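(* Let $\beta\ge0$ be an integer, $C_0,b,\sigma>0$, $\alpha=\min\{1,b\}$, $\overline C=C_0+b$, $\Xi=[0,1]\times[-\overline C,\overline C]$. Observations are $Y_i=y(x_i)+\varepsilon_i$, $i=1,\dots,n$, with fixed design points $x_i\in[0,\alpha]$ and $\varepsilon_i$ i.i.d. $\mathcal N(0,\sigma^2)$, where either (a) $y$ is a solution on $[0,\alpha]$ of $y'=f(y)$, $y(0)=y_0$, $|y_0|\le C_0$, $f\in\mathcal S_{\beta+1,1}(1,[-\overline C,\overline C])$, or (b) $y$ is a solution on $[0,\alpha]$ of $y'=f(x,y)$, $y(0)=y_0$, $|y_0|\le C_0$, $f\in\mathcal S_{\beta+1,2}(1,\Xi)$. Let $\mathcal E=\mathcal{AH}^\dagger_{\beta+2}$ in case (a) and $\mathcal E=\mathcal H^\dagger_{\beta+2}$ in case (b), and let $\hat y$ be any minimizer of $\frac1{2n}\sum_{i=1}^n(Y_i-\tilde y(x_i))^2$ over $\tilde y\in\mathcal E$. Define $$\bar r_n^2=\min_{\gamma\in\{0,\dots,\beta\}}\max\Big\{\frac{\sigma^2((\gamma\wedge n)\vee1)}n,\ \big[2^{\gamma+1}(\gamma+1)!\big]^{\frac2{2(\gamma+2)+1}}\Big(\frac{\sigma^2}n\Big)^{\frac{2(\gamma+2)}{2(\gamma+2)+1}}\Big\}.$$ Fix a universal constant $c_*>0$ and assume $\overline C\le c_*$. There exist universal constants $c_1,c_2,c_3>0$ (depending only on $c_*$) such that, in both cases, if $\max\{\alpha,C_0\}\ge c_1\bar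 r_n$ then $$\mathbb E\Big[\frac1n\sum_{i=1}^n(\hat y(x_i)-y(x_i))^2\Big]\le c_2\big(\bar r_n^2+\exp\{-c_3n\sigma^{-2}\bar r_n^2\}\big).$$
   Context: For a non-negative integer $\gamma$, $\rho>0$ and a box $B\subset\mathbb{R}^d$, $\mathcal S_{\gamma+1,d}(\rho,B)$ is the class of functions $h$ continuous on $B$ whose partial derivatives $D^ph$ exist for all multi-indices $p$ with $[p]\le\gamma$, satisfy $|D^ph(X)|\le\rho$ on $B$ for $[p]\le\gamma$, and $|D^ph(X)-D^ph(X')|\le\rho|X-X'|_\infty$ for $[p]=\gamma$. $\mathcal{AH}^\dagger_{\beta+2}$ is the set of $h:[0,\alpha]\to\mathbb{R}$ such that for every $k\in\{1,\dots,\beta+2\}$, $h^{(k-1)}$ is absolutely continuous and $\int_0^\alpha[h^{(k)}(t)]^2dt\le[(k-1)!]^2$. $\mathcal H^\dagger_{\beta+2}$ is the set of $h:[0,\alpha]\to\mathbb{R}$ such that for every $k\in\{1,\dots,\beta+2\}$, $h^{(k-1)}$ is absolutely continuous and $\int_0^\alpha[h^{(k)}(t)]^2dt\le[2^{k-1}(k-1)!]^2$. $a\wedge b=\min$, $a\vee b=\max$. *)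

theory Defs
  imports "HOL-Probability.Probability"
begin

definition abs_cont_on :: "real \<Rightarrow> real \<Rightarrow> (real \<Rightarrow> real) \<Rightarrow> bool" where
  "abs_cont_on a b f \<longleftrightarrow>
     (\<forall>\<epsilon>>0. \<exists>\<delta>>0. \<forall>(m::nat) (u::nat \<Rightarrow> real) v.
        (\<forall>i<m. a \<le> u i \<and> u i \<le> v i \<and> v i \<le> b) \<and>
        (\<forall>i<m. \<forall>j<m. i \<noteq> j \<longrightarrow> v i \<le> u j \<or> v j \<le> u i) \<and>
        (\<Sum>i<m. v i - u i) < \<delta>
        \<longrightarrow> (\<Sum>i<m. \<bar>f (v i) - f (u i)\<bar>) < \<epsilon>)"

definition S1 :: "nat \<Rightarrow> real \<Rightarrow> real set \<Rightarrow> (real \<Rightarrow> real) \<Rightarrow> bool" where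
  "S1 \<gamma> \<rho> B h \<longleftrightarrow> continuous_on B h \<and>
     (\<exists>D :: nat \<Rightarrow> real \<Rightarrow> real.
        (\<forall>t\<in>B. D 0 t = h t) \<and>
        (\<forall>k<\<gamma>. \<forall>t\<in>B. (D k has_real_derivative D (Suc k) t) (at t within B)) \<and>
        (\<forall>k\<le>\<gamma>. \<forall>t\<in>B. \<bar>D k t\<bar> \<le> \<rho>) \<and>
        (\<forall>t\<in>B. \<forall>t'\<in>B. \<bar>D \<gamma> t - D \<gamma> t'\<bar> \<le> \<rho> * \<bar>t - t'\<bar>))"

text \<open>S_{gamma+1,2}(rho,B) for the box B = [a1,b1] x [a2,b2]. D p q is the partial derivative
  D^(p,q) h = d^p/dx1^p d^q/dx2^q h (first q times in x2, then p times in x1).\<close>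
definition S2 :: "nat \<Rightarrow> real \<Rightarrow> real \<Rightarrow> real \<Rightarrow> real \<Rightarrow> real \<Rightarrow> (real \<Rightarrow> real \<Rightarrow> real) \<Rightarrow> bool" where
  "S2 \<gamma> \<rho> a1 b1 a2 b2 h \<longleftrightarrow> continuous_on ({a1..b1} \<times> {a2..b2}) (\<lambda>(s,t). h s t) \<and>
     (\<exists>D :: nat \<Rightarrow> nat \<Rightarrow> real \<Rightarrow> real \<Rightarrow> real.
        (\<forall>s\<in>{a1..b1}. \<forall>t\<in>{a2..b2}. D 0 0 s t = h s t) \<and>
        (\<forall>q<\<gamma>. \<forall>s\<in>{a1..b1}. \<forall>t\<in>{a2..b2}.
            ((\<lambda>t'. D 0 q s t') has_real_derivative D 0 (Suc q) s t) (at t within {a2..b2})) \<and>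
        (\<forall>p q. p + q < \<gamma> \<longrightarrow> (\<forall>s\<in>{a1..b1}. \<forall>t\<in>{a2..b2}.
            ((\<lambda>s'. D p q s' t) has_real_derivative D (Suc p) q s t) (at s within {a1..b1}))) \<and>
        (\<forall>p q. p + q \<le> \<gamma> \<longrightarrow> (\<forall>s\<in>{a1..b1}. \<forall>t\<in>{a2..b2}. \<bar>D p q s t\<bar> \<le> \<rho>)) \<and>
        (\<forall>p q. p + q = \<gamma> \<longrightarrow> (\<forall>s\<in>{a1..b1}. \<forall>t\<in>{a2..b2}. \<forall>s'\<in>{a1..b1}. \<forall>t'\<in>{a2..b2}.
            \<bar>D p q s t - D p q s' t'\<bar> \<le> \<rho> * max \<bar>s - s'\<bar> \<bar>t - t'\<bar>)))"

definition sob_class :: "real \<Rightarrow> nat \<Rightarrow> (nat \<Rightarrow> real) \<Rightarrow> (real \<Rightarrow> real) set" where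
  "sob_class \<alpha> m c = {h. \<exists>D :: nat \<Rightarrow> real \<Rightarrow> real.
      (\<forall>t\<in>{0..\<alpha>}. D 0 t = h t) \<and>
      (\<forall>k\<in>{1..m}. abs_cont_on 0 \<alpha> (D (k - 1)) \<and>
         (AE t in lebesgue. t \<in> {0..\<alpha>} \<longrightarrow>
             (D (k - 1) has_real_derivative D k t) (at t within {0..\<alpha>})) \<and>
         (\<integral>\<^sup>+ t\<in>{0..\<alpha>}. ennreal ((D k t)\<^sup>2) \<partial>lebesgue) \<le> ennreal ((c k)\<^sup>2))}"

definition AH_dagger :: "real \<Rightarrow> nat \<Rightarrow> (real \<Rightarrow> real) set" where
  "AH_dagger \<alpha> m = sob_class \<alpha> m (\<lambda>k. fact (k - 1))"

definition H_dagger :: "real \<Rightarrow> nat \<Rightarrow> (real \<Rightarrow> real) set" where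
  "H_dagger \<alpha> m = sob_class \<alpha> m (\<lambda>k. 2 ^ (k - 1) * fact (k - 1))"

definition ode_sol_aut :: "real \<Rightarrow> real \<Rightarrow> (real \<Rightarrow> real) \<Rightarrow> (real \<Rightarrow> real) \<Rightarrow> bool" where
  "ode_sol_aut \<alpha> y0 f y \<longleftrightarrow> y 0 = y0 \<and>
     (\<forall>t\<in>{0..\<alpha>}. (y has_real_derivative f (y t)) (at t within {0..\<alpha>}))"

definition ode_sol_nonaut :: "real \<Rightarrow> real \<Rightarrow> (real \<Rightarrow> real \<Rightarrow> real) \<Rightarrow> (real \<Rightarrow> real) \<Rightarrow> bool" where
  "ode_sol_nonaut \<alpha> y0 f y \<longleftrightarrow> y 0 = y0 \<and>
     (\<forall>t\<in>{0..\<alpha>}. (y has_real_derivative f t (y t)) (at t within {0..\<alpha>}))"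

definition ls_obj :: "nat \<Rightarrow> (nat \<Rightarrow> real) \<Rightarrow> (nat \<Rightarrow> real) \<Rightarrow> (real \<Rightarrow> real) \<Rightarrow> real" where
  "ls_obj n x Y h = (1 / (2 * real n)) * (\<Sum>i<n. (Y i - h (x i))\<^sup>2)"

definition is_ls_estimator :: "nat \<Rightarrow> (nat \<Rightarrow> real) \<Rightarrow> (real \<Rightarrow> real) set \<Rightarrow>
    ((nat \<Rightarrow> real) \<Rightarrow> real \<Rightarrow> real) \<Rightarrow> bool" where
  "is_ls_estimator n x E yhat \<longleftrightarrow>
     (\<forall>Y. yhat Y \<in> E \<and> (\<forall>h\<in>E. ls_obj n x Y (yhat Y) \<le> ls_obj n x Y h))"

definition ls_risk :: "nat \<Rightarrow> real \<Rightarrow> (nat \<Rightarrow> real) \<Rightarrow> (real \<Rightarrow> real) \<Rightarrow>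
    ((nat \<Rightarrow> real) \<Rightarrow> real \<Rightarrow> real) \<Rightarrow> ennreal" where
  "ls_risk n \<sigma> x y yhat =
     (\<integral>\<^sup>+ \<epsilon>. ennreal ((1 / real n) *
          (\<Sum>i<n. (yhat (\<lambda>j. y (x j) + \<epsilon> j) (x i) - y (x i))\<^sup>2))
      \<partial>(PiM {..<n} (\<lambda>_. density lborel (normal_density 0 \<sigma>))))"

definition rbar2 :: "nat \<Rightarrow> real \<Rightarrow> nat \<Rightarrow> real" where
  "rbar2 \<beta> \<sigma> n = Min ((\<lambda>\<gamma>::nat. max
       (\<sigma>\<^sup>2 * real (max (min \<gamma> n) 1) / real n)
       ((2 ^ (\<gamma> + 1) * fact (\<gamma> + 1)) powr (2 / (2 * (real \<gamma> + 2) + 1)) *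
        (\<sigma>\<^sup>2 / real n) powr (2 * (real \<gamma> + 2) / (2 * (real \<gamma> + 2) + 1)))) ` {0..\<beta>})"

end

theory Submission
  imports Defs
begin

text \<open>The derivatives of a solution are sums of products of partial derivatives of the right-hand side,
  and counting the terms puts the solution in the closure of the class \<open>E\<close>. Hence the error \<open>\<Delta>\<close> of the
  least squares estimator satisfies \<open>\<parallel>\<Delta>\<parallel>\<^sup>2 \<le> 2 \<langle>\<epsilon>, \<Delta>\<rangle>\<close>. Piecewise Taylor
  polynomials of degree below \<open>m = \<gamma> + 2\<close> on about \<open>J\<close> cells approximate all of \<open>E\<close> on the design up to a
  squared error of order \<open>4\<^sup>m J\<^bsup>-2m\<^esup>\<close> and span a space of dimension of order \<open>m J\<close>. Chaining along the
  resolutions \<open>J, 2J, 4J, \<dots>\<close> bounds the risk by a multiple of \<open>\<sigma>\<^sup>2 m J / n + 4\<^sup>m J\<^bsup>-2m\<^esup>\<close>.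
  Optimising \<open>J\<close> yields the rate.\<close>

section \<open>Gaussian noise and orthonormal systems\<close>

text \<open>One approximating space does not suffice: what it misses of \<open>\<Delta>\<close>
  correlates with the noise, and Cauchy-Schwarz against the full noise energy costs more than the
  rate. Chaining defers that crude step to a resolution where it is negligible. The approximants
  depend on the noise, but their increments lie in linear spaces fixed by the design alone, so the
  projected noise energy, of mean \<open>\<sigma>\<^sup>2\<close> times the dimension, replaces any
  entropy estimate. All inequalities before the expectation hold for each noise vector, hence no
  measurability of the estimator enters.

  The derivative of order m is bounded in L2 only, so the squared Taylor error on a cell is of order
  J^-(2m-1) times the local energy. The missing factor 1/J comes from counting design points per
  cell, which forces the cells to adapt to the design.

  Constants must not grow with the smoothness. The factorial in the derivative bounds cancels
  against the Taylor denominator and leaves a power of 2; for n <= \<open>\<gamma>\<close> counting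
  dimensions is useless and a bound of order \<open>\<sigma>\<^sup>2\<close> takes over.\<close>

lemma nn_integral_normal_affine_square:
  fixes \<sigma> a b :: real
  assumes "\<sigma> > 0"
  shows "(\<integral>\<^sup>+ y. ennreal ((a + b * y)\<^sup>2) \<partial>density lborel (normal_density 0 \<sigma>)) = ennreal (a\<^sup>2 + b\<^sup>2 * \<sigma>\<^sup>2)"
proof -
  have 0: "has_bochner_integral lborel (\<lambda>x. normal_density 0 \<sigma> x) 1"
    using normal_moment_even[OF assms, of 0 0] by simp
  have 1: "has_bochner_integral lborel (\<lambda>x. normal_density 0 \<sigma> x * x) 0"
    using normal_moment_odd[OF assms, of 0 0] by simp
  have 2: "has_bochner_integral lborel (\<lambda>x. normal_density 0 \<sigma> x * x\<^sup>2) (\<sigma>\<^sup>2)"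
    using normal_moment_even[OF assms, of 0 1] by (simp add: eval_nat_numeral)
  have 3: "has_bochner_integral lborel
     (\<lambda>x. a\<^sup>2 * normal_density 0 \<sigma> x + (2 * a * b) * (normal_density 0 \<sigma> x * x)
        + b\<^sup>2 * (normal_density 0 \<sigma> x * x\<^sup>2)) (a\<^sup>2 * 1 + (2 * a * b) * 0 + b\<^sup>2 * \<sigma>\<^sup>2)"
    by (intro has_bochner_integral_add has_bochner_integral_mult_right 0 1 2)
  have eq: "a\<^sup>2 * normal_density 0 \<sigma> x + (2 * a * b) * (normal_density 0 \<sigma> x * x)
        + b\<^sup>2 * (normal_density 0 \<sigma> x * x\<^sup>2) = normal_density 0 \<sigma> x * (a + b * x)\<^sup>2" for x
    by (simp add: power2_eq_square algebra_simps)
  have "(\<integral>\<^sup>+ y. ennreal ((a + b * y)\<^sup>2) \<partial>density lborel (normal_density 0 \<sigma>)) =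
    (\<integral>\<^sup>+ y. ennreal (normal_density 0 \<sigma> y * (a + b * y)\<^sup>2) \<partial>lborel)"
    by (subst nn_integral_density) (auto simp: ennreal_mult)
  also have "\<dots> = ennreal (a\<^sup>2 + b\<^sup>2 * \<sigma>\<^sup>2)"
    using 3 unfolding eq
    by (subst nn_integral_eq_integral) (auto simp: has_bochner_integral_iff)
  finally show ?thesis .
qed

abbreviation gauss :: "real \<Rightarrow> real measure" where
  "gauss \<sigma> \<equiv> density lborel (normal_density 0 \<sigma>)"

lemma product_sigma_finite_gauss:
  assumes "\<sigma> > 0" shows "product_sigma_finite (\<lambda>_::nat. gauss \<sigma>)"
proof -
  interpret prob_space "gauss \<sigma>" by (rule prob_space_normal_density[OF assms])
  show ?thesis by unfold_locales
qed

lemma prob_space_PiM_gauss: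
  assumes "\<sigma> > 0" shows "prob_space (PiM I (\<lambda>_. gauss \<sigma>))"
  by (intro prob_space_PiM prob_space_normal_density assms)

text \<open>One coordinate is integrated out at a time: the others act as the constant
  \<open>a\<close> of the affine form, and the vanishing first moment removes the cross
  term.\<close>

lemma nn_integral_gauss_linear_square:
  assumes "\<sigma> > 0" and "finite I"
  shows "(\<integral>\<^sup>+ \<epsilon>. ennreal ((\<Sum>i\<in>I. e i * \<epsilon> i)\<^sup>2) \<partial>PiM I (\<lambda>_::nat. gauss \<sigma>)) = ennreal (\<sigma>\<^sup>2 * (\<Sum>i\<in>I. (e i)\<^sup>2))"
  using assms(2)
proof (induction I)
  case empty
  then show ?case by simp
next
  case (insert j I)
  interpret product_sigma_finite "\<lambda>_::nat. gauss \<sigma>" by (rule product_sigma_finite_gauss[OF assms(1)])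
  interpret P: prob_space "PiM I (\<lambda>_::nat. gauss \<sigma>)" by (rule prob_space_PiM_gauss[OF assms(1)])
  have m: "(\<lambda>\<epsilon>. ennreal ((\<Sum>i\<in>insert j I. e i * \<epsilon> i)\<^sup>2)) \<in> borel_measurable (PiM (insert j I) (\<lambda>_::nat. gauss \<sigma>))"
    by measurable
  have up: "(\<Sum>i\<in>insert j I. e i * (x(j := y)) i) = (\<Sum>i\<in>I. e i * x i) + e j * y" for x y
  proof -
    have "(\<Sum>i\<in>I. e i * (x(j := y)) i) = (\<Sum>i\<in>I. e i * x i)"
      using insert.hyps by (intro sum.cong) auto
    then show ?thesis using insert.hyps by simp
  qed
  have "(\<integral>\<^sup>+ \<epsilon>. ennreal ((\<Sum>i\<in>insert j I. e i * \<epsilon> i)\<^sup>2) \<partial>PiM (insert j I) (\<lambda>_::nat. gauss \<sigma>))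
     = (\<integral>\<^sup>+ x. (\<integral>\<^sup>+ y. ennreal (((\<Sum>i\<in>I. e i * x i) + e j * y)\<^sup>2) \<partial>gauss \<sigma>) \<partial>PiM I (\<lambda>_. gauss \<sigma>))"
    by (subst product_nn_integral_insert[OF insert.hyps m]) (simp only: up)
  also have "\<dots> = (\<integral>\<^sup>+ x. ennreal ((\<Sum>i\<in>I. e i * x i)\<^sup>2) + ennreal ((e j)\<^sup>2 * \<sigma>\<^sup>2) \<partial>PiM I (\<lambda>_. gauss \<sigma>))"
    by (simp add: nn_integral_normal_affine_square[OF assms(1)] ennreal_plus)
  also have "\<dots> = ennreal (\<sigma>\<^sup>2 * (\<Sum>i\<in>I. (e i)\<^sup>2)) + ennreal ((e j)\<^sup>2 * \<sigma>\<^sup>2)"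
    by (subst nn_integral_add) (auto simp: insert.IH P.emeasure_space_1)
  also have "\<dots> = ennreal (\<sigma>\<^sup>2 * (\<Sum>i\<in>insert j I. (e i)\<^sup>2))"
    using insert.hyps by (subst ennreal_plus[symmetric]) (auto simp: algebra_simps sum_nonneg)
  finally show ?case .
qed

lemma gram_schmidt_finite:
  fixes v :: "'a \<Rightarrow> nat \<Rightarrow> real" and n :: nat
  assumes "finite I"
  defines "ip \<equiv> \<lambda>f g::nat \<Rightarrow> real. \<Sum>i<n. f i * g i"
  shows "\<exists>e. (\<forall>k\<in>I. ip (e k) (e k) = 0 \<or> ip (e k) (e k) = 1) \<and> (\<forall>k\<in>I. \<forall>l\<in>I. k \<noteq> l \<longrightarrow> ip (e k) (e l) = 0)
    \<and> (\<forall>k\<in>I. \<exists>d. \<forall>i<n. v k i = (\<Sum>l\<in>I. d l * e l i))"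
  using assms(1)
proof (induction I)
  case empty
  then show ?case by simp
next
  case (insert j I)
  then obtain e where n: "\<And>k. k \<in> I \<Longrightarrow> ip (e k) (e k) = 0 \<or> ip (e k) (e k) = 1"
    and o: "\<And>k l. k \<in> I \<Longrightarrow> l \<in> I \<Longrightarrow> k \<noteq> l \<Longrightarrow> ip (e k) (e l) = 0"
    and s: "\<And>k. k \<in> I \<Longrightarrow> \<exists>d. \<forall>i<n. v k i = (\<Sum>l\<in>I. d l * e l i)" by metis
  have z: "f i = 0" if "ip f f = 0" "i < n" for f i
    using that unfolding ip_def by (subst (asm) sum_nonneg_eq_0_iff) auto
  have ip0: "ip f g = 0" if "ip g g = 0" for f g
    using z[OF that] unfolding ip_def by (intro sum.neutral) auto
  have sym: "ip f g = ip g f" for f g unfolding ip_def by (simp add: mult.commute)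
  define r where "r i = v j i - (\<Sum>l\<in>I. ip (v j) (e l) * e l i)" for i
  have r0: "ip r (e k) = 0" if k: "k \<in> I" for k
  proof -
    have "ip r (e k) = ip (v j) (e k) - (\<Sum>i<n. \<Sum>l\<in>I. ip (v j) (e l) * e l i * e k i)"
      unfolding r_def by (simp add: ip_def left_diff_distrib sum_subtractf sum_distrib_right)
    also have "(\<Sum>i<n. \<Sum>l\<in>I. ip (v j) (e l) * e l i * e k i) = (\<Sum>l\<in>I. ip (v j) (e l) * ip (e l) (e k))"
      by (subst sum.swap) (simp add: ip_def sum_distrib_left mult.assoc)
    also have "\<dots> = (\<Sum>l\<in>I. if l = k then ip (v j) (e k) else 0)"
      using n[OF k] o[OF _ k] ip0 by (intro sum.cong) fastforce+
    finally show ?thesis using insert.hyps k by simp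
  qed
  \<comment> \<open>If the residual \<open>r\<close> vanishes on the first \<open>n\<close>
    coordinates, division by zero makes the new vector 0.\<close>
  define E where "E = e(j := (\<lambda>i. r i / sqrt (ip r r)))"
  have Ek: "k \<in> I \<Longrightarrow> E k = e k" for k using insert.hyps unfolding E_def by auto
  have Ej: "E j = (\<lambda>i. r i / sqrt (ip r r))" unfolding E_def by simp
  have rr: "ip r r \<ge> 0" unfolding ip_def by (intro sum_nonneg) auto
  have "ip (E j) (E j) = ip r r / (sqrt (ip r r))\<^sup>2"
    unfolding Ej ip_def by (simp add: sum_divide_distrib power2_eq_square)
  then have nj: "ip (E j) (E j) = 0 \<or> ip (E j) (E j) = 1" using rr by auto
  have oj: "ip (E j) (E k) = 0" if "k \<in> I" for k
  proof -
    have "ip (E j) (E k) = ip r (e k) / sqrt (ip r r)"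
      unfolding Ek[OF that] Ej ip_def by (simp add: sum_divide_distrib)
    then show ?thesis using r0[OF that] by simp
  qed
  have sp: "\<exists>d. \<forall>i<n. v k i = (\<Sum>l\<in>insert j I. d l * E l i)" if k: "k \<in> insert j I" for k
  proof (cases "k = j")
    case True
    have "v j i = (\<Sum>l\<in>insert j I. ((\<lambda>l. ip (v j) (e l))(j := sqrt (ip r r))) l * E l i)" if "i < n" for i
    proof -
      have "sqrt (ip r r) * E j i = r i" using z[OF _ that, of r] unfolding Ej by auto
      moreover have "(\<Sum>l\<in>I. ((\<lambda>l. ip (v j) (e l))(j := sqrt (ip r r))) l * E l i) = (\<Sum>l\<in>I. ip (v j) (e l) * e l i)"
        using insert.hyps Ek by (intro sum.cong) auto
      ultimately show ?thesis using insert.hyps by (simp add: r_def)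
    qed
    then show ?thesis using True by blast
  next
    case False
    then obtain d where d: "\<forall>i<n. v k i = (\<Sum>l\<in>I. d l * e l i)" using s k by blast
    have "(\<Sum>l\<in>insert j I. (d(j := 0)) l * E l i) = (\<Sum>l\<in>I. d l * e l i)" for i
    proof -
      have "(\<Sum>l\<in>I. (d(j := 0)) l * E l i) = (\<Sum>l\<in>I. d l * e l i)"
        using insert.hyps Ek by (intro sum.cong) auto
      then show ?thesis using insert.hyps by simp
    qed
    then show ?thesis using d by metis
  qed
  show ?case
  proof (intro exI[of _ E] conjI ballI impI)
    show "ip (E k) (E k) = 0 \<or> ip (E k) (E k) = 1" if "k \<in> insert j I" for k
      using that nj n Ek by (metis insert_iff)
    show "ip (E k) (E l) = 0" if "k \<in> insert j I" "l \<in> insert j I" "k \<noteq> l" for k l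
      using that oj sym o Ek by (metis insert_iff)
  qed (use sp in auto)
qed

text \<open>For w in the span, the pairing of the noise with w equals that of its projection with w;
  Cauchy-Schwarz then separates a factor depending on \<open>\<epsilon>\<close> alone. The
  coefficients \<open>c\<close> come after \<open>e\<close>, so they may depend on the
  noise.\<close>

lemma orthonormal_cover:
  fixes v :: "'a \<Rightarrow> nat \<Rightarrow> real" and n :: nat
  assumes "finite I"
  shows "\<exists>e. (\<forall>k\<in>I. (\<Sum>i<n. (e k i)\<^sup>2) \<le> 1) \<and>
    (\<forall>\<epsilon> c. (\<Sum>i<n. \<epsilon> i * (\<Sum>k\<in>I. c k * v k i))\<^sup>2
       \<le> (\<Sum>k\<in>I. (\<Sum>i<n. e k i * \<epsilon> i)\<^sup>2) * (\<Sum>i<n. (\<Sum>k\<in>I. c k * v k i)\<^sup>2))"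
proof -
  define ip where "ip f g = (\<Sum>i<n. f i * g i)" for f g :: "nat \<Rightarrow> real"
  from gram_schmidt_finite[OF assms(1), of n v, folded ip_def] obtain e d
    where n: "\<And>k. k \<in> I \<Longrightarrow> ip (e k) (e k) = 0 \<or> ip (e k) (e k) = 1"
    and o: "\<And>k l. k \<in> I \<Longrightarrow> l \<in> I \<Longrightarrow> k \<noteq> l \<Longrightarrow> ip (e k) (e l) = 0"
    and s: "\<And>k i. k \<in> I \<Longrightarrow> i < n \<Longrightarrow> v k i = (\<Sum>l\<in>I. d k l * e l i)" by metis
  have z: "f i = 0" if "ip f f = 0" "i < n" for f i
    using that unfolding ip_def by (subst (asm) sum_nonneg_eq_0_iff) auto
  have "(\<Sum>i<n. \<epsilon> i * (\<Sum>k\<in>I. c k * v k i))\<^sup>2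
       \<le> (\<Sum>k\<in>I. (\<Sum>i<n. e k i * \<epsilon> i)\<^sup>2) * (\<Sum>i<n. (\<Sum>k\<in>I. c k * v k i)\<^sup>2)" for \<epsilon> c
  proof -
    define w where "w i = (\<Sum>k\<in>I. c k * v k i)" for i
    \<comment> \<open>The coefficient of a vanishing vector is immaterial for \<open>w\<close>;
      choosing 0 makes the Parseval identity \<open>ww\<close> exact.\<close>
    define a where "a l = (if ip (e l) (e l) = 0 then 0 else (\<Sum>k\<in>I. c k * d k l))" for l
    have w: "w i = (\<Sum>l\<in>I. a l * e l i)" if i: "i < n" for i
    proof -
      have "w i = (\<Sum>k\<in>I. \<Sum>l\<in>I. c k * d k l * e l i)"
        unfolding w_def using s[OF _ i] by (intro sum.cong) (auto simp: sum_distrib_left mult.assoc)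
      also have "\<dots> = (\<Sum>l\<in>I. (\<Sum>k\<in>I. c k * d k l) * e l i)"
        by (subst sum.swap) (simp add: sum_distrib_right)
      also have "\<dots> = (\<Sum>l\<in>I. a l * e l i)"
        unfolding a_def using z[OF _ i] by (intro sum.cong) auto
      finally show ?thesis .
    qed
    have ww: "(\<Sum>i<n. (w i)\<^sup>2) = (\<Sum>l\<in>I. (a l)\<^sup>2)"
    proof -
      have "(\<Sum>i<n. (w i)\<^sup>2) = (\<Sum>i<n. \<Sum>l\<in>I. \<Sum>k\<in>I. a l * a k * (e l i * e k i))"
        by (intro sum.cong) (auto simp: w power2_eq_square sum_product mult_ac)
      also have "\<dots> = (\<Sum>l\<in>I. \<Sum>k\<in>I. a l * a k * ip (e l) (e k))"
        unfolding ip_def sum_distrib_left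
        by (subst sum.swap, intro sum.cong refl, subst sum.swap, rule refl)
      also have "\<dots> = (\<Sum>l\<in>I. \<Sum>k\<in>I. if k = l then (a l)\<^sup>2 else 0)"
        using o n unfolding a_def by (intro sum.cong refl) (fastforce simp: power2_eq_square)
      finally show ?thesis using assms by simp
    qed
    have "(\<Sum>i<n. \<epsilon> i * w i) = (\<Sum>i<n. \<Sum>l\<in>I. a l * (e l i * \<epsilon> i))"
      by (intro sum.cong) (auto simp: w sum_distrib_left mult_ac)
    also have "\<dots> = (\<Sum>l\<in>I. a l * (\<Sum>i<n. e l i * \<epsilon> i))"
      by (subst sum.swap) (simp add: sum_distrib_left)
    finally have "(\<Sum>i<n. \<epsilon> i * w i)\<^sup>2 \<le> (\<Sum>l\<in>I. (a l)\<^sup>2) * (\<Sum>l\<in>I. (\<Sum>i<n. e l i * \<epsilon> i)\<^sup>2)"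
      by (simp add: Cauchy_Schwarz_ineq_sum)
    then show ?thesis using ww by (simp add: w_def mult.commute)
  qed
  moreover have "(\<Sum>i<n. (e k i)\<^sup>2) \<le> 1" if "k \<in> I" for k
    using n[OF that] unfolding ip_def power2_eq_square by auto
  ultimately show ?thesis by blast
qed

section \<open>Absolutely continuous functions\<close>

text \<open>\<open>abs_cont_on\<close> speaks of families indexed by initial segments of the
  naturals; the gauge argument below indexes by the tagged intervals themselves.\<close>

lemma abs_cont_onD:
  fixes f :: "real \<Rightarrow> real"
  assumes "abs_cont_on a b f" "\<epsilon> > 0"
  shows "\<exists>\<delta>>0. \<forall>(P::'i set) u v. finite P \<longrightarrow> (\<forall>p\<in>P. a \<le> u p \<and> u p \<le> v p \<and> v p \<le> b) \<longrightarrow>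
     (\<forall>p\<in>P. \<forall>q\<in>P. p \<noteq> q \<longrightarrow> v p \<le> u q \<or> v q \<le> u p) \<longrightarrow> (\<Sum>p\<in>P. v p - u p) < \<delta> \<longrightarrow>
     (\<Sum>p\<in>P. \<bar>f (v p) - f (u p)\<bar>) < \<epsilon>"
proof -
  from assms(1)[unfolded abs_cont_on_def, rule_format, OF assms(2)] obtain \<delta> where \<delta>: "\<delta> > 0"
    and *: "\<forall>(m::nat) (u::nat \<Rightarrow> real) v.
        (\<forall>i<m. a \<le> u i \<and> u i \<le> v i \<and> v i \<le> b) \<and>
        (\<forall>i<m. \<forall>j<m. i \<noteq> j \<longrightarrow> v i \<le> u j \<or> v j \<le> u i) \<and>
        (\<Sum>i<m. v i - u i) < \<delta>
        \<longrightarrow> (\<Sum>i<m. \<bar>f (v i) - f (u i)\<bar>) < \<epsilon>"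
    by (elim exE conjE)
  show ?thesis
  proof (intro exI[of _ \<delta>] conjI allI impI \<delta>)
    fix P :: "'i set" and u v :: "'i \<Rightarrow> real"
    assume P: "finite P" and 1: "\<forall>p\<in>P. a \<le> u p \<and> u p \<le> v p \<and> v p \<le> b"
      and 2: "\<forall>p\<in>P. \<forall>q\<in>P. p \<noteq> q \<longrightarrow> v p \<le> u q \<or> v q \<le> u p"
      and 3: "(\<Sum>p\<in>P. v p - u p) < \<delta>"
    obtain h where h: "bij_betw h {..<card P} P"
      using ex_bij_betw_nat_finite[OF P] atLeast0LessThan by metis
    have hP: "h i \<in> P" if "i < card P" for i using h that by (auto simp: bij_betw_def)
    have hi: "h i \<noteq> h j" if "i < card P" "j < card P" "i \<noteq> j" for i j
      using h that by (auto simp: bij_betw_def inj_on_def)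
    have re: "(\<Sum>i<card P. F (h i)) = (\<Sum>p\<in>P. F p)" for F :: "'i \<Rightarrow> real"
      using sum.reindex_bij_betw[OF h] .
    have "(\<Sum>i<card P. \<bar>f ((v \<circ> h) i) - f ((u \<circ> h) i)\<bar>) < \<epsilon>"
      by (rule *[rule_format]) (use 1 2 3 hP hi re[of "\<lambda>p. v p - u p"] in auto)
    then show "(\<Sum>p\<in>P. \<bar>f (v p) - f (u p)\<bar>) < \<epsilon>"
      using re[of "\<lambda>p. \<bar>f (v p) - f (u p)\<bar>"] by simp
  qed
qed

lemma abs_cont_on_imp_continuous_on:
  assumes "abs_cont_on a b f"
  shows "continuous_on {a..b} f"
  unfolding continuous_on_iff
proof (intro ballI allI impI)
  fix x e :: real assume x: "x \<in> {a..b}" and "e > 0"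
  from abs_cont_onD[OF assms \<open>e > 0\<close>, where 'i=unit] obtain \<delta> where \<delta>: "\<delta> > 0"
    and *: "\<forall>(P::unit set) u v. finite P \<longrightarrow> (\<forall>p\<in>P. a \<le> u p \<and> u p \<le> v p \<and> v p \<le> b) \<longrightarrow>
     (\<forall>p\<in>P. \<forall>q\<in>P. p \<noteq> q \<longrightarrow> v p \<le> u q \<or> v q \<le> u p) \<longrightarrow> (\<Sum>p\<in>P. v p - u p) < \<delta> \<longrightarrow>
     (\<Sum>p\<in>P. \<bar>f (v p) - f (u p)\<bar>) < e" by (elim exE conjE)
  have "dist (f y) (f x) < e" if y: "y \<in> {a..b}" "dist y x < \<delta>" for y
  proof (cases "x \<le> y")
    case True
    then show ?thesis using *[rule_format, of UNIV "\<lambda>_. x" "\<lambda>_. y"] x y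
      by (simp add: dist_real_def)
  next
    case False
    then show ?thesis using *[rule_format, of UNIV "\<lambda>_. y" "\<lambda>_. x"] x y
      by (simp add: dist_real_def abs_minus_commute)
  qed
  then show "\<exists>d>0. \<forall>x'\<in>{a..b}. dist x' x < d \<longrightarrow> dist (f x') (f x) < e" using \<delta> by blast
qed

lemma abs_cont_on_subinterval:
  assumes "abs_cont_on a b f" "a \<le> a'" "b' \<le> b"
  shows "abs_cont_on a' b' f"
  unfolding abs_cont_on_def
proof (intro allI impI)
  fix \<epsilon> :: real assume "\<epsilon> > 0"
  from assms(1)[unfolded abs_cont_on_def, rule_format, OF this] obtain \<delta> where \<delta>: "\<delta> > 0"
    and *: "\<forall>(m::nat) (u::nat \<Rightarrow> real) v.
        (\<forall>i<m. a \<le> u i \<and> u i \<le> v i \<and> v i \<le> b) \<and>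
        (\<forall>i<m. \<forall>j<m. i \<noteq> j \<longrightarrow> v i \<le> u j \<or> v j \<le> u i) \<and>
        (\<Sum>i<m. v i - u i) < \<delta>
        \<longrightarrow> (\<Sum>i<m. \<bar>f (v i) - f (u i)\<bar>) < \<epsilon>"
    by (elim exE conjE)
  show "\<exists>\<delta>>0. \<forall>(m::nat) (u::nat \<Rightarrow> real) v.
        (\<forall>i<m. a' \<le> u i \<and> u i \<le> v i \<and> v i \<le> b') \<and>
        (\<forall>i<m. \<forall>j<m. i \<noteq> j \<longrightarrow> v i \<le> u j \<or> v j \<le> u i) \<and>
        (\<Sum>i<m. v i - u i) < \<delta>
        \<longrightarrow> (\<Sum>i<m. \<bar>f (v i) - f (u i)\<bar>) < \<epsilon>"
  proof (intro exI[of _ \<delta>] conjI allI impI \<delta>)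
    fix m :: nat and u v :: "nat \<Rightarrow> real"
    assume A: "(\<forall>i<m. a' \<le> u i \<and> u i \<le> v i \<and> v i \<le> b') \<and>
        (\<forall>i<m. \<forall>j<m. i \<noteq> j \<longrightarrow> v i \<le> u j \<or> v j \<le> u i) \<and>
        (\<Sum>i<m. v i - u i) < \<delta>"
    then have "\<forall>i<m. a \<le> u i \<and> u i \<le> v i \<and> v i \<le> b"
      using assms(2,3) by (meson order_trans)
    with A show "(\<Sum>i<m. \<bar>f (v i) - f (u i)\<bar>) < \<epsilon>"
      by (intro *[rule_format]) simp
  qed
qed

text \<open>Gauge-integral proof: on tags in the exceptional null set the increments of \<open>f\<close> are
  controlled by absolute continuity, elsewhere by the derivative.\<close>

theorem abs_cont_on_has_integral_derivative:
  fixes f g :: "real \<Rightarrow> real"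
  assumes ab: "a \<le> b" and ac: "abs_cont_on a b f" and N: "negligible N"
    and deriv: "\<And>x. x \<in> {a..b} - N \<Longrightarrow> (f has_real_derivative g x) (at x within {a..b})"
  shows "(g has_integral (f b - f a)) {a..b}"
proof -
  \<comment> \<open>The values of \<open>g\<close> on \<open>N\<close> are arbitrary; zero there
    removes them from the Riemann sums and changes \<open>g\<close> on a negligible set
    only.\<close>
  define g0 where "g0 x = (if x \<in> N then 0 else g x)" for x
  have "(g0 has_integral (f b - f a)) {a..b}"
    unfolding has_integral_real
  proof (intro allI impI)
    fix e :: real assume e: "e > 0"
    \<comment> \<open>Half of the error budget spread over the length of the interval; the summand 1
      covers \<open>a = b\<close>.\<close>
    define e1 where "e1 = e / (2 * (b - a + 1))"
    have e1: "e1 > 0" using e ab by (simp add: e1_def)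
    have "\<exists>d>0. x \<in> {a..b} - N \<longrightarrow>
         (\<forall>y\<in>{a..b}. \<bar>y-x\<bar> < d \<longrightarrow> \<bar>f y - f x - (y-x) * g x\<bar> \<le> e1 * \<bar>y-x\<bar>)" for x
    proof (cases "x \<in> {a..b} - N")
      case True
      from deriv[OF True] have "(f has_derivative (\<lambda>h. h * g x)) (at x within {a..b})"
        by (simp add: has_field_derivative_def mult_commute_abs)
      then show ?thesis using e1 unfolding has_derivative_within_alt by auto
    qed (auto intro: zero_less_one)
    then obtain d where d: "\<And>x. 0 < d x"
      "\<And>x y. \<lbrakk>x \<in> {a..b} - N; y \<in> {a..b}; \<bar>y-x\<bar> < d x\<rbrakk> \<Longrightarrow> \<bar>f y - f x - (y-x) * g x\<bar> \<le> e1 * \<bar>y-x\<bar>"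
      by metis
    have e2: "e/2 > 0" using e by simp
    from abs_cont_onD[OF ac e2, where 'i="real \<times> real set"] obtain \<delta> where \<delta>: "\<delta> > 0"
      and acd: "\<forall>(P::(real \<times> real set) set) u v. finite P \<longrightarrow> (\<forall>p\<in>P. a \<le> u p \<and> u p \<le> v p \<and> v p \<le> b) \<longrightarrow>
         (\<forall>p\<in>P. \<forall>q\<in>P. p \<noteq> q \<longrightarrow> v p \<le> u q \<or> v q \<le> u p) \<longrightarrow> (\<Sum>p\<in>P. v p - u p) < \<delta> \<longrightarrow>
         (\<Sum>p\<in>P. \<bar>f (v p) - f (u p)\<bar>) < e/2" by (elim exE conjE)
    \<comment> \<open>The gauge will confine the intervals tagged in \<open>N\<close> to
      \<open>U\<close>, so their total length stays below the threshold
      \<open>\<delta>\<close>.\<close>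
    obtain U where U: "open U" "N \<subseteq> U" "U \<in> lmeasurable" "measure lebesgue U < \<delta>"
    proof -
      have 0: "N \<in> null_sets lebesgue" using N by (simp add: negligible_iff_null_sets)
      then obtain U where U: "open U" "N \<subseteq> U" "U - N \<in> lmeasurable" "emeasure lebesgue (U - N) < ennreal \<delta>"
        using sets_lebesgue_outer_open[of N \<delta>] \<delta> by auto
      have "emeasure lebesgue U < ennreal \<delta>"
        using U(4) emeasure_Diff_null_set[OF 0, of U] U(1) by simp
      moreover from this have "U \<in> lmeasurable"
        using U(1) by (auto simp: fmeasurable_def less_top intro: order_less_trans)
      ultimately have "U \<in> lmeasurable \<and> measure lebesgue U < \<delta>"
        using \<delta> by (simp add: emeasure_eq_measure2 ennreal_less_iff)
      then show thesis using U that by blast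
    qed
    have "\<exists>r>0. ball x r \<subseteq> U" if "x \<in> N" for x
      using that U by (meson open_contains_ball subsetD)
    then obtain r where r: "\<And>x. x \<in> N \<Longrightarrow> r x > 0 \<and> ball x (r x) \<subseteq> U" by metis
    define \<gamma> where "\<gamma> x = ball x (if x \<in> N then r x else d x)" for x
    have "gauge \<gamma>" unfolding \<gamma>_def using r d by (intro gauge_ball_dependent) auto
    moreover have "norm ((\<Sum>(x,k)\<in>p. measure lborel k *\<^sub>R g0 x) - (f b - f a)) < e"
      if ptag: "p tagged_division_of {a..b}" and fine: "\<gamma> fine p" for p
    proof -
      have fin: "finite p" using ptag by blast
      have K: "\<exists>u v. K = {u..v} \<and> a \<le> u \<and> u \<le> v \<and> v \<le> b \<and> x \<in> K \<and> x \<in> {a..b}" if "(x,K) \<in> p" for x K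
      proof -
        have "x \<in> K" "K \<subseteq> {a..b}" "\<exists>u v. K = cbox u v" using ptag that by (auto simp: tagged_division_of)
        then show ?thesis by fastforce
      qed
      define L where "L q = Inf (snd q)" for q :: "real \<times> real set"
      define R where "R q = Sup (snd q)" for q :: "real \<times> real set"
      have LR: "a \<le> L q" "L q \<le> R q" "R q \<le> b" "snd q = {L q..R q}" "fst q \<in> {L q..R q}" "fst q \<in> {a..b}" if qp: "q \<in> p" for q
      proof -
        obtain u v where uv: "snd q = {u..v}" "a \<le> u" "u \<le> v" "v \<le> b" "fst q \<in> snd q"
          using K[of "fst q" "snd q"] qp by auto
        then have "L q = u" "R q = v" unfolding L_def R_def by simp_all
        with uv show "a \<le> L q" "L q \<le> R q" "R q \<le> b" "snd q = {L q..R q}" "fst q \<in> {L q..R q}" "fst q \<in> {a..b}"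
          by simp_all
      qed
      have ba: "b - a = (\<Sum>q\<in>p. R q - L q)" "f b - f a = (\<Sum>q\<in>p. f(R q) - f(L q))"
        using additive_tagged_division_1[where f= "\<lambda>x. x"] additive_tagged_division_1[where f= f]
            ab ptag by (auto simp: R_def L_def split_def)
      \<comment> \<open>Degenerate intervals are left out: they contribute nothing, and one may lie
        inside another interval of the division, which would violate the separation demanded by
        absolute continuity.\<close>
      define A where "A = {q\<in>p. fst q \<in> N \<and> L q < R q}"
      define B where "B = {q\<in>p. fst q \<notin> N}"
      have co: "measure lborel (snd q) = R q - L q" if "q \<in> p" for q using LR[OF that] by simp
      have tm: "\<bar>measure lborel (snd q) * g0 (fst q) - (f (R q) - f (L q))\<bar> \<le>
          (if q \<in> A then \<bar>f (R q) - f (L q)\<bar> else 0) + e1 * (R q - L q)" if q: "q \<in> p" for q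
      proof (cases "fst q \<in> N")
        case True
        show ?thesis
        proof (cases "L q < R q")
          case True
          then show ?thesis using \<open>fst q \<in> N\<close> q e1 by (simp add: A_def g0_def abs_minus_commute)
        next
          case False
          then have "L q = R q" using LR[OF q] by simp
          then show ?thesis using True by (simp add: g0_def A_def)
        qed
      next
        case False
        have sub: "snd q \<subseteq> ball (fst q) (d (fst q))"
          using fine q False unfolding fine_def \<gamma>_def by force
        have 1: "L q \<in> {a..b}" "R q \<in> {a..b}" using LR[OF q] by auto
        have "L q \<in> snd q" "R q \<in> snd q" using LR[OF q] by auto
        then have 2: "\<bar>L q - fst q\<bar> < d (fst q)" "\<bar>R q - fst q\<bar> < d (fst q)"
          using sub by (auto simp: dist_real_def abs_minus_commute)
        have 3: "fst q \<in> {a..b} - N" using LR[OF q] False by auto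
        have "\<bar>f (L q) - f (fst q) - (L q - fst q) * g (fst q)\<bar> \<le> e1 * \<bar>L q - fst q\<bar>"
          "\<bar>f (R q) - f (fst q) - (R q - fst q) * g (fst q)\<bar> \<le> e1 * \<bar>R q - fst q\<bar>"
          using d(2)[OF 3 1(1) 2(1)] d(2)[OF 3 1(2) 2(2)] by auto
        \<comment> \<open>Straddle argument: the tag lies between the endpoints, so the two
          one-sided errors add up to a multiple of the length.\<close>
        moreover have "e1 * \<bar>L q - fst q\<bar> + e1 * \<bar>R q - fst q\<bar> = e1 * (R q - L q)"
          using LR[OF q] by (simp add: algebra_simps)
        moreover have "(R q - L q) * g (fst q) - (f (R q) - f (L q)) =
            (f (L q) - f (fst q) - (L q - fst q) * g (fst q)) - (f (R q) - f (fst q) - (R q - fst q) * g (fst q))"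
          by (simp add: algebra_simps)
        ultimately have "\<bar>(R q - L q) * g (fst q) - (f (R q) - f (L q))\<bar> \<le> e1 * (R q - L q)" by linarith
        then show ?thesis using False co[OF q] by (simp add: g0_def A_def)
      qed
      have A: "finite A" "A \<subseteq> p" using fin by (auto simp: A_def)
      have iK: "interior (snd q) = {L q<..<R q}" if "q \<in> p" for q using LR[OF that] by (metis interior_atLeastAtMost_real)
      have dis: "{L q<..<R q} \<inter> {L q'<..<R q'} = {}" if "q \<in> p" "q' \<in> p" "q \<noteq> q'" for q q'
        using ptag that iK by (metis prod.collapse tagged_division_ofD(5))
      have sumA: "(\<Sum>q\<in>A. R q - L q) < \<delta>"
      proof -
        have "(\<Sum>q\<in>A. R q - L q) = (\<Sum>q\<in>A. measure lebesgue {L q<..<R q})"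
          by (intro sum.cong) (auto simp: A_def)
        also have "\<dots> = measure lebesgue (\<Union>q\<in>A. {L q<..<R q})"
        proof (rule measure_finite_Union[symmetric])
          show "disjoint_family_on (\<lambda>q. {L q<..<R q}) A"
            using A(2) dis unfolding disjoint_family_on_def by blast
          show "emeasure lebesgue {L q<..<R q} \<noteq> \<infinity>" if "q \<in> A" for q
            using that by (auto simp: A_def)
        qed (use A in auto)
        also have "\<dots> \<le> measure lebesgue U"
        proof (rule measure_mono_fmeasurable)
          show "(\<Union>q\<in>A. {L q<..<R q}) \<subseteq> U"
          proof (rule UN_least)
            fix q assume q: "q \<in> A"
            then have "snd q \<subseteq> ball (fst q) (r (fst q))"
              using fine unfolding fine_def \<gamma>_def A_def by force
            also have "\<dots> \<subseteq> U" using r q by (auto simp: A_def)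
            finally have "snd q \<subseteq> U" .
            moreover have "q \<in> p" using q A by blast
            ultimately show "{L q<..<R q} \<subseteq> U" using LR(4)[of q] greaterThanLessThan_subseteq_atLeastAtMost_iff by force
          qed
        qed (use U A in auto)
        finally show ?thesis using U by simp
      qed
      have ac': "(\<Sum>q\<in>A. \<bar>f (R q) - f (L q)\<bar>) < e/2"
      proof (rule acd[rule_format, OF A(1) _ _ sumA])
        show "a \<le> L q \<and> L q \<le> R q \<and> R q \<le> b" if "q \<in> A" for q using LR[of q] that A by auto
        show "R q \<le> L q' \<or> R q' \<le> L q" if "q \<in> A" "q' \<in> A" "q \<noteq> q'" for q q'
        proof (rule ccontr)
          assume c: "\<not> (R q \<le> L q' \<or> R q' \<le> L q)"
          have "L q < R q" "L q' < R q'" using that by (auto simp: A_def)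
          then have "max (L q) (L q') < min (R q) (R q')" using c by auto
          then obtain z where "max (L q) (L q') < z" "z < min (R q) (R q')" using dense by blast
          then have "z \<in> {L q<..<R q} \<inter> {L q'<..<R q'}" by auto
          then show False using dis that A by blast
        qed
      qed
      have "\<bar>(\<Sum>q\<in>p. measure lborel (snd q) * g0 (fst q)) - (f b - f a)\<bar>
         = \<bar>\<Sum>q\<in>p. measure lborel (snd q) * g0 (fst q) - (f (R q) - f (L q))\<bar>"
        by (simp add: ba sum_subtractf)
      also have "\<dots> \<le> (\<Sum>q\<in>p. (if q \<in> A then \<bar>f (R q) - f (L q)\<bar> else 0) + e1 * (R q - L q))"
        by (rule order_trans[OF sum_abs]) (intro sum_mono tm)
      also have "\<dots> = (\<Sum>q\<in>A. \<bar>f (R q) - f (L q)\<bar>) + e1 * (b - a)"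
        using fin A by (simp add: sum.distrib ba sum_distrib_left sum.inter_restrict[symmetric] Int_absorb1)
      also have "\<dots> < e/2 + e1 * (b - a)" using ac' by simp
      also have "e1 * (b - a) \<le> e1 * (b - a + 1)" using e1 by simp
      also have "e1 * (b - a + 1) = e/2"
      proof -
        have "b - a + 1 > 0" using ab by simp
        then show ?thesis unfolding e1_def by (subst times_divide_eq_left, subst nonzero_divide_eq_eq) auto
      qed
      finally show ?thesis by (simp add: split_def)
    qed
    ultimately show "\<exists>\<gamma>. gauge \<gamma> \<and> (\<forall>\<D>. \<D> tagged_division_of {a..b} \<and> \<gamma> fine \<D> \<longrightarrow>
        norm ((\<Sum>(x,k)\<in>\<D>. measure lborel k *\<^sub>R g0 x) - (f b - f a)) < e)" by (intro exI[of _ \<gamma>] conjI allI impI; simp)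
  qed
  then show ?thesis
    by (rule has_integral_spike[OF N, rotated]) (auto simp: g0_def)
qed

section \<open>Sobolev classes and piecewise Taylor polynomials\<close>

lemma sob_class_mono:
  assumes "m' \<le> m" "\<And>k. k \<in> {1..m'} \<Longrightarrow> \<bar>c k\<bar> \<le> \<bar>c' k\<bar>"
  shows "sob_class \<alpha> m c \<subseteq> sob_class \<alpha> m' c'"
proof
  fix h assume "h \<in> sob_class \<alpha> m c"
  then obtain D where D: "\<forall>t\<in>{0..\<alpha>}. D 0 t = h t"
    "\<And>k. k \<in> {1..m} \<Longrightarrow> abs_cont_on 0 \<alpha> (D (k - 1)) \<and>
         (AE t in lebesgue. t \<in> {0..\<alpha>} \<longrightarrow>
             (D (k - 1) has_real_derivative D k t) (at t within {0..\<alpha>})) \<and>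
         (\<integral>\<^sup>+ t\<in>{0..\<alpha>}. ennreal ((D k t)\<^sup>2) \<partial>lebesgue) \<le> ennreal ((c k)\<^sup>2)"
    unfolding sob_class_def by blast
  have "ennreal ((c k)\<^sup>2) \<le> ennreal ((c' k)\<^sup>2)" if "k \<in> {1..m'}" for k
    using assms(2)[OF that] by (intro ennreal_leI) (simp add: abs_le_square_iff)
  moreover have "k \<in> {1..m}" if "k \<in> {1..m'}" for k using that assms(1) by auto
  ultimately show "h \<in> sob_class \<alpha> m' c'"
    unfolding sob_class_def using D by (blast intro: order_trans)
qed

text \<open>The class grants derivatives only almost everywhere. Below the top order the derivative
  is itself absolutely continuous, hence continuous, and integrating it gives differentiability at
  every point. Only the top derivative remains a mere integrand.\<close>

lemma sob_class_representation:
  assumes "h \<in> sob_class \<alpha> m c" and m: "m \<ge> 1" and \<alpha>: "\<alpha> \<ge> 0"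
  obtains D g where "\<And>t. t \<in> {0..\<alpha>} \<Longrightarrow> D 0 t = h t"
    and "\<And>k t. Suc k < m \<Longrightarrow> t \<in> {0..\<alpha>} \<Longrightarrow> (D k has_real_derivative D (Suc k) t) (at t within {0..\<alpha>})"
    and "\<And>s t. 0 \<le> s \<Longrightarrow> s \<le> t \<Longrightarrow> t \<le> \<alpha> \<Longrightarrow> (g has_integral (D (m - 1) t - D (m - 1) s)) {s..t}"
    and "(\<lambda>x. (g x)\<^sup>2) integrable_on {0..\<alpha>}" and "integral {0..\<alpha>} (\<lambda>x. (g x)\<^sup>2) \<le> (c m)\<^sup>2"
proof -
  obtain D :: "nat \<Rightarrow> real \<Rightarrow> real" where D0: "\<forall>t\<in>{0..\<alpha>}. D 0 t = h t" and
    D: "\<And>k. k \<in> {1..m} \<Longrightarrow> abs_cont_on 0 \<alpha> (D (k - 1)) \<and>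
         (AE t in lebesgue. t \<in> {0..\<alpha>} \<longrightarrow>
             (D (k - 1) has_real_derivative D k t) (at t within {0..\<alpha>})) \<and>
         (\<integral>\<^sup>+ t\<in>{0..\<alpha>}. ennreal ((D k t)\<^sup>2) \<partial>lebesgue) \<le> ennreal ((c k)\<^sup>2)"
    using assms(1) unfolding sob_class_def by blast
  have ac: "abs_cont_on 0 \<alpha> (D k)" if "k < m" for k using D[of "Suc k"] that by auto
  have int: "(D (Suc k) has_integral (D k t - D k s)) {s..t}"
    if k: "k < m" and st: "0 \<le> s" "s \<le> t" "t \<le> \<alpha>" for k s t
  proof -
    have "AE t in lebesgue. t \<in> {0..\<alpha>} \<longrightarrow>
             (D k has_real_derivative D (Suc k) t) (at t within {0..\<alpha>})"
      using D[of "Suc k"] k by auto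
    then obtain N where N: "N \<in> null_sets lebesgue"
      "{t. \<not> (t \<in> {0..\<alpha>} \<longrightarrow> (D k has_real_derivative D (Suc k) t) (at t within {0..\<alpha>}))} \<subseteq> N"
      by (auto simp: eventually_ae_filter)
    show ?thesis
    proof (rule abs_cont_on_has_integral_derivative)
      show "abs_cont_on s t (D k)" using abs_cont_on_subinterval ac[OF k] st by blast
      show "negligible N" using N by (simp add: negligible_iff_null_sets)
      show "(D k has_real_derivative D (Suc k) x) (at x within {s..t})" if "x \<in> {s..t} - N" for x
      proof -
        have "x \<notin> N" "x \<in> {0..\<alpha>}" using that st by auto
        then have "(D k has_real_derivative D (Suc k) x) (at x within {0..\<alpha>})" using N(2) by blast
        then show ?thesis by (rule DERIV_subset) (use st in auto)
      qed
    qed (use st in auto)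
  qed
  have deriv: "(D k has_real_derivative D (Suc k) t) (at t within {0..\<alpha>})"
    if k: "Suc k < m" and t: "t \<in> {0..\<alpha>}" for k t
  proof -
    have c: "continuous_on {0..\<alpha>} (D (Suc k))" by (rule abs_cont_on_imp_continuous_on[OF ac[OF k]])
    have "((\<lambda>x. D k 0 + integral {0..x} (D (Suc k))) has_real_derivative 0 + D (Suc k) t) (at t within {0..\<alpha>})"
      by (intro DERIV_add DERIV_const integral_has_real_derivative c t)
    moreover have "D k 0 + integral {0..x} (D (Suc k)) = D k x" if "x \<in> {0..\<alpha>}" for x
      using int[of k 0 x] k that by (auto simp: integral_unique)
    ultimately show ?thesis
      using has_field_derivative_transform_within[of "\<lambda>x. D k 0 + integral {0..x} (D (Suc k))" _ t "{0..\<alpha>}" 1 "D k"] t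
      by simp
  qed
  \<comment> \<open>Measurability of \<open>D m\<close> is not stated in \<open>sob_class\<close>;
    it is read off from the gauge integrability established above.\<close>
  define G where "G x = D m x * indicator {0..\<alpha>} x" for x
  have Sm: "Suc (m - 1) = m" using m by simp
  have G: "G \<in> borel_measurable lebesgue"
  proof -
    have "(D m has_integral (D (m - 1) \<alpha> - D (m - 1) 0)) {0..\<alpha>}"
      using int[of "m - 1" 0 \<alpha>] m \<alpha> unfolding Sm by simp
    from has_integral_implies_lebesgue_measurable_real[OF this] show ?thesis unfolding G_def .
  qed
  have le: "(\<integral>\<^sup>+ t. ennreal ((G t)\<^sup>2) \<partial>lebesgue) \<le> ennreal ((c m)\<^sup>2)"
  proof -
    have "(\<integral>\<^sup>+ t. ennreal ((G t)\<^sup>2) \<partial>lebesgue) = (\<integral>\<^sup>+ t\<in>{0..\<alpha>}. ennreal ((D m t)\<^sup>2) \<partial>lebesgue)"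
      by (intro nn_integral_cong) (auto simp: G_def indicator_def)
    then show ?thesis using D[of m] m by simp
  qed
  then obtain r where r: "r \<ge> 0" "(\<integral>\<^sup>+ t. ennreal ((G t)\<^sup>2) \<partial>lebesgue) = ennreal r"
    by (metis ennreal_cases ennreal_less_top infinity_ennreal_def leD)
  then have "((\<lambda>t. (G t)\<^sup>2) has_integral r) UNIV"
    using G by (subst has_integral_iff_nn_integral_lebesgue) auto
  moreover have "(\<lambda>t. (G t)\<^sup>2) = (\<lambda>t. if t \<in> {0..\<alpha>} then (D m t)\<^sup>2 else 0)"
    by (auto simp: G_def fun_eq_iff)
  ultimately have I: "((\<lambda>t. (D m t)\<^sup>2) has_integral r) {0..\<alpha>}"
    by (simp only: has_integral_restrict_UNIV)
  have "r \<le> (c m)\<^sup>2" using le r by simp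
  show thesis
  proof (rule that[of D "D m"])
    show "(D m has_integral D (m - 1) t - D (m - 1) s) {s..t}" if "0 \<le> s" "s \<le> t" "t \<le> \<alpha>" for s t
      using int[of "m - 1" s t] that m Sm by simp
    show "integral {0..\<alpha>} (\<lambda>x. (D m x)\<^sup>2) \<le> (c m)\<^sup>2" using I \<open>r \<le> (c m)\<^sup>2\<close> by (simp add: integral_unique)
  qed (use D0 deriv I in auto)
qed

section \<open>Taylor remainders with a square integrable top derivative\<close>

lemma integral_Cauchy_Schwarz_interval:
  fixes g :: "real \<Rightarrow> real"
  assumes "s \<le> t" "(g has_integral I) {s..t}" "((\<lambda>x. (g x)\<^sup>2) has_integral W) {s..t}"
  shows "I\<^sup>2 \<le> (t - s) * W"
proof (cases "s = t")
  case True
  then have "I = 0" using assms(2) has_integral_refl(2)[of g s] by (auto dest: has_integral_unique)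
  then show ?thesis using True by simp
next
  case False
  then have st: "t - s > 0" using assms by simp
  \<comment> \<open>\<open>c\<close> is the mean of \<open>g\<close>; the inequality is
    nonnegativity of the integral of \<open>(g x - c)\<^sup>2\<close>.\<close>
  define c where "c = I / (t - s)"
  have "((\<lambda>x. (g x)\<^sup>2 - 2 * c * g x + c\<^sup>2) has_integral (W - 2 * c * I + (t - s) * c\<^sup>2)) {s..t}"
    using has_integral_add[OF has_integral_diff[OF assms(3) has_integral_mult_right[OF assms(2), of "2 * c"]]
        has_integral_const_real[of "c\<^sup>2" s t]] st by simp
  moreover have "(\<lambda>x. (g x)\<^sup>2 - 2 * c * g x + c\<^sup>2) = (\<lambda>x. (g x - c)\<^sup>2)"
    by (simp add: power2_eq_square algebra_simps fun_eq_iff)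
  ultimately have "((\<lambda>x. (g x - c)\<^sup>2) has_integral (W - 2 * c * I + (t - s) * c\<^sup>2)) {s..t}" by simp
  then have "0 \<le> W - 2 * c * I + (t - s) * c\<^sup>2" by (rule has_integral_nonneg) simp
  also have "\<dots> = W - I\<^sup>2 / (t - s)" proof -
    have "(t - s) * c = I" using st by (simp add: c_def)
    then have "(t - s) * c\<^sup>2 = c * I" by (simp add: power2_eq_square)
    moreover have "c * I = I\<^sup>2 / (t - s)" by (simp add: c_def power2_eq_square)
    ultimately show ?thesis by simp
  qed
  finally show ?thesis using st by (simp add: field_simps)
qed

lemma DERIV_scaled_power_Suc:
  fixes M a :: real
  shows "((\<lambda>x. M * (x - a) ^ Suc j / fact (Suc j)) has_real_derivative M * (x - a) ^ j / fact j) (at x within S)"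
proof -
  have "((\<lambda>x. (x - a) ^ Suc j) has_real_derivative real (Suc j) * (x - a) ^ j) (at x within S)"
    using DERIV_power[OF DERIV_diff[OF DERIV_ident DERIV_const], where n = "Suc j" and x = x] by simp
  from DERIV_cmult[OF this, of "M / fact (Suc j)"] show ?thesis
    by (simp del: power_Suc)
qed

text \<open>The bound \<open>M\<close> on order \<open>m - 1\<close> is integrated downwards
  \<open>j\<close> times, each time by comparing \<open>R k\<close> with the antiderivative of its
  bound, both zero at \<open>a\<close>.\<close>

lemma iterated_mvt_bound:
  fixes R :: "nat \<Rightarrow> real \<Rightarrow> real"
  assumes ab: "a \<le> b" and
    der: "\<And>k t. Suc k < m \<Longrightarrow> t \<in> {a..b} \<Longrightarrow> (R k has_real_derivative R (Suc k) t) (at t within {a..b})"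
    and z: "\<And>k. k < m \<Longrightarrow> R k a = 0" and top: "\<And>t. t \<in> {a..b} \<Longrightarrow> \<bar>R (m - 1) t\<bar> \<le> M"
    and j: "j < m" and t: "t \<in> {a..b}"
  shows "\<bar>R (m - 1 - j) t\<bar> \<le> M * (t - a) ^ j / fact j"
  using j t
proof (induction j arbitrary: t)
  case 0
  then show ?case using top by simp
next
  case (Suc j)
  define k where "k = m - 1 - Suc j"
  have k: "Suc k < m" "m - 1 - j = Suc k" using Suc.prems by (auto simp: k_def)
  have bnd: "\<bar>R (Suc k) x\<bar> \<le> M * (x - a) ^ j / fact j" if "x \<in> {a..b}" for x
    using Suc.IH[of x] that Suc.prems k by auto
  note pw = DERIV_scaled_power_Suc[of M a j]
  \<comment> \<open>The sign \<open>s\<close> treats the upper and the lower bound with one monotone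
    function \<open>F\<close>.\<close>
  have sg: "s * R k t \<le> M * (t - a) ^ Suc j / fact (Suc j)" if s: "s = 1 \<or> s = -1" for s :: real
  proof -
    define F where "F x = M * (x - a) ^ Suc j / fact (Suc j) - s * R k x" for x
    have dF: "(F has_real_derivative (M * (x - a) ^ j / fact j - s * R (Suc k) x)) (at x within {a..t})" if "x \<in> {a..t}" for x
    proof -
      have "(R k has_real_derivative R (Suc k) x) (at x within {a..t})"
        using der[OF k(1), of x] Suc.prems that by (auto intro: DERIV_subset)
      then show ?thesis unfolding F_def by (intro DERIV_diff pw DERIV_cmult)
    qed
    have "F a \<le> F t"
    proof (rule DERIV_nonneg_imp_increasing_open[of a t F])
      show "a \<le> t" using Suc.prems by simp
      show "continuous_on {a..t} F"
        using dF by (meson DERIV_continuous continuous_on_eq_continuous_within)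
      show "\<exists>y. (F has_real_derivative y) (at x) \<and> 0 \<le> y" if "a < x" "x < t" for x
      proof (intro exI conjI)
        show "(F has_real_derivative (M * (x - a) ^ j / fact j - s * R (Suc k) x)) (at x)"
          using dF[of x] that at_within_Icc_at[of a x t] by simp
        show "0 \<le> M * (x - a) ^ j / fact j - s * R (Suc k) x"
          using bnd[of x] that Suc.prems s by auto
      qed
    qed
    moreover have "F a = 0" using z[of k] k(1) by (simp add: F_def)
    ultimately show ?thesis unfolding F_def by linarith
  qed
  show ?case unfolding k_def[symmetric] abs_le_iff using sg[of 1] sg[of "-1"] by simp
qed

text \<open>\<open>R k\<close> is the Taylor remainder of the derivative of order \<open>k\<close>.
  For \<open>k = m - 1\<close> it is an increment, which Cauchy-Schwarz bounds by the local energy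
  of \<open>g\<close>; the other orders follow by repeated integration.\<close>

lemma taylor_remainder_L2:
  fixes D :: "nat \<Rightarrow> real \<Rightarrow> real"
  assumes m: "m \<ge> 1" and ab: "a \<le> b"
    and der: "\<And>k t. Suc k < m \<Longrightarrow> t \<in> {a..b} \<Longrightarrow> (D k has_real_derivative D (Suc k) t) (at t within {a..b})"
    and top: "\<And>t. a \<le> t \<Longrightarrow> t \<le> b \<Longrightarrow> (g has_integral (D (m - 1) t - D (m - 1) a)) {a..t}"
    and W: "(\<lambda>x. (g x)\<^sup>2) integrable_on {a..b}"
    and t: "t \<in> {a..b}"
  shows "(D 0 t - (\<Sum>p<m. D p a * (t - a) ^ p / fact p))\<^sup>2
     \<le> ((b - a) ^ (m - 1) / fact (m - 1))\<^sup>2 * ((b - a) * integral {a..b} (\<lambda>x. (g x)\<^sup>2))"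
proof -
  define R where "R k t = D k t - (\<Sum>p<m - k. D (k + p) a * (t - a) ^ p / fact p)" for k t
  define W where "W = integral {a..b} (\<lambda>x. (g x)\<^sup>2)"
  have W0: "W \<ge> 0" unfolding W_def by (rule integral_nonneg[OF assms(5)]) simp
  have dR: "(R k has_real_derivative R (Suc k) t) (at t within {a..b})" if k: "Suc k < m" and t: "t \<in> {a..b}" for k t
  proof -
    have mk: "m - k = Suc (m - Suc k)" using k by simp
    have "R k = (\<lambda>t. D k t - (D k a + (\<Sum>p<m - Suc k. D (Suc k + p) a * (t - a) ^ Suc p / fact (Suc p))))"
      unfolding R_def mk sum.lessThan_Suc_shift by simp
    moreover have "((\<lambda>t. D k t - (D k a + (\<Sum>p<m - Suc k. D (Suc k + p) a * (t - a) ^ Suc p / fact (Suc p))))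
      has_real_derivative (D (Suc k) t - (0 + (\<Sum>p<m - Suc k. D (Suc k + p) a * (t - a) ^ p / fact p)))) (at t within {a..b})"
      by (intro DERIV_diff DERIV_add DERIV_const DERIV_sum DERIV_scaled_power_Suc der k t)
    ultimately show ?thesis by (simp add: R_def)
  qed
  have Ra: "R k a = 0" if "k < m" for k
  proof -
    have mk: "m - k = Suc (m - Suc k)" using that by simp
    show ?thesis unfolding R_def mk sum.lessThan_Suc_shift by simp
  qed
  have sq: "\<bar>R (m - 1) t\<bar> \<le> sqrt ((b - a) * W)" if t: "t \<in> {a..b}" for t
  proof -
    have "R (m - 1) t = D (m - 1) t - D (m - 1) a" unfolding R_def using m by simp
    moreover have i: "(\<lambda>x. (g x)\<^sup>2) integrable_on {a..t}"
      using assms(5) by (rule integrable_on_subinterval) (use t in auto)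
    ultimately have "(R (m - 1) t)\<^sup>2 \<le> (t - a) * integral {a..t} (\<lambda>x. (g x)\<^sup>2)"
      using integral_Cauchy_Schwarz_interval[of a t g "R (m - 1) t"] top[of t] t
      by (auto intro: integrable_integral)
    also have "\<dots> \<le> (b - a) * W"
      unfolding W_def using t i assms(5)
      by (intro mult_mono integral_subset_le integral_nonneg) auto
    finally show ?thesis by (metis real_le_rsqrt abs_le_square_iff real_sqrt_abs real_sqrt_le_iff)
  qed
  have "\<bar>R (m - 1 - (m - 1)) t\<bar> \<le> sqrt ((b - a) * W) * (t - a) ^ (m - 1) / fact (m - 1)"
    by (rule iterated_mvt_bound[OF ab dR Ra sq _ t]) (use m in auto)
  also have "\<dots> \<le> sqrt ((b - a) * W) * (b - a) ^ (m - 1) / fact (m - 1)"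
    using t W0 ab by (intro divide_right_mono mult_left_mono power_mono) auto
  finally have "\<bar>R 0 t\<bar> \<le> sqrt ((b - a) * W) * (b - a) ^ (m - 1) / fact (m - 1)" by simp
  then have "\<bar>R 0 t\<bar>\<^sup>2 \<le> (sqrt ((b - a) * W) * (b - a) ^ (m - 1) / fact (m - 1))\<^sup>2"
    by (rule power_mono) simp
  also have "\<dots> = ((b - a) ^ (m - 1) / fact (m - 1))\<^sup>2 * ((b - a) * W)"
    using W0 ab by (simp add: power_mult_distrib power_divide)
  finally show ?thesis by (simp add: R_def W_def)
qed

text \<open>The intervals are disjoint as sets, endpoints included, so at each point at most one
  summand is active and the sum is dominated pointwise.\<close>

lemma sum_integral_disjoint_le:
  fixes f :: "real \<Rightarrow> real"
  assumes "finite C" and f: "f integrable_on {l..u}" "\<And>t. t \<in> {l..u} \<Longrightarrow> f t \<ge> 0"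
    and sub: "\<And>c. c \<in> C \<Longrightarrow> {a c..b c} \<subseteq> {l..u}"
    and dis: "\<And>c d t. c \<in> C \<Longrightarrow> d \<in> C \<Longrightarrow> t \<in> {a c..b c} \<Longrightarrow> t \<in> {a d..b d} \<Longrightarrow> c = d"
  shows "(\<Sum>c\<in>C. integral {a c..b c} f) \<le> integral {l..u} f"
proof (rule has_integral_le)
  show "((\<lambda>t. \<Sum>c\<in>C. if t \<in> {a c..b c} then f t else 0) has_integral (\<Sum>c\<in>C. integral {a c..b c} f)) {l..u}"
  proof (rule has_integral_sum[OF assms(1)])
    fix c assume c: "c \<in> C"
    have "f integrable_on {a c..b c}" by (rule integrable_on_subinterval[OF f(1) sub[OF c]])
    then show "((\<lambda>t. if t \<in> {a c..b c} then f t else 0) has_integral integral {a c..b c} f) {l..u}"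
      using has_integral_restrict[OF sub[OF c]] by (blast intro: integrable_integral)
  qed
  show "(f has_integral integral {l..u} f) {l..u}" using f by (simp add: integrable_integral)
  show "(\<Sum>c\<in>C. if t \<in> {a c..b c} then f t else 0) \<le> f t" if t: "t \<in> {l..u}" for t
  proof (cases "\<exists>c\<in>C. t \<in> {a c..b c}")
    case True
    then obtain c where c: "c \<in> C" "t \<in> {a c..b c}" by blast
    have "(\<Sum>d\<in>C. if t \<in> {a d..b d} then f t else 0) = (\<Sum>d\<in>C. if d = c then f t else 0)"
    proof (intro sum.cong refl)
      fix d assume d: "d \<in> C"
      have "t \<in> {a d..b d} \<longleftrightarrow> d = c" using dis[OF d c(1) _ c(2)] c by metis
      then show "(if t \<in> {a d..b d} then f t else 0) = (if d = c then f t else 0)" by simp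
    qed
    then show ?thesis using c assms(1) by simp
  next
    case False
    then have "(\<Sum>c\<in>C. if t \<in> {a c..b c} then f t else 0) = 0" by (intro sum.neutral) auto
    then show ?thesis using f(2)[OF t] by simp
  qed
qed

text \<open>The cells are the level sets of \<open>\<lfloor>J * F\<rfloor>\<close>, where \<open>F\<close> adds the empirical distribution function of the
  design to the identity: so every cell is at most \<open>1/J\<close> long and carries, besides its leftmost design
  point, at most a fraction \<open>1/J\<close> of the design. At the leftmost point, the Taylor centre, the error vanishes.\<close>

lemma sob_class_piecewise_taylor:
  fixes x :: "nat \<Rightarrow> real" and J n :: nat
  assumes n: "n \<ge> 1" and J: "J \<ge> 1" and \<alpha>: "\<alpha> \<le> 1" and x: "\<And>i. i < n \<Longrightarrow> x i \<in> {0..\<alpha>}"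
  obtains cl :: "nat \<Rightarrow> nat" and a :: "nat \<Rightarrow> real" where "\<And>i. i < n \<Longrightarrow> cl i \<le> 2 * J"
    and "\<And>m c h. m \<ge> 1 \<Longrightarrow> h \<in> sob_class \<alpha> m c \<Longrightarrow>
      \<exists>q. (\<Sum>i<n. (h (x i) - (\<Sum>p<m. q (cl i) p * (x i - a (cl i)) ^ p))\<^sup>2)
          \<le> real n * (c m / fact (m - 1))\<^sup>2 / real J ^ (2 * m)"
proof -
  define F where "F t = t + card {i. i < n \<and> x i \<le> t} / n" for t
  define cell where "cell t = nat \<lfloor>J * F t\<rfloor>" for t
  define cl where "cl i = cell (x i)" for i
  define G where "G c = {i. i < n \<and> cl i = c}" for c
  \<comment> \<open>\<open>a c\<close> and \<open>b c\<close> are extreme design points of the cell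
    rather than ends of a level set, so that the Taylor centre is itself a design point.\<close>
  define a where "a c = Min (x ` G c)" for c
  define b where "b c = Max (x ` G c)" for c
  have \<alpha>0: "\<alpha> \<ge> 0" using x[of 0] n by auto
  have finG: "finite (G c)" for c by (simp add: G_def)
  have Fmono: "t - s + card {i. i < n \<and> s < x i \<and> x i \<le> t} / n = F t - F s" if "s \<le> t" for s t
  proof -
    have "{i. i < n \<and> x i \<le> t} = {i. i < n \<and> x i \<le> s} \<union> {i. i < n \<and> s < x i \<and> x i \<le> t}" using that by auto
    then have "card {i. i < n \<and> x i \<le> t} = card {i. i < n \<and> x i \<le> s} + card {i. i < n \<and> s < x i \<and> x i \<le> t}"
      by (simp add: card_Un_disjoint disjoint_iff)
    then show ?thesis by (simp add: F_def add_divide_distrib)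
  qed
  have Fle: "F s \<le> F t" if "s \<le> t" for s t using Fmono[OF that] that by (smt (verit) divide_nonneg_nonneg of_nat_0_le_iff)
  have F0: "F t \<ge> 0" if "t \<ge> 0" for t using that by (simp add: F_def)
  have cl2: "cl i \<le> 2 * J" if i: "i < n" for i
  proof -
    have "card {k. k < n \<and> x k \<le> x i} \<le> card {..<n}" by (intro card_mono) auto
    \<comment> \<open>One unit comes from \<open>\<alpha> \<le> 1\<close>, the other from the
      empirical distribution function.\<close>
    then have "F (x i) \<le> 1 + 1" unfolding F_def using x[OF i] \<alpha> n by (intro add_mono) (auto simp: divide_le_eq)
    then have "J * F (x i) \<le> 2 * J" using J by (simp add: mult.commute mult_left_mono)
    then show ?thesis unfolding cl_def cell_def by linarith
  qed
  have ab: "a c \<in> x ` G c" "b c \<in> x ` G c" "a c \<le> b c" "0 \<le> a c" "b c \<le> \<alpha>" "cell (a c) = c" "cell (b c) = c"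
     "\<And>i. i \<in> G c \<Longrightarrow> x i \<in> {a c..b c}" if "c \<in> cl ` {..<n}" for c
  proof -
    have ne: "x ` G c \<noteq> {}" "finite (x ` G c)" using that by (auto simp: G_def)
    show A: "a c \<in> x ` G c" and B: "b c \<in> x ` G c" unfolding a_def b_def using ne by (auto intro: Min_in Max_in)
    then show "0 \<le> a c" "b c \<le> \<alpha>" "cell (a c) = c" "cell (b c) = c" using x by (force simp: G_def cl_def)+
    show C: "\<And>i. i \<in> G c \<Longrightarrow> x i \<in> {a c..b c}" unfolding a_def b_def using finG by auto
    show "a c \<le> b c" using A C by force
  qed
  have short: "b c - a c \<le> 1 / J" "real (card {i\<in>G c. x i \<noteq> a c}) \<le> n / J" if c: "c \<in> cl ` {..<n}" for c
  proof -
    have "J * F (a c) \<ge> 0" "J * F (b c) \<ge> 0" using F0 ab[OF c] by auto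
    then have "J * F (b c) - J * F (a c) < 1"
      using ab(6,7)[OF c] unfolding cell_def by linarith
    then have "J * (F (b c) - F (a c)) \<le> 1" by (simp add: algebra_simps)
    then have le: "F (b c) - F (a c) \<le> 1 / J" using J by (simp add: field_simps)
    have eq: "b c - a c + card {i. i < n \<and> a c < x i \<and> x i \<le> b c} / n \<le> 1 / J" using Fmono[OF ab(3)[OF c]] le by simp
    then show "b c - a c \<le> 1 / J" by (smt (verit) divide_nonneg_nonneg of_nat_0_le_iff)
    \<comment> \<open>The empirical increment over the half-open interval starting at
      \<open>a c\<close> does not count the points at \<open>a c\<close>, however many coincide
      there.\<close>
    have "card {i\<in>G c. x i \<noteq> a c} \<le> card {i. i < n \<and> a c < x i \<and> x i \<le> b c}"
      using ab(8)[OF c] by (intro card_mono) (force simp: G_def)+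
    then have "real (card {i\<in>G c. x i \<noteq> a c}) / n \<le> card {i. i < n \<and> a c < x i \<and> x i \<le> b c} / n"
      by (simp add: divide_right_mono)
    also have "\<dots> \<le> 1 / J" using eq ab(3)[OF c] by linarith
    finally show "real (card {i\<in>G c. x i \<noteq> a c}) \<le> n / J" using n by (simp add: field_simps)
  qed
  have main: "\<exists>q. (\<Sum>i<n. (h (x i) - (\<Sum>p<m. q (cl i) p * (x i - a (cl i)) ^ p))\<^sup>2)
          \<le> real n * (C m / fact (m - 1))\<^sup>2 / real J ^ (2 * m)"
    if m: "m \<ge> 1" and h: "h \<in> sob_class \<alpha> m C" for m C h
  proof -
    show ?thesis
    proof (rule sob_class_representation[OF h m \<alpha>0])
      fix D g
      assume D0: "\<And>t. t \<in> {0..\<alpha>} \<Longrightarrow> D 0 t = h t"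
        and der: "\<And>k t. Suc k < m \<Longrightarrow> t \<in> {0..\<alpha>} \<Longrightarrow> (D k has_real_derivative D (Suc k) t) (at t within {0..\<alpha>})"
        and top: "\<And>s t. 0 \<le> s \<Longrightarrow> s \<le> t \<Longrightarrow> t \<le> \<alpha> \<Longrightarrow> (g has_integral (D (m - 1) t - D (m - 1) s)) {s..t}"
        and gi: "(\<lambda>x. (g x)\<^sup>2) integrable_on {0..\<alpha>}" and gC: "integral {0..\<alpha>} (\<lambda>x. (g x)\<^sup>2) \<le> (C m)\<^sup>2"
      define W where "W c = integral {a c..b c} (\<lambda>x. (g x)\<^sup>2)" for c
      define q where "q c p = D p (a c) / fact p" for c p
      define e where "e i = h (x i) - (\<Sum>p<m. q (cl i) p * (x i - a (cl i)) ^ p)" for i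
      have sub: "{a c..b c} \<subseteq> {0..\<alpha>}" if "c \<in> cl ` {..<n}" for c using ab[OF that] by auto
      have W0: "W c \<ge> 0" if "c \<in> cl ` {..<n}" for c unfolding W_def
        by (rule integral_nonneg[OF integrable_on_subinterval[OF gi sub[OF that]]]) simp
      \<comment> \<open>Squared error at one point per unit of energy, of order J^-(2m-1); the at
        most n/J points of a cell supply the last factor 1/J.\<close>
      define K where "K = ((1 / J) ^ (m - 1) / fact (m - 1))\<^sup>2 * (1 / real J)"
      have K0: "K \<ge> 0" by (simp add: K_def)
      have eb: "(e i)\<^sup>2 \<le> K * W c" if i: "i \<in> G c" and c: "c \<in> cl ` {..<n}" for i c
      proof -
        have xi: "x i \<in> {a c..b c}" "cl i = c" "i < n" using ab(8)[OF c] i by (auto simp: G_def)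
        have "(D 0 (x i) - (\<Sum>p<m. D p (a c) * (x i - a c) ^ p / fact p))\<^sup>2
            \<le> ((b c - a c) ^ (m - 1) / fact (m - 1))\<^sup>2 * ((b c - a c) * W c)"
          unfolding W_def
        proof (rule taylor_remainder_L2[OF m ab(3)[OF c] _ _ _ xi(1)])
          show "(D k has_real_derivative D (Suc k) t) (at t within {a c..b c})" if "Suc k < m" "t \<in> {a c..b c}" for k t
            using der[OF that(1), of t] that(2) sub[OF c] by (meson DERIV_subset subsetD)
          show "(g has_integral D (m - 1) t - D (m - 1) (a c)) {a c..t}" if "a c \<le> t" "t \<le> b c" for t
            using top[of "a c" t] that ab(4,5)[OF c] by simp
          show "(\<lambda>x. (g x)\<^sup>2) integrable_on {a c..b c}" by (rule integrable_on_subinterval[OF gi sub[OF c]])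
        qed
        also have "\<dots> \<le> ((1 / J) ^ (m - 1) / fact (m - 1))\<^sup>2 * (1 / J * W c)"
          using short(1)[OF c] ab(3)[OF c] W0[OF c]
          by (intro mult_mono power_mono divide_right_mono) auto
        finally show ?thesis using xi D0[of "x i"] x[of i] by (simp add: e_def q_def K_def)
      qed
      have e0: "e i = 0" if "i \<in> G c" "x i = a c" for i c
      proof -
        obtain m' where m': "m = Suc m'" using m by (cases m) auto
        show ?thesis using that D0[of "x i"] x[of i] unfolding e_def m' sum.lessThan_Suc_shift
          by (simp add: G_def q_def)
      qed
      have cellsum: "(\<Sum>i\<in>G c. (e i)\<^sup>2) \<le> n / J * (K * W c)" if c: "c \<in> cl ` {..<n}" for c
      proof -
        have "(\<Sum>i\<in>G c. (e i)\<^sup>2) = (\<Sum>i\<in>{i\<in>G c. x i \<noteq> a c}. (e i)\<^sup>2)"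
          using e0 by (intro sum.mono_neutral_right finG) auto
        also have "\<dots> \<le> real (card {i\<in>G c. x i \<noteq> a c}) * (K * W c)"
          using eb c by (intro sum_bounded_above) auto
        also have "\<dots> \<le> n / J * (K * W c)"
          using short(2)[OF c] K0 W0[OF c] by (intro mult_right_mono) auto
        finally show ?thesis .
      qed
      have "(\<Sum>i<n. (e i)\<^sup>2) = (\<Sum>c\<in>cl ` {..<n}. \<Sum>i\<in>G c. (e i)\<^sup>2)"
      proof -
        have "(\<Sum>c\<in>cl ` {..<n}. \<Sum>i\<in>{i\<in>{..<n}. cl i = c}. (e i)\<^sup>2) = (\<Sum>i\<in>{..<n}. (e i)\<^sup>2)"
          by (rule sum.group) auto
        moreover have "{i\<in>{..<n}. cl i = c} = G c" for c by (auto simp: G_def)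
        ultimately show ?thesis by simp
      qed
      also have "\<dots> \<le> (\<Sum>c\<in>cl ` {..<n}. n / J * (K * W c))" by (intro sum_mono cellsum)
      also have "\<dots> = n / J * K * (\<Sum>c\<in>cl ` {..<n}. W c)" by (simp only: sum_distrib_left mult.assoc)
      also have "\<dots> \<le> n / J * K * (C m)\<^sup>2"
      proof (intro mult_left_mono)
        have "(\<Sum>c\<in>cl ` {..<n}. W c) \<le> integral {0..\<alpha>} (\<lambda>x. (g x)\<^sup>2)"
          unfolding W_def
        proof (rule sum_integral_disjoint_le)
          show "c = d" if c: "c \<in> cl ` {..<n}" and d: "d \<in> cl ` {..<n}" and t: "t \<in> {a c..b c}" "t \<in> {a d..b d}" for c d t
          proof -
            \<comment> \<open>\<open>F\<close> is monotone, so \<open>cell\<close> is constant on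
              the hull of a cell and two hulls cannot meet.\<close>
            have ct: "cell t = c'" if c': "c' \<in> cl ` {..<n}" and "t \<in> {a c'..b c'}" for c'
            proof -
              have "F (a c') \<le> F t" "F t \<le> F (b c')" using that by (auto intro: Fle)
              then have "J * F (a c') \<le> J * F t" "J * F t \<le> J * F (b c')" by (auto intro: mult_left_mono)
              then have "nat \<lfloor>J * F (a c')\<rfloor> \<le> cell t" "cell t \<le> nat \<lfloor>J * F (b c')\<rfloor>"
                unfolding cell_def by (auto intro!: nat_mono floor_mono)
              then show ?thesis using ab(6,7)[OF c'] unfolding cell_def by simp
            qed
            show ?thesis using ct[OF c t(1)] ct[OF d t(2)] by simp
          qed
        qed (simp_all add: gi sub del: atLeastatMost_subset_iff)
        then show "(\<Sum>c\<in>cl ` {..<n}. W c) \<le> (C m)\<^sup>2" using gC by simp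
      qed (use K0 in auto)
      also have "\<dots> = real n * (C m / fact (m - 1))\<^sup>2 / real J ^ (2 * m)"
      proof -
        obtain m' where m': "m = Suc m'" using m by (cases m) auto
        have "real J ^ (2 * m) = (real J * real J) * (real J ^ m' * real J ^ m')"
          unfolding mult.commute[of 2 m] power_mult by (simp add: m' power2_eq_square mult_ac)
        then show ?thesis unfolding K_def m' by (simp add: power_divide power2_eq_square power_mult mult_ac)
      qed
      finally show ?thesis unfolding e_def by (rule exI[of _ q])
    qed
  qed
  show thesis
  proof (rule that[of cl a])
    show "cl i \<le> 2 * J" if "i < n" for i using cl2[OF that] .
  qed (rule main)
qed

section \<open>Chaining\<close>

text \<open>Weighted arithmetic-geometric mean inequality. The premise is in squared form because
  that is what \<open>orthonormal_cover\<close> delivers; the weight \<open>l\<close> is tuned at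
  each use.\<close>

lemma amgm_from_square:
  fixes u Q w l :: real
  assumes "u\<^sup>2 \<le> Q * w" "Q \<ge> 0" "w \<ge> 0" "l > 0"
  shows "2 * u \<le> l * Q + w / l"
proof -
  have "(2 * u)\<^sup>2 \<le> 4 * (l * Q) * (w / l)" using assms by (simp add: power2_eq_square)
  also have "\<dots> \<le> (l * Q + w / l)\<^sup>2"
    using sum_squares_bound[of "l * Q" "w / l"] assms(4) by (simp add: power2_sum)
  finally show ?thesis
    by (rule power2_le_imp_le) (use assms in simp)
qed

lemma sum_power2_add_le:
  fixes f g :: "'a \<Rightarrow> real"
  shows "(\<Sum>i\<in>S. (f i + g i)\<^sup>2) \<le> 2 * (\<Sum>i\<in>S. (f i)\<^sup>2) + 2 * (\<Sum>i\<in>S. (g i)\<^sup>2)"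
proof -
  have "(f i + g i)\<^sup>2 \<le> 2 * (f i)\<^sup>2 + 2 * (g i)\<^sup>2" for i
    using sum_squares_bound[of "f i" "g i"] by (simp add: power2_sum)
  then have "(\<Sum>i\<in>S. (f i + g i)\<^sup>2) \<le> (\<Sum>i\<in>S. 2 * (f i)\<^sup>2 + 2 * (g i)\<^sup>2)" by (rule sum_mono)
  then show ?thesis by (simp add: sum.distrib sum_distrib_left)
qed

text \<open>Chaining: the noise is paired with the increments of a sequence of approximations \<open>A k\<close> of the
  error \<open>\<Delta>\<close>. The squared approximation error decays like \<open>16\<^sup>-\<^sup>k\<close>, while \<open>Q k\<close> will grow like \<open>2\<^sup>k\<close>, so that
  the weights \<open>4\<^sup>-\<^sup>k\<close> make both resulting series converge.\<close>

lemma chaining_bound: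
  fixes \<Delta> \<epsilon> :: "nat \<Rightarrow> real" and A :: "nat \<Rightarrow> nat \<Rightarrow> real" and b :: real
  assumes basic: "(\<Sum>i<n. (\<Delta> i)\<^sup>2) \<le> 2 * (\<Sum>i<n. \<epsilon> i * \<Delta> i)"
    and b: "b \<ge> 0" and Q: "\<And>k. Q k \<ge> 0"
    and close: "\<And>k. (\<Sum>i<n. (\<Delta> i - A k i)\<^sup>2) \<le> 10 * b / 16 ^ k"
    and n0: "(\<Sum>i<n. \<epsilon> i * A 0 i)\<^sup>2 \<le> Q 0 * (\<Sum>i<n. (A 0 i)\<^sup>2)"
    and nk: "\<And>k. (\<Sum>i<n. \<epsilon> i * (A (Suc k) i - A k i))\<^sup>2 \<le> Q k * (\<Sum>i<n. (A (Suc k) i - A k i)\<^sup>2)"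
  shows "(\<Sum>i<n. (\<Delta> i)\<^sup>2) \<le> 8 * Q 0 + 2 * (\<Sum>k<K. Q k / 4 ^ k) + 2 / 4 ^ K * (\<Sum>i<n. (\<epsilon> i)\<^sup>2) + 90 * b"
proof -
  have sq0: "(\<Sum>i<n. (f i)\<^sup>2) \<ge> 0" for f :: "nat \<Rightarrow> real" by (intro sum_nonneg) simp
  have A0: "(\<Sum>i<n. (A 0 i)\<^sup>2) \<le> 2 * (\<Sum>i<n. (\<Delta> i)\<^sup>2) + 20 * b"
    using sum_power2_add_le[of \<Delta> "\<lambda>i. A 0 i - \<Delta> i" "{..<n}"] close[of 0] by (simp add: power2_commute)
  \<comment> \<open>The weight 4 leaves exactly half of the squared error on the right, to be
    absorbed at the end.\<close>
  have t0: "2 * (\<Sum>i<n. \<epsilon> i * A 0 i) \<le> 4 * Q 0 + (\<Sum>i<n. (\<Delta> i)\<^sup>2) / 2 + 5 * b"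
    using amgm_from_square[OF n0 Q sq0, of 4] A0 by simp
  \<comment> \<open>2 * 10 + 2 * 10/16 = 21.25, rounded up to 22.\<close>
  have inc: "(\<Sum>i<n. (A (Suc k) i - A k i)\<^sup>2) \<le> 22 * b / 16 ^ k" for k
  proof -
    have "(\<Sum>i<n. (A (Suc k) i - A k i)\<^sup>2) \<le> 2 * (\<Sum>i<n. (A (Suc k) i - \<Delta> i)\<^sup>2) + 2 * (\<Sum>i<n. (\<Delta> i - A k i)\<^sup>2)"
      using sum_power2_add_le[of "\<lambda>i. A (Suc k) i - \<Delta> i" "\<lambda>i. \<Delta> i - A k i" "{..<n}"] by simp
    also have "\<dots> \<le> 2 * (10 * b / 16 ^ Suc k) + 2 * (10 * b / 16 ^ k)"
      using close[of "Suc k"] close[of k] by (intro add_mono mult_left_mono) (simp_all add: power2_commute)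
    also have "\<dots> \<le> 22 * b / 16 ^ k" using b by (simp add: field_simps)
    finally show ?thesis .
  qed
  have tk: "2 * (\<Sum>i<n. \<epsilon> i * (A (Suc k) i - A k i)) \<le> Q k / 4 ^ k + 22 * b * (1/4) ^ k" for k
  proof -
    have "2 * (\<Sum>i<n. \<epsilon> i * (A (Suc k) i - A k i)) \<le> 1 / 4 ^ k * Q k + (\<Sum>i<n. (A (Suc k) i - A k i)\<^sup>2) / (1 / 4 ^ k)"
      by (rule amgm_from_square[OF nk Q sq0]) simp
    also have "(\<Sum>i<n. (A (Suc k) i - A k i)\<^sup>2) / (1 / 4 ^ k) \<le> 22 * b / 16 ^ k / (1 / 4 ^ k)"
      using inc by (intro divide_right_mono) auto
    also have "22 * b / 16 ^ k / (1 / 4 ^ k) = 22 * b * (1/4) ^ k"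
    proof -
      have "(16::real) ^ k = 4 ^ k * 4 ^ k" by (simp add: power_mult_distrib[symmetric])
      then show ?thesis by (simp add: power_one_over)
    qed
    finally show ?thesis by simp
  qed
  \<comment> \<open>Only here is the whole noise energy used, with the small weight
    \<open>1 / 4 ^ K\<close>.\<close>
  have tK: "2 * (\<Sum>i<n. \<epsilon> i * (\<Delta> i - A K i)) \<le> 1 / 4 ^ K * (\<Sum>i<n. (\<epsilon> i)\<^sup>2) + 10 * b"
  proof -
    have "2 * (\<Sum>i<n. \<epsilon> i * (\<Delta> i - A K i)) \<le> 1 / 4 ^ K * (\<Sum>i<n. (\<epsilon> i)\<^sup>2) + (\<Sum>i<n. (\<Delta> i - A K i)\<^sup>2) / (1 / 4 ^ K)"
      by (rule amgm_from_square[OF Cauchy_Schwarz_ineq_sum sq0 sq0]) simp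
    also have "(\<Sum>i<n. (\<Delta> i - A K i)\<^sup>2) / (1 / 4 ^ K) \<le> 10 * b / 16 ^ K / (1 / 4 ^ K)"
      using close by (intro divide_right_mono) auto
    also have "10 * b / 16 ^ K / (1 / 4 ^ K) = 10 * b / 4 ^ K"
    proof -
      have "(16::real) ^ K = 4 ^ K * 4 ^ K" by (simp add: power_mult_distrib[symmetric])
      then show ?thesis by simp
    qed
    also have "\<dots> \<le> 10 * b" using b by (simp add: divide_le_eq mult_le_cancel_left1)
    finally show ?thesis by simp
  qed
  have tel: "(\<Sum>i<n. \<epsilon> i * \<Delta> i) = (\<Sum>i<n. \<epsilon> i * A 0 i) + (\<Sum>k<K. \<Sum>i<n. \<epsilon> i * (A (Suc k) i - A k i))
      + (\<Sum>i<n. \<epsilon> i * (\<Delta> i - A K i))"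
  proof -
    have "(\<Sum>k<K. \<Sum>i<n. \<epsilon> i * (A (Suc k) i - A k i)) = (\<Sum>i<n. \<epsilon> i * (\<Sum>k<K. A (Suc k) i - A k i))"
      by (subst sum.swap) (simp add: sum_distrib_left)
    also have "\<dots> = (\<Sum>i<n. \<epsilon> i * (A K i - A 0 i))" using sum_lessThan_telescope[of "\<lambda>k. A k i" K for i] by simp
    finally have eq: "(\<Sum>k<K. \<Sum>i<n. \<epsilon> i * (A (Suc k) i - A k i)) = (\<Sum>i<n. \<epsilon> i * (A K i - A 0 i))" .
    show ?thesis unfolding eq by (simp add: right_diff_distrib sum_subtractf)
  qed
  have geo: "(\<Sum>k<K. 22 * b * (1/4) ^ k) \<le> 30 * b"
  proof -
    have "(\<Sum>k<K. (1/4::real) ^ k) \<le> 4/3" by (simp add: sum_gp_strict)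
    then have "22 * b * (\<Sum>k<K. (1/4) ^ k) \<le> 22 * b * (4/3)" using b by (intro mult_left_mono) auto
    then show ?thesis using b by (simp add: sum_distrib_left)
  qed
  have "2 * (\<Sum>k<K. \<Sum>i<n. \<epsilon> i * (A (Suc k) i - A k i)) \<le> (\<Sum>k<K. Q k / 4 ^ k) + 30 * b"
  proof -
    have "(\<Sum>k<K. 2 * (\<Sum>i<n. \<epsilon> i * (A (Suc k) i - A k i))) \<le> (\<Sum>k<K. Q k / 4 ^ k + 22 * b * (1/4) ^ k)"
      by (intro sum_mono tk)
    then show ?thesis using geo by (simp add: sum_distrib_left sum.distrib)
  qed
  \<comment> \<open>Moving half of the squared error to the left doubles the rest: 90 = 2 * (5 + 30
    + 10) and 8 = 2 * 4.\<close>
  then show ?thesis using t0 tK tel basic by simp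
qed

section \<open>Mean values of projected noise\<close>

lemma nn_integral_projection_energy:
  fixes e :: "'a \<Rightarrow> nat \<Rightarrow> real"
  assumes "\<sigma> > 0" "finite I" "\<And>l. l \<in> I \<Longrightarrow> (\<Sum>i<n. (e l i)\<^sup>2) \<le> 1"
  shows "(\<integral>\<^sup>+ \<epsilon>. ennreal (\<Sum>l\<in>I. (\<Sum>i<n. e l i * \<epsilon> i)\<^sup>2) \<partial>PiM {..<n} (\<lambda>_. gauss \<sigma>)) \<le> ennreal (\<sigma>\<^sup>2 * card I)"
proof -
  have "(\<integral>\<^sup>+ \<epsilon>. ennreal (\<Sum>l\<in>I. (\<Sum>i<n. e l i * \<epsilon> i)\<^sup>2) \<partial>PiM {..<n} (\<lambda>_. gauss \<sigma>))
      = (\<Sum>l\<in>I. \<integral>\<^sup>+ \<epsilon>. ennreal ((\<Sum>i<n. e l i * \<epsilon> i)\<^sup>2) \<partial>PiM {..<n} (\<lambda>_. gauss \<sigma>))"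
    by (subst sum_ennreal[symmetric], simp, subst nn_integral_sum) auto
  also have "\<dots> = (\<Sum>l\<in>I. ennreal (\<sigma>\<^sup>2 * (\<Sum>i<n. (e l i)\<^sup>2)))"
    by (intro sum.cong refl nn_integral_gauss_linear_square assms(1)) simp
  also have "\<dots> \<le> (\<Sum>l\<in>I. ennreal (\<sigma>\<^sup>2))"
    using assms(3) by (intro sum_mono ennreal_leI) (simp add: mult_left_le)
  also have "\<dots> = ennreal (\<sigma>\<^sup>2 * card I)"
    by (simp add: ennreal_mult ennreal_of_nat_eq_real_of_nat mult.commute)
  finally show ?thesis .
qed

text \<open>Packs a real bound on an expectation with the measurability and signs that additivity of
  the nonnegative integral requires, so that such bounds add and scale like real numbers.\<close>

definition mean_le :: "'a measure \<Rightarrow> ('a \<Rightarrow> real) \<Rightarrow> real \<Rightarrow> bool" where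
  "mean_le M f F \<longleftrightarrow> f \<in> borel_measurable M \<and> (\<forall>x. f x \<ge> 0) \<and> F \<ge> 0 \<and> (\<integral>\<^sup>+ x. ennreal (f x) \<partial>M) \<le> ennreal F"

lemma mean_le_add: "mean_le M f F \<Longrightarrow> mean_le M g G \<Longrightarrow> mean_le M (\<lambda>x. f x + g x) (F + G)"
  unfolding mean_le_def by (auto simp: nn_integral_add ennreal_plus intro: add_mono)

lemma mean_le_cmult:
  assumes "mean_le M f F" "w \<ge> 0"
  shows "mean_le M (\<lambda>x. w * f x) (w * F)"
  using assms unfolding mean_le_def
  by (auto simp: nn_integral_cmult ennreal_mult intro: mult_left_mono)

lemma mean_le_sum:
  assumes "finite S" "\<And>s. s \<in> S \<Longrightarrow> mean_le M (f s) (F s)"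
  shows "mean_le M (\<lambda>x. \<Sum>s\<in>S. f s x) (\<Sum>s\<in>S. F s)"
  using assms
proof (induction S)
  case empty
  then show ?case by (simp add: mean_le_def)
next
  case (insert s S)
  then have "mean_le M (\<lambda>x. f s x + (\<Sum>s\<in>S. f s x)) (F s + (\<Sum>s\<in>S. F s))"
    by (intro mean_le_add) auto
  then show ?case using insert.hyps by simp
qed

lemma (in prob_space) mean_le_const: "w \<ge> 0 \<Longrightarrow> mean_le M (\<lambda>x. w) w"
  by (simp add: mean_le_def emeasure_space_1)

lemma mean_le_mono: "mean_le M f F \<Longrightarrow> F \<le> G \<Longrightarrow> mean_le M f G"
  unfolding mean_le_def by (auto intro: order_trans ennreal_leI)

lemma mean_le_projection_energy:
  fixes e :: "'a \<Rightarrow> nat \<Rightarrow> real"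
  assumes "\<sigma> > 0" "finite I" "\<And>l. l \<in> I \<Longrightarrow> (\<Sum>i<n. (e l i)\<^sup>2) \<le> 1"
  shows "mean_le (PiM {..<n} (\<lambda>_. gauss \<sigma>)) (\<lambda>\<epsilon>. \<Sum>l\<in>I. (\<Sum>i<n. e l i * \<epsilon> i)\<^sup>2) (\<sigma>\<^sup>2 * card I)"
  unfolding mean_le_def using nn_integral_projection_energy[OF assms] by (auto intro!: sum_nonneg)

text \<open>The special case of the standard unit vectors.\<close>

lemma mean_le_noise_energy:
  fixes n :: nat
  assumes \<sigma>: "\<sigma> > 0"
  shows "mean_le (PiM {..<n} (\<lambda>_. gauss \<sigma>)) (\<lambda>\<epsilon>. \<Sum>i<n. (\<epsilon> i)\<^sup>2) (\<sigma>\<^sup>2 * n)"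
proof -
  have "mean_le (PiM {..<n} (\<lambda>_. gauss \<sigma>)) (\<lambda>\<epsilon>. \<Sum>l<n. (\<Sum>i<n. (if i = l then 1 else 0) * \<epsilon> i)\<^sup>2) (\<sigma>\<^sup>2 * card {..<n})"
    by (rule mean_le_projection_energy[OF \<sigma>]) (auto simp: if_distrib[of "\<lambda>x. x\<^sup>2"] cong: if_cong)
  moreover have "(\<Sum>i<n. (if i = l then 1 else 0) * \<epsilon> i) = \<epsilon> l" if "l < n" for l and \<epsilon> :: "nat \<Rightarrow> real"
    using that by (simp add: if_distrib[of "\<lambda>x. x * _"] cong: if_cong)
  ultimately show ?thesis by simp
qed

text \<open>At resolution \<open>J * 2 ^ k\<close> the dimension is of order m J 2^k, while the
  squared error gains the factor 2^(-2mk), at most 16^(-k) because \<open>m \<ge> 2\<close>. The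
  numerator 4^m bounds (2^(m-1))^2, what is left of \<open>c m\<close> after division by the
  factorial.\<close>

lemma ls_risk_bound_resolution:
  fixes x :: "nat \<Rightarrow> real" and y :: "real \<Rightarrow> real" and J n m :: nat
  assumes \<sigma>: "\<sigma> > 0" and n: "n \<ge> 1" and J: "J \<ge> 1" and m: "m \<ge> 2" and \<alpha>: "\<alpha> \<le> 1"
    and x: "\<And>i. i < n \<Longrightarrow> x i \<in> {0..\<alpha>}" and c: "c m = 2 ^ (m - 1) * fact (m - 1)"
    and yS: "\<And>\<eta>. \<eta> > 0 \<Longrightarrow> \<exists>h\<in>sob_class \<alpha> m c. \<forall>i<n. \<bar>h (x i) - y (x i)\<bar> \<le> \<eta>"
    and yhS: "\<And>Y. yhat Y \<in> sob_class \<alpha> m c"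
    and basic: "\<And>\<epsilon>. (\<Sum>i<n. (yhat (\<lambda>j. y (x j) + \<epsilon> j) (x i) - y (x i))\<^sup>2)
         \<le> 2 * (\<Sum>i<n. \<epsilon> i * (yhat (\<lambda>j. y (x j) + \<epsilon> j) (x i) - y (x i)))"
  shows "ls_risk n \<sigma> x y yhat \<le> ennreal (110 * (\<sigma>\<^sup>2 / n) * real m * real J + 90 * 4 ^ m / real J ^ (2 * m))"
proof -
  define b where "b = real n * 4 ^ m / real J ^ (2 * m)"
  have b0: "b > 0" using n J by (simp add: b_def)
  define P where "P cl a q i = (\<Sum>p<m. q (cl i) p * (x i - a (cl i)) ^ p)"
    for cl :: "nat \<Rightarrow> nat" and a :: "nat \<Rightarrow> real" and q :: "nat \<Rightarrow> nat \<Rightarrow> real" and i :: nat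
  define good where "good k cl a \<longleftrightarrow> (\<forall>i<n. cl i \<le> 2 * (J * 2 ^ k)) \<and>
      (\<forall>h\<in>sob_class \<alpha> m c. \<exists>q. (\<Sum>i<n. (h (x i) - P cl a q i)\<^sup>2) \<le> b / 16 ^ k)" for k cl a
  have "\<exists>cl a. good k cl a" for k
  proof (rule sob_class_piecewise_taylor[of n "J * 2 ^ k" \<alpha> x])
    show "n \<ge> 1" "J * 2 ^ k \<ge> 1" "\<alpha> \<le> 1" using n J \<alpha> by auto
    show "x i \<in> {0..\<alpha>}" if "i < n" for i using x[OF that] .
    fix cl :: "nat \<Rightarrow> nat" and a :: "nat \<Rightarrow> real"
    assume 1: "\<And>i. i < n \<Longrightarrow> cl i \<le> 2 * (J * 2 ^ k)"
      and 2: "\<And>m c h. m \<ge> 1 \<Longrightarrow> h \<in> sob_class \<alpha> m c \<Longrightarrow>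
      \<exists>q. (\<Sum>i<n. (h (x i) - (\<Sum>p<m. q (cl i) p * (x i - a (cl i)) ^ p))\<^sup>2)
          \<le> real n * (c m / fact (m - 1))\<^sup>2 / real (J * 2 ^ k) ^ (2 * m)"
    have le: "real n * (c m / fact (m - 1))\<^sup>2 / real (J * 2 ^ k) ^ (2 * m) \<le> b / 16 ^ k"
    proof -
      have "(c m / fact (m - 1))\<^sup>2 = (2 ^ (m - 1))\<^sup>2" by (simp add: c)
      also have "\<dots> \<le> (2 ^ m)\<^sup>2" by (intro power_mono power_increasing) auto
      also have "\<dots> = (4::real) ^ m" by (simp add: power2_eq_square power_mult_distrib[symmetric])
      finally have num: "real n * (c m / fact (m - 1))\<^sup>2 \<le> real n * 4 ^ m" by (simp add: mult_left_mono)
      have "(16::real) ^ k = 2 ^ (4 * k)" by (simp add: power_mult)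
      also have "\<dots> \<le> 2 ^ (2 * m * k)" using m by (intro power_increasing) auto
      also have "\<dots> = (2 ^ k) ^ (2 * m)" by (simp add: power_mult[symmetric] mult_ac)
      finally have "real J ^ (2 * m) * 16 ^ k \<le> real (J * 2 ^ k) ^ (2 * m)"
        by (simp add: power_mult_distrib mult_left_mono)
      then have "real n * (c m / fact (m - 1))\<^sup>2 / real (J * 2 ^ k) ^ (2 * m) \<le> real n * 4 ^ m / (real J ^ (2 * m) * 16 ^ k)"
        using num J by (intro frac_le) auto
      then show ?thesis by (simp add: b_def)
    qed
    have "good k cl a"
      unfolding good_def P_def
    proof (intro conjI allI impI ballI)
      show "cl i \<le> 2 * (J * 2 ^ k)" if "i < n" for i using 1[OF that] .
      fix h assume "h \<in> sob_class \<alpha> m c"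
      then obtain q where "(\<Sum>i<n. (h (x i) - (\<Sum>p<m. q (cl i) p * (x i - a (cl i)) ^ p))\<^sup>2)
          \<le> real n * (c m / fact (m - 1))\<^sup>2 / real (J * 2 ^ k) ^ (2 * m)" using 2[of m h c] m by auto
      then show "\<exists>q. (\<Sum>i<n. (h (x i) - (\<Sum>p<m. q (cl i) p * (x i - a (cl i)) ^ p))\<^sup>2) \<le> b / 16 ^ k"
        using le by (intro exI[of _ q]) (rule order_trans)
    qed
    then show "\<exists>cl a. good k cl a" by blast
  qed
  then obtain cl a where good: "\<And>k. good k (cl k) (a k)" by metis
  have clb: "cl k i \<le> 2 * (J * 2 ^ k)" if "i < n" for k i using good[of k] that by (auto simp: good_def)
  have hP: "\<exists>q. (\<Sum>i<n. (h (x i) - P (cl k) (a k) q i)\<^sup>2) \<le> b / 16 ^ k" if "h \<in> sob_class \<alpha> m c" for h k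
    using good[of k] that by (auto simp: good_def)
  have yP: "\<exists>q. (\<Sum>i<n. (y (x i) - P (cl k) (a k) q i)\<^sup>2) \<le> 4 * (b / 16 ^ k)" for k
  proof -
    \<comment> \<open>\<open>y\<close> is only a limit of class members. This \<open>\<eta>\<close>
      makes the replacement cost exactly \<open>b / 16 ^ k\<close>, so the factor is 2 + 2 = 4 for
      \<open>y\<close> and 2 * 1 + 2 * 4 = 10 for the error.\<close>
    define \<eta> where "\<eta> = sqrt (b / 16 ^ k / n)"
    have \<eta>: "\<eta> > 0" "real n * \<eta>\<^sup>2 = b / 16 ^ k" using b0 n by (auto simp: \<eta>_def)
    obtain h where h: "h \<in> sob_class \<alpha> m c" "\<And>i. i < n \<Longrightarrow> \<bar>h (x i) - y (x i)\<bar> \<le> \<eta>" using yS[OF \<eta>(1)] by blast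
    obtain q where q: "(\<Sum>i<n. (h (x i) - P (cl k) (a k) q i)\<^sup>2) \<le> b / 16 ^ k" using hP[OF h(1)] by blast
    have "(y (x i) - h (x i))\<^sup>2 \<le> \<eta>\<^sup>2" if "i < n" for i
      using h(2)[OF that] \<eta>(1) by (subst abs_le_square_iff[symmetric]) (simp add: abs_minus_commute)
    then have "(\<Sum>i<n. (y (x i) - h (x i))\<^sup>2) \<le> (\<Sum>i<n. \<eta>\<^sup>2)" by (intro sum_mono) auto
    then have "(\<Sum>i<n. (y (x i) - h (x i))\<^sup>2) \<le> b / 16 ^ k" using \<eta>(2) by simp
    then have "(\<Sum>i<n. (y (x i) - P (cl k) (a k) q i)\<^sup>2) \<le> 4 * (b / 16 ^ k)"
      using sum_power2_add_le[of "\<lambda>i. y (x i) - h (x i)" "\<lambda>i. h (x i) - P (cl k) (a k) q i" "{..<n}"] q by simp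
    then show ?thesis by blast
  qed
  \<comment> \<open>One function per level, cell and degree. The level is part of the index, so the
    systems of consecutive levels are disjoint in \<open>I k\<close> even where their functions
    coincide.\<close>
  define v where "v l i = (case l of (j, d, p) \<Rightarrow> if cl j i = d then (x i - a j d) ^ p else 0)" for l :: "nat \<times> nat \<times> nat" and i
  define L where "L k = {k} \<times> {..2 * (J * 2 ^ k)} \<times> {..<m}" for k :: nat
  define I where "I k = L k \<union> L (Suc k)" for k
  have finL: "finite (L k)" for k by (simp add: L_def)
  have finI: "finite (I k)" for k by (simp add: I_def finL)
  have LL: "L k \<inter> L (Suc k) = {}" for k by (auto simp: L_def)
  have PL: "P (cl k) (a k) q i = (\<Sum>l\<in>L k. (case l of (j, d, p) \<Rightarrow> q d p) * v l i)" if i: "i < n" for k q i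
  proof -
    have "(\<Sum>l\<in>L k. (case l of (j, d, p) \<Rightarrow> q d p) * v l i)
        = (\<Sum>d\<le>2 * (J * 2 ^ k). \<Sum>p<m. q d p * (if cl k i = d then (x i - a k d) ^ p else 0))"
      unfolding L_def v_def by (simp add: sum.cartesian_product')
    also have "\<dots> = (\<Sum>d\<le>2 * (J * 2 ^ k). if cl k i = d then P (cl k) (a k) q i else 0)"
      unfolding P_def by (intro sum.cong refl) auto
    also have "\<dots> = P (cl k) (a k) q i" using clb[OF i, of k] by simp
    finally show ?thesis by simp
  qed
  have PI: "\<exists>w. \<forall>i<n. P (cl (Suc k)) (a (Suc k)) q' i - P (cl k) (a k) q i = (\<Sum>l\<in>I k. w l * v l i)" for k q q'
  proof -
    define w where "w = (\<lambda>(j, d, p). if j = k then - q d p else q' d p)"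
    have "P (cl (Suc k)) (a (Suc k)) q' i - P (cl k) (a k) q i = (\<Sum>l\<in>I k. w l * v l i)" if i: "i < n" for i
    proof -
      have "(\<Sum>l\<in>I k. w l * v l i) = (\<Sum>l\<in>L k. w l * v l i) + (\<Sum>l\<in>L (Suc k). w l * v l i)"
        unfolding I_def by (rule sum.union_disjoint[OF finL finL LL])
      also have "(\<Sum>l\<in>L k. w l * v l i) = (\<Sum>l\<in>L k. - ((case l of (j, d, p) \<Rightarrow> q d p) * v l i))"
        by (intro sum.cong refl) (auto simp: L_def w_def)
      also have "(\<Sum>l\<in>L (Suc k). w l * v l i) = (\<Sum>l\<in>L (Suc k). (case l of (j, d, p) \<Rightarrow> q' d p) * v l i)"
        by (intro sum.cong refl) (auto simp: L_def w_def)
      finally show ?thesis by (simp add: PL[OF i] sum_negf)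
    qed
    then show ?thesis by blast
  qed
  have cardI: "real (card (I k)) \<le> 9 * real m * real J * 2 ^ k" for k
  proof -
    have "card (I k) = (2 * (J * 2 ^ k) + 1) * m + (2 * (J * 2 ^ Suc k) + 1) * m"
      unfolding I_def by (subst card_Un_disjoint[OF finL finL LL]) (simp add: L_def card_cartesian_product)
    also have "\<dots> = (6 * (J * 2 ^ k) + 2) * m" by (simp add: algebra_simps)
    also have "\<dots> \<le> (9 * (J * 2 ^ k)) * m"
    proof (rule mult_right_mono)
      have "J * 2 ^ k \<ge> 1" using J by simp
      then show "6 * (J * 2 ^ k) + 2 \<le> 9 * (J * 2 ^ k)" by linarith
    qed simp
    finally have "real (card (I k)) \<le> real ((9 * (J * 2 ^ k)) * m)" by (simp only: of_nat_le_iff)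
    then show ?thesis by (simp add: mult_ac)
  qed
  \<comment> \<open>The systems \<open>e k\<close> are fixed by design and cells before any noise
    vector appears, so \<open>Q k\<close> is a quadratic form with deterministic
    coefficients.\<close>
  have "\<forall>k. \<exists>e. (\<forall>l\<in>I k. (\<Sum>i<n. (e l i)\<^sup>2) \<le> 1) \<and>
    (\<forall>\<epsilon> w. (\<Sum>i<n. \<epsilon> i * (\<Sum>l\<in>I k. w l * v l i))\<^sup>2
       \<le> (\<Sum>l\<in>I k. (\<Sum>i<n. e l i * \<epsilon> i)\<^sup>2) * (\<Sum>i<n. (\<Sum>l\<in>I k. w l * v l i)\<^sup>2))"
    by (intro allI orthonormal_cover finI)
  from choice[OF this] obtain e where e: "\<forall>k. (\<forall>l\<in>I k. (\<Sum>i<n. (e k l i)\<^sup>2) \<le> 1) \<and>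
    (\<forall>\<epsilon> w. (\<Sum>i<n. \<epsilon> i * (\<Sum>l\<in>I k. w l * v l i))\<^sup>2
       \<le> (\<Sum>l\<in>I k. (\<Sum>i<n. e k l i * \<epsilon> i)\<^sup>2) * (\<Sum>i<n. (\<Sum>l\<in>I k. w l * v l i)\<^sup>2))" ..
  define Q where "Q k \<epsilon> = (\<Sum>l\<in>I k. (\<Sum>i<n. e k l i * \<epsilon> i)\<^sup>2)" for k \<epsilon>
  have Q0: "Q k \<epsilon> \<ge> 0" for k \<epsilon> unfolding Q_def by (intro sum_nonneg) simp
  have QP: "(\<Sum>i<n. \<epsilon> i * (P (cl (Suc k)) (a (Suc k)) q' i - P (cl k) (a k) q i))\<^sup>2
      \<le> Q k \<epsilon> * (\<Sum>i<n. (P (cl (Suc k)) (a (Suc k)) q' i - P (cl k) (a k) q i)\<^sup>2)" for k \<epsilon> q q'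
  proof -
    obtain w where w: "\<forall>i<n. P (cl (Suc k)) (a (Suc k)) q' i - P (cl k) (a k) q i = (\<Sum>l\<in>I k. w l * v l i)"
      using PI by blast
    have "(\<Sum>i<n. \<epsilon> i * (\<Sum>l\<in>I k. w l * v l i))\<^sup>2 \<le> Q k \<epsilon> * (\<Sum>i<n. (\<Sum>l\<in>I k. w l * v l i)\<^sup>2)"
      using e unfolding Q_def by blast
    then show ?thesis using w by simp
  qed
  define \<Delta> where "\<Delta> \<epsilon> i = yhat (\<lambda>j. y (x j) + \<epsilon> j) (x i) - y (x i)" for \<epsilon> i
  \<comment> \<open>With \<open>n\<close> levels the leftover noise energy has mean
    \<open>2 / 4 ^ n * (\<sigma>\<^sup>2 * n)\<close>, at most
    \<open>2 * \<sigma>\<^sup>2\<close>.\<close>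
  have pt: "(\<Sum>i<n. (\<Delta> \<epsilon> i)\<^sup>2) \<le> 8 * Q 0 \<epsilon> + 2 * (\<Sum>k<n. Q k \<epsilon> / 4 ^ k) + 2 / 4 ^ n * (\<Sum>i<n. (\<epsilon> i)\<^sup>2) + 90 * b" for \<epsilon>
  proof -
    have "\<exists>q. (\<Sum>i<n. (\<Delta> \<epsilon> i - P (cl k) (a k) q i)\<^sup>2) \<le> 10 * b / 16 ^ k" for k
    proof -
      obtain q1 where q1: "(\<Sum>i<n. (yhat (\<lambda>j. y (x j) + \<epsilon> j) (x i) - P (cl k) (a k) q1 i)\<^sup>2) \<le> b / 16 ^ k"
        using hP[OF yhS] by blast
      obtain q2 where q2: "(\<Sum>i<n. (y (x i) - P (cl k) (a k) q2 i)\<^sup>2) \<le> 4 * (b / 16 ^ k)" using yP by blast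
      have Pd: "P (cl k) (a k) (\<lambda>d p. q1 d p - q2 d p) i = P (cl k) (a k) q1 i - P (cl k) (a k) q2 i" for i
        by (simp add: P_def left_diff_distrib sum_subtractf)
      have "(\<Sum>i<n. (\<Delta> \<epsilon> i - P (cl k) (a k) (\<lambda>d p. q1 d p - q2 d p) i)\<^sup>2)
          = (\<Sum>i<n. ((yhat (\<lambda>j. y (x j) + \<epsilon> j) (x i) - P (cl k) (a k) q1 i) + (P (cl k) (a k) q2 i - y (x i)))\<^sup>2)"
        unfolding \<Delta>_def Pd by (intro sum.cong refl arg_cong[where f = "\<lambda>z. z\<^sup>2"]) simp
      also have "\<dots> \<le> 2 * (b / 16 ^ k) + 2 * (4 * (b / 16 ^ k))"
        by (rule order_trans[OF sum_power2_add_le add_mono]) (use q1 q2 in \<open>simp_all add: power2_commute\<close>)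
      finally show ?thesis by (intro exI[of _ "\<lambda>d p. q1 d p - q2 d p"]) simp
    qed
    then obtain q where q: "\<And>k. (\<Sum>i<n. (\<Delta> \<epsilon> i - P (cl k) (a k) (q k) i)\<^sup>2) \<le> 10 * b / 16 ^ k" by metis
    show ?thesis
    proof (rule chaining_bound[where A = "\<lambda>k. P (cl k) (a k) (q k)"])
      show "(\<Sum>i<n. (\<Delta> \<epsilon> i)\<^sup>2) \<le> 2 * (\<Sum>i<n. \<epsilon> i * \<Delta> \<epsilon> i)" using basic[of \<epsilon>] by (simp add: \<Delta>_def)
      \<comment> \<open>The initial term is treated as an increment towards the zero polynomial on
        level 1, so that \<open>Q 0\<close> covers it as well.\<close>
      have 0: "P (cl (Suc 0)) (a (Suc 0)) (\<lambda>_ _. 0) i = 0" for i by (simp add: P_def)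
      have "(\<Sum>i<n. \<epsilon> i * (- P (cl 0) (a 0) (q 0) i))\<^sup>2 \<le> Q 0 \<epsilon> * (\<Sum>i<n. (- P (cl 0) (a 0) (q 0) i)\<^sup>2)"
        using QP[of \<epsilon> 0 "\<lambda>_ _. 0" "q 0"] unfolding 0 by simp
      then show "(\<Sum>i<n. \<epsilon> i * P (cl 0) (a 0) (q 0) i)\<^sup>2 \<le> Q 0 \<epsilon> * (\<Sum>i<n. (P (cl 0) (a 0) (q 0) i)\<^sup>2)"
        by (simp add: sum_negf)
    qed (use b0 Q0 QP q in auto)
  qed
  let ?M = "PiM {..<n} (\<lambda>_. gauss \<sigma>)"
  interpret prob_space ?M by (rule prob_space_PiM_gauss[OF \<sigma>])
  define s where "s = \<sigma>\<^sup>2 * real m * real J"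
  have s0: "s \<ge> 0" by (simp add: s_def)
  have EQ: "mean_le ?M (Q k) (9 * s * 2 ^ k)" for k
  proof -
    have "mean_le ?M (Q k) (\<sigma>\<^sup>2 * card (I k))"
      unfolding Q_def by (rule mean_le_projection_energy[OF \<sigma> finI]) (use e in blast)
    moreover have "\<sigma>\<^sup>2 * real (card (I k)) \<le> \<sigma>\<^sup>2 * (9 * real m * real J * 2 ^ k)" by (intro mult_left_mono cardI) simp
    ultimately have "mean_le ?M (Q k) (\<sigma>\<^sup>2 * (9 * real m * real J * 2 ^ k))" by (rule mean_le_mono)
    then show ?thesis by (simp add: s_def mult_ac)
  qed
  note Ee = mean_le_noise_energy[OF \<sigma>, of n]
  have "mean_le ?M (\<lambda>\<epsilon>. 8 * Q 0 \<epsilon> + 2 * (\<Sum>k<n. 1 / 4 ^ k * Q k \<epsilon>) + 2 / 4 ^ n * (\<Sum>i<n. (\<epsilon> i)\<^sup>2) + 90 * b)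
     (8 * (9 * s * 2 ^ 0) + 2 * (\<Sum>k<n. 1 / 4 ^ k * (9 * s * 2 ^ k)) + 2 / 4 ^ n * (\<sigma>\<^sup>2 * n) + 90 * b)"
    by (intro mean_le_add mean_le_cmult mean_le_sum mean_le_const EQ Ee) (use b0 in auto)
  \<comment> \<open>110 = 72 + 36 + 2: the coarsest level, the geometric series with ratio 1/2, and
    the leftover noise energy.\<close>
  moreover have "8 * (9 * s * 2 ^ 0) + 2 * (\<Sum>k<n. 1 / 4 ^ k * (9 * s * 2 ^ k)) + 2 / 4 ^ n * (\<sigma>\<^sup>2 * n) + 90 * b \<le> 110 * s + 90 * b"
  proof -
    have "1 / 4 ^ k * (9 * s * 2 ^ k) = 9 * s * (1/2) ^ k" for k
    proof -
      have "(4::real) ^ k = 2 ^ k * 2 ^ k" by (simp add: power_mult_distrib[symmetric])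
      then show ?thesis by (simp add: power_one_over)
    qed
    then have "(\<Sum>k<n. 1 / 4 ^ k * (9 * s * 2 ^ k)) = 9 * s * (\<Sum>k<n. (1/2) ^ k)" by (simp add: sum_distrib_left)
    also have "\<dots> \<le> 9 * s * 2" using s0 by (intro mult_left_mono) (simp_all add: sum_gp_strict)
    finally have 1: "(\<Sum>k<n. 1 / 4 ^ k * (9 * s * 2 ^ k)) \<le> 18 * s" by simp
    have "real n \<le> 4 ^ n"
    proof -
      have "n \<le> 2 ^ n" by simp
      also have "\<dots> \<le> (4::nat) ^ n" by (intro power_mono) auto
      finally show ?thesis by (metis of_nat_le_iff of_nat_numeral of_nat_power)
    qed
    then have "2 / 4 ^ n * (\<sigma>\<^sup>2 * n) \<le> 2 * \<sigma>\<^sup>2" by (simp add: divide_le_eq mult_left_mono)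
    also have "\<dots> \<le> 2 * s"
    proof -
      have "real m * real J \<ge> 1 * 1" using m J by (intro mult_mono) auto
      then have "\<sigma>\<^sup>2 * 1 \<le> \<sigma>\<^sup>2 * (real m * real J)" by (intro mult_left_mono) auto
      then show ?thesis by (simp add: s_def mult_ac)
    qed
    finally show ?thesis using 1 by simp
  qed
  ultimately have "mean_le ?M (\<lambda>\<epsilon>. 8 * Q 0 \<epsilon> + 2 * (\<Sum>k<n. 1 / 4 ^ k * Q k \<epsilon>) + 2 / 4 ^ n * (\<Sum>i<n. (\<epsilon> i)\<^sup>2) + 90 * b) (110 * s + 90 * b)"
    by (rule mean_le_mono)
  then have fin: "mean_le ?M (\<lambda>\<epsilon>. 1 / real n * (8 * Q 0 \<epsilon> + 2 * (\<Sum>k<n. 1 / 4 ^ k * Q k \<epsilon>) + 2 / 4 ^ n * (\<Sum>i<n. (\<epsilon> i)\<^sup>2) + 90 * b))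
     (1 / real n * (110 * s + 90 * b))"
    by (rule mean_le_cmult) simp
  \<comment> \<open>Nothing is known about measurability of the estimator; monotonicity of the
    nonnegative integral holds for arbitrary functions, and only the majorant is evaluated.\<close>
  have "ls_risk n \<sigma> x y yhat \<le> (\<integral>\<^sup>+ \<epsilon>. ennreal (1 / real n * (8 * Q 0 \<epsilon> + 2 * (\<Sum>k<n. 1 / 4 ^ k * Q k \<epsilon>) + 2 / 4 ^ n * (\<Sum>i<n. (\<epsilon> i)\<^sup>2) + 90 * b)) \<partial>?M)"
    unfolding ls_risk_def using pt by (intro nn_integral_mono ennreal_leI mult_left_mono) (simp_all add: \<Delta>_def)
  also have "\<dots> \<le> ennreal (1 / real n * (110 * s + 90 * b))" using fin by (simp add: mean_le_def)
  also have "1 / real n * (110 * s + 90 * b) = 110 * (\<sigma>\<^sup>2 / n) * real m * real J + 90 * 4 ^ m / real J ^ (2 * m)"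
    using n by (simp add: s_def b_def add_divide_distrib mult_ac)
  finally show ?thesis .
qed

section \<open>Derivatives of solutions\<close>

lemma DERIV_bound_imp_Lipschitz:
  fixes f f' :: "real \<Rightarrow> real"
  assumes "\<And>t. t \<in> {a..b} \<Longrightarrow> (f has_real_derivative f' t) (at t within {a..b})"
    and "\<And>t. t \<in> {a..b} \<Longrightarrow> \<bar>f' t\<bar> \<le> K" and "s \<in> {a..b}" "t \<in> {a..b}"
  shows "\<bar>f s - f t\<bar> \<le> K * \<bar>s - t\<bar>"
  using field_differentiable_bound[of "{a..b}" f f' K s t] assms by simp

lemma Lipschitz_imp_abs_cont_on:
  assumes "\<And>s t. s \<in> {a..b} \<Longrightarrow> t \<in> {a..b} \<Longrightarrow> \<bar>f s - f t\<bar> \<le> K * \<bar>s - t\<bar>"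
  shows "abs_cont_on a b f"
  unfolding abs_cont_on_def
proof (intro allI impI)
  fix e :: real assume e: "e > 0"
  define d where "d = e / (\<bar>K\<bar> + 1)"
  have d: "d > 0" using e by (simp add: d_def)
  show "\<exists>\<delta>>0. \<forall>(m::nat) (u::nat \<Rightarrow> real) v.
        (\<forall>i<m. a \<le> u i \<and> u i \<le> v i \<and> v i \<le> b) \<and>
        (\<forall>i<m. \<forall>j<m. i \<noteq> j \<longrightarrow> v i \<le> u j \<or> v j \<le> u i) \<and>
        (\<Sum>i<m. v i - u i) < \<delta> \<longrightarrow> (\<Sum>i<m. \<bar>f (v i) - f (u i)\<bar>) < e"
  proof (intro exI[of _ d] conjI allI impI d)
    fix m :: nat and u v :: "nat \<Rightarrow> real"
    assume A: "(\<forall>i<m. a \<le> u i \<and> u i \<le> v i \<and> v i \<le> b) \<and>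
        (\<forall>i<m. \<forall>j<m. i \<noteq> j \<longrightarrow> v i \<le> u j \<or> v j \<le> u i) \<and> (\<Sum>i<m. v i - u i) < d"
    have "\<bar>f (v i) - f (u i)\<bar> \<le> (\<bar>K\<bar> + 1) * (v i - u i)" if "i < m" for i
    proof -
      have uv: "a \<le> u i" "u i \<le> v i" "v i \<le> b" using A that by auto
      have "\<bar>f (v i) - f (u i)\<bar> \<le> K * \<bar>v i - u i\<bar>" using assms[of "v i" "u i"] uv by simp
      also have "\<dots> \<le> (\<bar>K\<bar> + 1) * (v i - u i)" using uv by (intro mult_mono) auto
      finally show ?thesis .
    qed
    then have "(\<Sum>i<m. \<bar>f (v i) - f (u i)\<bar>) \<le> (\<Sum>i<m. (\<bar>K\<bar> + 1) * (v i - u i))" by (intro sum_mono) auto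
    also have "\<dots> = (\<bar>K\<bar> + 1) * (\<Sum>i<m. v i - u i)" by (simp add: sum_distrib_left)
    also have "\<dots> < (\<bar>K\<bar> + 1) * d" using A by (intro mult_strict_left_mono) auto
    also have "\<dots> = e" by (simp add: d_def)
    finally show "(\<Sum>i<m. \<bar>f (v i) - f (u i)\<bar>) < e" .
  qed
qed

text \<open>\<open>comb G l k c u\<close>: the function \<open>u\<close> is a sum of products, each of at most \<open>k\<close> factors from \<open>G l\<close>,
  with coefficients adding up to at most \<open>c\<close>. In the application \<open>G l\<close> consists of the partial derivatives of
  order at most \<open>l\<close> of the right-hand side of the differential equation, taken along the solution.\<close>

inductive comb :: "(nat \<Rightarrow> (real \<Rightarrow> real) set) \<Rightarrow> nat \<Rightarrow> nat \<Rightarrow> real \<Rightarrow> (real \<Rightarrow> real) \<Rightarrow> bool"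
  for G l where
  base: "u \<in> G l \<Longrightarrow> comb G l 1 1 u"
| mult: "comb G l k c u \<Longrightarrow> comb G l k' c' v \<Longrightarrow> comb G l (k + k') (c * c') (\<lambda>t. u t * v t)"
| add: "comb G l k c u \<Longrightarrow> comb G l k c' v \<Longrightarrow> comb G l k (c + c') (\<lambda>t. u t + v t)"
| weaken: "comb G l k c u \<Longrightarrow> k \<le> k' \<Longrightarrow> c \<le> c' \<Longrightarrow> comb G l k' c' u"

lemma comb_nonneg: "comb G l k c u \<Longrightarrow> c \<ge> 0"
  by (induction rule: comb.induct) auto

lemma comb_level_mono:
  assumes "comb G l k c u" "G l \<subseteq> G l'"
  shows "comb G l' k c u"
  using assms(1)
proof (induction rule: comb.induct)
  case (base u)
  then have "u \<in> G l'" using assms(2) by blast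
  then show ?case by (rule comb.base)
next
  case (mult k c u k' c' v)
  then show ?case by (intro comb.mult)
next
  case (add k c u c' v)
  then show ?case by (intro comb.add)
next
  case (weaken k c u k' c')
  then show ?case by (blast intro: comb.weaken)
qed

lemma comb_bound:
  assumes "comb G l k c u" "\<And>u t. u \<in> G l \<Longrightarrow> t \<in> S \<Longrightarrow> \<bar>u t\<bar> \<le> 1" "t \<in> S"
  shows "\<bar>u t\<bar> \<le> c"
  using assms(1)
proof (induction rule: comb.induct)
  case (base u)
  then show ?case using assms by auto
next
  case (mult k c u k' c' v)
  then show ?case by (auto simp: abs_mult intro!: mult_mono dest: comb_nonneg)
qed auto

text \<open>Each product has at most \<open>k\<close> factors that are bounded by 1 and
  \<open>r\<close>-Lipschitz. The constant is the one \<open>comb_deriv\<close> would give for a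
  further derivative, so the last order fits the pattern of the others.\<close>

lemma comb_Lipschitz:
  assumes "comb G l k c u" "r \<ge> 0" "\<And>u t. u \<in> G l \<Longrightarrow> t \<in> S \<Longrightarrow> \<bar>u t\<bar> \<le> 1"
    and "\<And>u s t. u \<in> G l \<Longrightarrow> s \<in> S \<Longrightarrow> t \<in> S \<Longrightarrow> \<bar>u s - u t\<bar> \<le> r * \<bar>s - t\<bar>" and st: "s \<in> S" "t \<in> S"
  shows "\<bar>u s - u t\<bar> \<le> r * real k * c * \<bar>s - t\<bar>"
  using assms(1)
proof (induction rule: comb.induct)
  case (base u)
  then show ?case using assms by auto
next
  case (mult k c u k' c' v)
  have b: "\<bar>v s\<bar> \<le> c'" "\<bar>u t\<bar> \<le> c" using comb_bound mult.hyps assms(3) st by metis+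
  have "u s * v s - u t * v t = (u s - u t) * v s + u t * (v s - v t)" by (simp add: algebra_simps)
  then have "\<bar>u s * v s - u t * v t\<bar> \<le> \<bar>u s - u t\<bar> * \<bar>v s\<bar> + \<bar>u t\<bar> * \<bar>v s - v t\<bar>"
    by (metis abs_mult abs_triangle_ineq)
  also have "\<dots> \<le> (r * real k * c * \<bar>s - t\<bar>) * c' + c * (r * real k' * c' * \<bar>s - t\<bar>)"
    using mult.IH b comb_nonneg[OF mult.hyps(1)] comb_nonneg[OF mult.hyps(2)] assms(2)
    by (intro add_mono mult_mono) auto
  also have "\<dots> = r * real (k + k') * (c * c') * \<bar>s - t\<bar>" by (simp add: algebra_simps)
  finally show ?case .
next
  case (add k c u c' v)
  have "\<bar>u s + v s - (u t + v t)\<bar> \<le> \<bar>u s - u t\<bar> + \<bar>v s - v t\<bar>" by linarith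
  also have "\<dots> \<le> r * real k * c * \<bar>s - t\<bar> + r * real k * c' * \<bar>s - t\<bar>" using add.IH by (intro add_mono)
  also have "\<dots> = r * real k * (c + c') * \<bar>s - t\<bar>" by (simp add: algebra_simps)
  finally show ?case .
next
  case (weaken k c u k' c')
  have "r * real k * c * \<bar>s - t\<bar> \<le> r * real k' * c' * \<bar>s - t\<bar>"
    using weaken.hyps assms(2) comb_nonneg[OF weaken.hyps(1)] by (intro mult_mono) auto
  then show ?case using weaken.IH by linarith
qed

text \<open>The product rule replaces one of at most \<open>k\<close> factors by a combination of
  products of two factors with coefficient sum \<open>r\<close>: the length grows by 1, the
  coefficient sum by the factor \<open>r * k\<close>.\<close>

lemma comb_deriv:
  assumes "comb G l k c u" "r \<ge> 0" and G: "G l \<subseteq> G (Suc l)"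
    and D: "\<And>u. u \<in> G l \<Longrightarrow> \<exists>u'. comb G (Suc l) 2 r u' \<and> (\<forall>t\<in>S. (u has_real_derivative u' t) (at t within S))"
  shows "\<exists>u'. comb G (Suc l) (Suc k) (r * real k * c) u' \<and> (\<forall>t\<in>S. (u has_real_derivative u' t) (at t within S))"
  using assms(1)
proof (induction rule: comb.induct)
  case (base u)
  then show ?case using D[of u] by (simp add: numeral_2_eq_2)
next
  case (mult k c u k' c' v)
  obtain u' v' where u': "comb G (Suc l) (Suc k) (r * real k * c) u'" "\<forall>t\<in>S. (u has_real_derivative u' t) (at t within S)"
    and v': "comb G (Suc l) (Suc k') (r * real k' * c') v'" "\<forall>t\<in>S. (v has_real_derivative v' t) (at t within S)"
    using mult.IH by blast
  have uv: "comb G (Suc l) k c u" "comb G (Suc l) k' c' v" using mult.hyps G by (auto intro: comb_level_mono)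
  have "comb G (Suc l) (Suc (k + k')) (r * real k * c * c' + c * (r * real k' * c')) (\<lambda>t. u' t * v t + u t * v' t)"
    using comb.add[OF comb.mult[OF u'(1) uv(2), unfolded add_Suc] comb.mult[OF uv(1) v'(1), unfolded add_Suc_right]] .
  moreover have "r * real k * c * c' + c * (r * real k' * c') = r * real (k + k') * (c * c')" by (simp add: algebra_simps)
  moreover have "((\<lambda>t. u t * v t) has_real_derivative u' t * v t + u t * v' t) (at t within S)" if "t \<in> S" for t
    using DERIV_mult[of u "u' t" t S v "v' t"] u'(2) v'(2) that by (simp add: mult.commute)
  ultimately show ?case by (intro exI[of _ "\<lambda>t. u' t * v t + u t * v' t"]) simp
next
  case (add k c u c' v)
  obtain u' v' where u': "comb G (Suc l) (Suc k) (r * real k * c) u'" "\<forall>t\<in>S. (u has_real_derivative u' t) (at t within S)"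
    and v': "comb G (Suc l) (Suc k) (r * real k * c') v'" "\<forall>t\<in>S. (v has_real_derivative v' t) (at t within S)"
    using add.IH by blast
  have "comb G (Suc l) (Suc k) (r * real k * (c + c')) (\<lambda>t. u' t + v' t)"
    using comb.add[OF u'(1) v'(1)] by (simp add: distrib_left)
  moreover have "((\<lambda>t. u t + v t) has_real_derivative u' t + v' t) (at t within S)" if "t \<in> S" for t
    using u'(2) v'(2) that by (auto intro: DERIV_add)
  ultimately show ?case by blast
next
  case (weaken k c u k' c')
  obtain u' where u': "comb G (Suc l) (Suc k) (r * real k * c) u'" "\<forall>t\<in>S. (u has_real_derivative u' t) (at t within S)"
    using weaken.IH by blast
  have "r * real k * c \<le> r * real k' * c'"
    using weaken.hyps assms(2) comb_nonneg[OF weaken.hyps(1)] by (intro mult_mono) auto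
  then have "comb G (Suc l) (Suc k') (r * real k' * c') u'"
    using weaken.hyps by (intro comb.weaken[OF u'(1)]) auto
  then show ?case using u'(2) by blast
qed

text \<open>The factors r * 1, r * 2, ... multiply to \<open>r ^ j * fact j\<close>. This is the
  origin of the radii of the two classes, with r = 1 for the autonomous equation and r = 2 for the
  other.\<close>

lemma comb_iterated_derivs:
  assumes "r \<ge> 0" and G: "\<And>l. G l \<subseteq> G (Suc l)" and u: "u \<in> G 0"
    and D: "\<And>l u. l < \<beta> \<Longrightarrow> u \<in> G l \<Longrightarrow> \<exists>u'. comb G (Suc l) 2 r u' \<and> (\<forall>t\<in>S. (u has_real_derivative u' t) (at t within S))"
    and "N \<le> \<beta>"
  shows "\<exists>U. U 0 = u \<and> (\<forall>j\<le>N. comb G j (Suc j) (r ^ j * fact j) (U j)) \<and>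
     (\<forall>j<N. \<forall>t\<in>S. (U j has_real_derivative U (Suc j) t) (at t within S))"
  using assms(5)
proof (induction N)
  case 0
  then show ?case using comb.base[of u G 0] u by (intro exI[of _ "\<lambda>_. u"]) auto
next
  case (Suc N)
  then obtain U where U: "U 0 = u" "\<forall>j\<le>N. comb G j (Suc j) (r ^ j * fact j) (U j)"
     "\<forall>j<N. \<forall>t\<in>S. (U j has_real_derivative U (Suc j) t) (at t within S)" by auto
  have "comb G N (Suc N) (r ^ N * fact N) (U N)" using U(2) by simp
  from comb_deriv[OF this assms(1) G D] Suc.prems obtain u' where
    u': "comb G (Suc N) (Suc (Suc N)) (r * real (Suc N) * (r ^ N * fact N)) u'"
      "\<forall>t\<in>S. (U N has_real_derivative u' t) (at t within S)" by auto
  have eq: "r * real (Suc N) * (r ^ N * fact N) = r ^ Suc N * fact (Suc N)" by simp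
  have u'': "comb G (Suc N) (Suc (Suc N)) (r ^ Suc N * fact (Suc N)) u'" using u'(1) unfolding eq .
  show ?case
  proof (intro exI[of _ "U(Suc N := u')"] conjI allI impI)
    fix j assume "j \<le> Suc N"
    then show "comb G j (Suc j) (r ^ j * fact j) ((U(Suc N := u')) j)" using U(2) u'' by (cases "j = Suc N") auto
  next
    fix j assume "j < Suc N"
    then show "\<forall>t\<in>S. ((U(Suc N := u')) j has_real_derivative (U(Suc N := u')) (Suc j) t) (at t within S)"
      using U(3) u'(2) by (cases "j = N") auto
  qed (use U(1) in auto)
qed

text \<open>The approximants are the Steklov means \<open>\<epsilon>\<^sup>-\<^sup>1 \<integral>\<^sub>0\<^sup>\<epsilon> y (\<theta>t + s) ds\<close>, with \<open>\<theta> < 1\<close> keeping the argument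
  in the interval. They turn the Lipschitz bound on the last derivative of \<open>y\<close> into a bound on a genuine
  derivative, so that no almost everywhere differentiability of Lipschitz functions is needed.\<close>

lemma smooth_in_closure_sob_class:
  fixes Y :: "nat \<Rightarrow> real \<Rightarrow> real"
  assumes \<alpha>: "0 < \<alpha>" "\<alpha> \<le> 1"
    and der: "\<And>k t. k \<le> \<beta> \<Longrightarrow> t \<in> {0..\<alpha>} \<Longrightarrow> (Y k has_real_derivative Y (Suc k) t) (at t within {0..\<alpha>})"
    and lip: "\<And>k s t. k \<le> Suc \<beta> \<Longrightarrow> s \<in> {0..\<alpha>} \<Longrightarrow> t \<in> {0..\<alpha>} \<Longrightarrow> \<bar>Y k s - Y k t\<bar> \<le> c (Suc k) * \<bar>s - t\<bar>"
    and c0: "\<And>k. c k \<ge> 0" and c1: "c 1 \<le> 1" and \<eta>: "\<eta> > 0"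
  shows "\<exists>h\<in>sob_class \<alpha> (\<beta> + 2) c. \<forall>t\<in>{0..\<alpha>}. \<bar>h t - Y 0 t\<bar> \<le> \<eta>"
proof -
  define e where "e = min (\<alpha> / 2) \<eta>"
  \<comment> \<open>Then \<open>\<theta> * \<alpha> + e = \<alpha>\<close>, and the averaging window
    from \<open>\<theta> * t\<close> to \<open>\<theta> * t + e\<close> always contains
    \<open>t\<close>.\<close>
  define \<theta> where "\<theta> = 1 - e / \<alpha>"
  have e: "e > 0" "e < \<alpha>" "e \<le> \<eta>" using \<alpha> \<eta> by (auto simp: e_def)
  have \<theta>: "0 \<le> \<theta>" "\<theta> \<le> 1" using e \<alpha> by (auto simp: \<theta>_def)
  \<comment> \<open>Prepending an antiderivative turns the mean into a difference quotient, and its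
    derivatives into difference quotients of the \<open>Y j\<close>, scaled by powers of
    \<open>\<theta>\<close>.\<close>
  define Z where "Z k = (case k of 0 \<Rightarrow> (\<lambda>t. integral {0..t} (Y 0)) | Suc j \<Rightarrow> Y j)" for k
  have Y0: "continuous_on {0..\<alpha>} (Y 0)"
    using der[of 0] by (meson DERIV_continuous continuous_on_eq_continuous_within le0)
  have Z: "(Z k has_real_derivative Z (Suc k) t) (at t within {0..\<alpha>})" if "k \<le> Suc \<beta>" "t \<in> {0..\<alpha>}" for k t
    using that der integral_has_real_derivative[OF Y0 that(2)] by (cases k) (auto simp: Z_def)
  have arg: "\<theta> * t \<in> {0..\<alpha>}" "\<theta> * t + e \<in> {0..\<alpha>}" "\<theta> * t \<le> t" "t \<le> \<theta> * t + e" if t: "t \<in> {0..\<alpha>}" for t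
  proof -
    have "\<theta> * t + e = t + e * (1 - t / \<alpha>)" by (simp add: \<theta>_def algebra_simps)
    moreover have "e * (1 - t / \<alpha>) \<le> \<alpha> * (1 - t / \<alpha>)" "0 \<le> e * (1 - t / \<alpha>)" using t \<alpha> e by (auto intro: mult_right_mono)
    moreover have "\<alpha> * (1 - t / \<alpha>) = \<alpha> - t" using \<alpha> by (simp add: algebra_simps)
    moreover have "0 \<le> \<theta> * t" "\<theta> * t \<le> t" using \<theta> t by (auto intro: mult_left_le_one_le)
    ultimately show "\<theta> * t \<in> {0..\<alpha>}" "\<theta> * t + e \<in> {0..\<alpha>}" "\<theta> * t \<le> t" "t \<le> \<theta> * t + e" using t e by auto
  qed
  define D where "D k t = \<theta> ^ k * ((Z k (\<theta> * t + e) - Z k (\<theta> * t)) / e)" for k t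
  have comp: "((\<lambda>t. Z k (\<theta> * t + d)) has_real_derivative Z (Suc k) (\<theta> * t + d) * \<theta>) (at t within {0..\<alpha>})"
    if k: "k \<le> Suc \<beta>" and t: "t \<in> {0..\<alpha>}" and d: "\<And>t. t \<in> {0..\<alpha>} \<Longrightarrow> \<theta> * t + d \<in> {0..\<alpha>}" for k t d
  proof -
    have "(Z k \<circ> (\<lambda>t. \<theta> * t + d) has_real_derivative Z (Suc k) (\<theta> * t + d) * \<theta>) (at t within {0..\<alpha>})"
    proof (rule DERIV_image_chain)
      show "(Z k has_real_derivative Z (Suc k) (\<theta> * t + d)) (at (\<theta> * t + d) within (\<lambda>t. \<theta> * t + d) ` {0..\<alpha>})"
        using Z[OF k d[OF t]] by (rule DERIV_subset) (use d in auto)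
      show "((\<lambda>t. \<theta> * t + d) has_real_derivative \<theta>) (at t within {0..\<alpha>})"
        by (auto intro!: derivative_eq_intros)
    qed
    then show ?thesis by (simp add: o_def)
  qed
  have dD: "(D k has_real_derivative D (Suc k) t) (at t within {0..\<alpha>})" if k: "k \<le> Suc \<beta>" and t: "t \<in> {0..\<alpha>}" for k t
  proof -
    have "((\<lambda>t. \<theta> ^ k * ((Z k (\<theta> * t + e) - Z k (\<theta> * t + 0)) / e)) has_real_derivative
       \<theta> ^ k * ((Z (Suc k) (\<theta> * t + e) * \<theta> - Z (Suc k) (\<theta> * t + 0) * \<theta>) / e)) (at t within {0..\<alpha>})"
      using arg by (intro DERIV_cmult DERIV_cdivide DERIV_diff comp k t) auto
    moreover have "\<theta> ^ k * ((Z (Suc k) (\<theta> * t + e) * \<theta> - Z (Suc k) (\<theta> * t + 0) * \<theta>) / e) = D (Suc k) t"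
      by (simp add: D_def left_diff_distrib[symmetric])
    moreover have "(\<lambda>t. \<theta> ^ k * ((Z k (\<theta> * t + e) - Z k (\<theta> * t + 0)) / e)) = D k"
      by (simp add: D_def fun_eq_iff)
    ultimately show ?thesis by simp
  qed
  have bD: "\<bar>D k t\<bar> \<le> c k" if k: "1 \<le> k" "k \<le> \<beta> + 2" and t: "t \<in> {0..\<alpha>}" for k t
  proof -
    obtain j where j: "k = Suc j" using k by (cases k) auto
    have "\<bar>Y j (\<theta> * t + e) - Y j (\<theta> * t)\<bar> \<le> c k * \<bar>\<theta> * t + e - \<theta> * t\<bar>"
      unfolding j using k arg[OF t] by (intro lip) (auto simp: j)
    then have "\<bar>Y j (\<theta> * t + e) - Y j (\<theta> * t)\<bar> / e \<le> c k" using e by (simp add: divide_le_eq)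
    then have "\<theta> ^ k * (\<bar>Y j (\<theta> * t + e) - Y j (\<theta> * t)\<bar> / e) \<le> 1 * c k"
      using \<theta> e by (intro mult_mono power_le_one) auto
    then show ?thesis using \<theta> e by (simp add: D_def Z_def j abs_mult)
  qed
  have "D 0 \<in> sob_class \<alpha> (\<beta> + 2) c"
    unfolding sob_class_def
  proof (intro CollectI exI[of _ D] conjI ballI)
    fix k assume k: "k \<in> {1..\<beta> + 2}"
    have dk: "(D (k - 1) has_real_derivative D k t) (at t within {0..\<alpha>})" if "t \<in> {0..\<alpha>}" for t
      using dD[of "k - 1" t] k that by auto
    show "abs_cont_on 0 \<alpha> (D (k - 1))"
      by (rule Lipschitz_imp_abs_cont_on[where K = "c k"], rule DERIV_bound_imp_Lipschitz[where f' = "D k"])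
         (use dk bD k in auto)
    show "AE t in lebesgue. t \<in> {0..\<alpha>} \<longrightarrow> (D (k - 1) has_real_derivative D k t) (at t within {0..\<alpha>})"
      using dk by simp
    have "(\<integral>\<^sup>+ t\<in>{0..\<alpha>}. ennreal ((D k t)\<^sup>2) \<partial>lebesgue) \<le> (\<integral>\<^sup>+ t. ennreal ((c k)\<^sup>2) * indicator {0..\<alpha>} t \<partial>lebesgue)"
    proof (intro nn_integral_mono)
      fix t
      have "(D k t)\<^sup>2 \<le> (c k)\<^sup>2" if "t \<in> {0..\<alpha>}"
        using bD[of k t] k that c0[of k] by (intro abs_le_square_iff[THEN iffD1]) auto
      then show "ennreal ((D k t)\<^sup>2) * indicator {0..\<alpha>} t \<le> ennreal ((c k)\<^sup>2) * indicator {0..\<alpha>} t"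
        by (auto simp: indicator_def intro: ennreal_leI)
    qed
    also have "\<dots> = ennreal ((c k)\<^sup>2) * ennreal \<alpha>" using \<alpha> by (simp add: nn_integral_cmult_indicator)
    also have "\<dots> \<le> ennreal ((c k)\<^sup>2)" using \<alpha> by (simp add: ennreal_mult[symmetric] mult_left_le)
    finally show "(\<integral>\<^sup>+ t\<in>{0..\<alpha>}. ennreal ((D k t)\<^sup>2) \<partial>lebesgue) \<le> ennreal ((c k)\<^sup>2)" .
  qed simp
  moreover have "\<bar>D 0 t - Y 0 t\<bar> \<le> \<eta>" if t: "t \<in> {0..\<alpha>}" for t
  proof -
    have "\<bar>(Z 0 (\<theta> * t + e) - (\<theta> * t + e) * Y 0 t) - (Z 0 (\<theta> * t) - (\<theta> * t) * Y 0 t)\<bar> \<le> e * \<bar>\<theta> * t + e - \<theta> * t\<bar>"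
    \<comment> \<open>On a window of length \<open>e\<close> around \<open>t\<close> the 1-Lipschitz
      function \<open>Y 0\<close> differs from \<open>Y 0 t\<close> by at most \<open>e\<close>,
      hence so does its mean.\<close>
    proof (rule DERIV_bound_imp_Lipschitz[where a = "\<theta> * t" and b = "\<theta> * t + e" and f = "\<lambda>s. Z 0 s - s * Y 0 t" and f' = "\<lambda>s. Y 0 s - 1 * Y 0 t"])
      fix s assume s: "s \<in> {\<theta> * t..\<theta> * t + e}"
      have sa: "s \<in> {0..\<alpha>}" using s arg[OF t] by auto
      have "(Z 0 has_real_derivative Y 0 s) (at s within {\<theta> * t..\<theta> * t + e})"
        using Z[of 0 s] sa arg[OF t] by (auto simp: Z_def intro: DERIV_subset)
      then show "((\<lambda>s. Z 0 s - s * Y 0 t) has_real_derivative Y 0 s - 1 * Y 0 t) (at s within {\<theta> * t..\<theta> * t + e})"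
        by (intro DERIV_diff DERIV_cmult_right DERIV_ident)
      have "\<bar>Y 0 s - Y 0 t\<bar> \<le> c 1 * \<bar>s - t\<bar>" using lip[of 0 s t] sa t by simp
      also have "\<dots> \<le> 1 * e" using c1 c0[of 1] s arg[OF t] by (intro mult_mono) auto
      finally show "\<bar>Y 0 s - 1 * Y 0 t\<bar> \<le> e" by simp
    qed (use e in auto)
    moreover have "e * D 0 t = Z 0 (\<theta> * t + e) - Z 0 (\<theta> * t)" using e by (simp add: D_def)
    ultimately have "\<bar>e * (D 0 t - Y 0 t)\<bar> \<le> e * e" using e by (simp add: algebra_simps)
    then have "\<bar>D 0 t - Y 0 t\<bar> \<le> e" using e by (simp add: abs_mult)
    then show ?thesis using e by simp
  qed
  ultimately show ?thesis by blast
qed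

section \<open>Differential calculus on a box and along the solution\<close>

lemma has_real_derivative_zero_if_quadratic:
  fixes R :: "real \<Rightarrow> real"
  assumes K: "\<And>s. s \<in> S \<Longrightarrow> \<bar>R s - R t\<bar> \<le> K * (s - t)\<^sup>2"
  shows "(R has_real_derivative 0) (at t within S)"
  unfolding has_field_derivative_def has_derivative_within_alt
proof (intro conjI allI impI)
  fix e :: real assume e: "e > 0"
  show "\<exists>d>0. \<forall>s\<in>S. norm (s - t) < d \<longrightarrow> norm (R s - R t - 0 * (s - t)) \<le> e * norm (s - t)"
  proof (intro exI[of _ "e / (\<bar>K\<bar> + 1)"] conjI ballI impI)
    show "e / (\<bar>K\<bar> + 1) > 0" using e by simp
    fix s assume s: "s \<in> S" and d: "norm (s - t) < e / (\<bar>K\<bar> + 1)"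
    have "\<bar>R s - R t\<bar> \<le> K * (s - t)\<^sup>2" by (rule K[OF s])
    also have "\<dots> \<le> (\<bar>K\<bar> + 1) * (\<bar>s - t\<bar> * \<bar>s - t\<bar>)"
      unfolding abs_mult_self_eq power2_eq_square by (intro mult_right_mono) auto
    also have "\<dots> = ((\<bar>K\<bar> + 1) * \<bar>s - t\<bar>) * \<bar>s - t\<bar>" by simp
    also have "\<dots> \<le> e * \<bar>s - t\<bar>" using d by (intro mult_right_mono) (auto simp: field_simps)
    finally show "norm (R s - R t - 0 * (s - t)) \<le> e * norm (s - t)" by simp
  qed
qed (rule bounded_linear_mult_right)

text \<open>Mean value inequality for \<open>f\<close> minus a line of slope \<open>L\<close>.
  Restricting the premise to points no farther from \<open>t\<close> than \<open>s\<close> lets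
  \<open>K\<close> shrink with the increment, which yields quadratic remainders.\<close>

lemma DERIV_approx_bound:
  fixes f f' :: "real \<Rightarrow> real"
  assumes "\<And>t. t \<in> {a..b} \<Longrightarrow> (f has_real_derivative f' t) (at t within {a..b})"
    and s: "s \<in> {a..b}" and t: "t \<in> {a..b}"
    and "\<And>z. z \<in> {a..b} \<Longrightarrow> \<bar>z - t\<bar> \<le> \<bar>s - t\<bar> \<Longrightarrow> \<bar>f' z - L\<bar> \<le> K"
  shows "\<bar>f s - f t - (s - t) * L\<bar> \<le> K * \<bar>s - t\<bar>"
proof -
  have sub: "{min s t..max s t} \<subseteq> {a..b}" using s t by auto
  have "\<bar>(f s - s * L) - (f t - t * L)\<bar> \<le> K * \<bar>s - t\<bar>"
  proof (rule DERIV_bound_imp_Lipschitz[where a = "min s t" and b = "max s t" and f' = "\<lambda>z. f' z - 1 * L"])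
    fix z assume z: "z \<in> {min s t..max s t}"
    have "(f has_real_derivative f' z) (at z within {min s t..max s t})"
      using assms(1)[of z] z sub by (meson DERIV_subset subsetD)
    then show "((\<lambda>z. f z - z * L) has_real_derivative f' z - 1 * L) (at z within {min s t..max s t})"
      by (intro DERIV_diff DERIV_cmult_right DERIV_ident)
    have "\<bar>z - t\<bar> \<le> \<bar>s - t\<bar>" using z by (cases "s \<le> t") auto
    moreover have "z \<in> {a..b}" using z sub by blast
    ultimately show "\<bar>f' z - 1 * L\<bar> \<le> K" using assms(4)[of z] by simp
  qed auto
  then show ?thesis by (simp add: algebra_simps)
qed

text \<open>Interchange of mixed partial derivatives in the manner of Peano: only the derivative of \<open>B\<close>, in the
  one order in which it is assumed to exist, has to be continuous.\<close>

lemma mixed_partial_interchange: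
  fixes g A B C :: "real \<Rightarrow> real \<Rightarrow> real"
  assumes ab: "a1 < b1"
    and A: "\<And>s t. s \<in> {a1..b1} \<Longrightarrow> t \<in> {a2..b2} \<Longrightarrow> ((\<lambda>s. g s t) has_real_derivative A s t) (at s within {a1..b1})"
    and B: "\<And>s t. s \<in> {a1..b1} \<Longrightarrow> t \<in> {a2..b2} \<Longrightarrow> ((\<lambda>t. g s t) has_real_derivative B s t) (at t within {a2..b2})"
    and C: "\<And>s t. s \<in> {a1..b1} \<Longrightarrow> t \<in> {a2..b2} \<Longrightarrow> ((\<lambda>s. B s t) has_real_derivative C s t) (at s within {a1..b1})"
    and lip: "\<And>s t s' t'. s \<in> {a1..b1} \<Longrightarrow> t \<in> {a2..b2} \<Longrightarrow> s' \<in> {a1..b1} \<Longrightarrow> t' \<in> {a2..b2} \<Longrightarrow>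
        \<bar>C s t - C s' t'\<bar> \<le> \<bar>s - s'\<bar> + \<bar>t - t'\<bar>"
    and s0: "s0 \<in> {a1..b1}" and t0: "t0 \<in> {a2..b2}"
  shows "((\<lambda>t. A s0 t) has_real_derivative C s0 t0) (at t0 within {a2..b2})"
proof -
  define c where "c = C s0 t0"
  \<comment> \<open>The second difference is estimated by two nested mean value inequalities, the
    outer in \<open>t\<close> through \<open>B\<close>, the inner in \<open>s\<close> through
    \<open>C\<close>.\<close>
  have key: "\<bar>(g s t - g s0 t) - (g s t0 - g s0 t0) - (t - t0) * ((s - s0) * c)\<bar>
      \<le> (\<bar>s - s0\<bar> + \<bar>t - t0\<bar>) * \<bar>s - s0\<bar> * \<bar>t - t0\<bar>" if s: "s \<in> {a1..b1}" and t: "t \<in> {a2..b2}" for s t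
  proof (rule DERIV_approx_bound[where f = "\<lambda>t. g s t - g s0 t" and f' = "\<lambda>t. B s t - B s0 t", OF _ t t0])
    show "((\<lambda>t. g s t - g s0 t) has_real_derivative B s z - B s0 z) (at z within {a2..b2})" if "z \<in> {a2..b2}" for z
      by (intro DERIV_diff B s s0 that)
    fix z assume z: "z \<in> {a2..b2}" "\<bar>z - t0\<bar> \<le> \<bar>t - t0\<bar>"
    show "\<bar>(B s z - B s0 z) - (s - s0) * c\<bar> \<le> (\<bar>s - s0\<bar> + \<bar>t - t0\<bar>) * \<bar>s - s0\<bar>"
    proof (rule DERIV_approx_bound[where f = "\<lambda>s. B s z", OF _ s s0])
      show "((\<lambda>s. B s z) has_real_derivative C w z) (at w within {a1..b1})" if "w \<in> {a1..b1}" for w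
        by (rule C[OF that z(1)])
      show "\<bar>C w z - c\<bar> \<le> \<bar>s - s0\<bar> + \<bar>t - t0\<bar>" if "w \<in> {a1..b1}" "\<bar>w - s0\<bar> \<le> \<bar>s - s0\<bar>" for w
        using lip[OF that(1) z(1) s0 t0] that(2) z(2) unfolding c_def by linarith
    qed
  qed
  \<comment> \<open>\<open>a1 < b1\<close> makes \<open>s0\<close> a limit point, so that
    \<open>key\<close>, divided by \<open>s - s0\<close>, survives the passage
    \<open>s \<longlongrightarrow> s0\<close>.\<close>
  have nontriv: "at s0 within {a1..b1} \<noteq> bot"
    using s0 ab by (auto simp: trivial_limit_within islimpt_Icc)
  have quad: "\<bar>A s0 t - A s0 t0 - (t - t0) * c\<bar> \<le> 1 * (t - t0)\<^sup>2" if t: "t \<in> {a2..b2}" for t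
  proof -
    have slope: "((\<lambda>s. (g s u - g s0 u) / (s - s0)) \<longlongrightarrow> A s0 u) (at s0 within {a1..b1})" if "u \<in> {a2..b2}" for u
      using A[OF s0 that] by (simp add: has_field_derivative_iff)
    have lim1: "((\<lambda>s. \<bar>(g s t - g s0 t) / (s - s0) - (g s t0 - g s0 t0) / (s - s0) - (t - t0) * c\<bar>)
        \<longlongrightarrow> \<bar>A s0 t - A s0 t0 - (t - t0) * c\<bar>) (at s0 within {a1..b1})"
      by (intro tendsto_intros slope t t0)
    have "((\<lambda>s. (\<bar>s - s0\<bar> + \<bar>t - t0\<bar>) * \<bar>t - t0\<bar>) \<longlongrightarrow> (\<bar>s0 - s0\<bar> + \<bar>t - t0\<bar>) * \<bar>t - t0\<bar>) (at s0 within {a1..b1})"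
      by (intro tendsto_intros)
    then have lim2: "((\<lambda>s. (\<bar>s - s0\<bar> + \<bar>t - t0\<bar>) * \<bar>t - t0\<bar>) \<longlongrightarrow> (t - t0)\<^sup>2) (at s0 within {a1..b1})"
      by (simp add: power2_eq_square)
    have "\<bar>A s0 t - A s0 t0 - (t - t0) * c\<bar> \<le> (t - t0)\<^sup>2"
    proof (rule tendsto_le[OF nontriv lim2 lim1])
      show "\<forall>\<^sub>F s in at s0 within {a1..b1}. \<bar>(g s t - g s0 t) / (s - s0) - (g s t0 - g s0 t0) / (s - s0) - (t - t0) * c\<bar>
          \<le> (\<bar>s - s0\<bar> + \<bar>t - t0\<bar>) * \<bar>t - t0\<bar>"
        unfolding eventually_at_filter
      proof (intro always_eventually allI impI)
        fix s assume s: "s \<noteq> s0" "s \<in> {a1..b1}"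
        have "\<bar>(g s t - g s0 t) / (s - s0) - (g s t0 - g s0 t0) / (s - s0) - (t - t0) * c\<bar>
            = \<bar>((g s t - g s0 t) - (g s t0 - g s0 t0) - (t - t0) * ((s - s0) * c)) / (s - s0)\<bar>"
          using s(1) by (simp add: diff_divide_distrib)
        also have "\<dots> \<le> (\<bar>s - s0\<bar> + \<bar>t - t0\<bar>) * \<bar>t - t0\<bar>"
          using key[OF s(2) t] s(1) by (simp add: abs_divide divide_le_eq mult_ac)
        finally show "\<bar>(g s t - g s0 t) / (s - s0) - (g s t0 - g s0 t0) / (s - s0) - (t - t0) * c\<bar>
          \<le> (\<bar>s - s0\<bar> + \<bar>t - t0\<bar>) * \<bar>t - t0\<bar>" .
      qed
    qed
    then show ?thesis by simp
  qed
  have "((\<lambda>t. (A s0 t - t * c) + t * c) has_real_derivative 0 + 1 * c) (at t0 within {a2..b2})"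
    by (intro DERIV_add DERIV_cmult_right DERIV_ident has_real_derivative_zero_if_quadratic[where K = 1])
       (use quad in \<open>simp add: algebra_simps\<close>)
  then show ?thesis by (simp add: c_def)
qed

text \<open>The curve may touch the boundary of the box, where only one-sided partial derivatives
  exist. The increment is therefore split into one horizontal and one vertical step inside the box,
  and Lipschitz partial derivatives leave a quadratic remainder.\<close>

lemma DERIV_along_curve:
  fixes h h1 h2 :: "real \<Rightarrow> real \<Rightarrow> real" and y :: "real \<Rightarrow> real" and y' :: real
  assumes h1: "\<And>s t. s \<in> {a1..b1} \<Longrightarrow> t \<in> {a2..b2} \<Longrightarrow> ((\<lambda>s. h s t) has_real_derivative h1 s t) (at s within {a1..b1})"
    and h2: "\<And>s t. s \<in> {a1..b1} \<Longrightarrow> t \<in> {a2..b2} \<Longrightarrow> ((\<lambda>t. h s t) has_real_derivative h2 s t) (at t within {a2..b2})"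
    and lip1: "\<And>s t s' t'. s \<in> {a1..b1} \<Longrightarrow> t \<in> {a2..b2} \<Longrightarrow> s' \<in> {a1..b1} \<Longrightarrow> t' \<in> {a2..b2} \<Longrightarrow>
        \<bar>h1 s t - h1 s' t'\<bar> \<le> \<bar>s - s'\<bar> + \<bar>t - t'\<bar>"
    and lip2: "\<And>s t s' t'. s \<in> {a1..b1} \<Longrightarrow> t \<in> {a2..b2} \<Longrightarrow> s' \<in> {a1..b1} \<Longrightarrow> t' \<in> {a2..b2} \<Longrightarrow>
        \<bar>h2 s t - h2 s' t'\<bar> \<le> \<bar>s - s'\<bar> + \<bar>t - t'\<bar>"
    and S: "S \<subseteq> {a1..b1}" "\<And>s. s \<in> S \<Longrightarrow> y s \<in> {a2..b2}"
    and ylip: "\<And>s t. s \<in> S \<Longrightarrow> t \<in> S \<Longrightarrow> \<bar>y s - y t\<bar> \<le> \<bar>s - t\<bar>"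
    and s0: "s0 \<in> S" and yd: "(y has_real_derivative y') (at s0 within S)"
  shows "((\<lambda>s. h s (y s)) has_real_derivative h1 s0 (y s0) + h2 s0 (y s0) * y') (at s0 within S)"
proof -
  define p where "p = h1 s0 (y s0)"
  define q where "q = h2 s0 (y s0)"
  \<comment> \<open>3 = 2 + 1: along the horizontal step both coordinates differ from the base
    point, along the vertical one only the second.\<close>
  have "\<bar>(h s (y s) - s * p - y s * q) - (h s0 (y s0) - s0 * p - y s0 * q)\<bar> \<le> 3 * (s - s0)\<^sup>2" if s: "s \<in> S" for s
  proof -
    have in1: "s \<in> {a1..b1}" "s0 \<in> {a1..b1}" "y s \<in> {a2..b2}" "y s0 \<in> {a2..b2}" using S s s0 by auto
    have yl: "\<bar>y s - y s0\<bar> \<le> \<bar>s - s0\<bar>" by (rule ylip[OF s s0])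
    have 1: "\<bar>h s (y s) - h s0 (y s) - (s - s0) * p\<bar> \<le> (2 * \<bar>s - s0\<bar>) * \<bar>s - s0\<bar>"
    proof (rule DERIV_approx_bound[where f = "\<lambda>s'. h s' (y s)", OF _ in1(1,2)])
      show "((\<lambda>s'. h s' (y s)) has_real_derivative h1 z (y s)) (at z within {a1..b1})" if "z \<in> {a1..b1}" for z
        by (rule h1[OF that in1(3)])
      show "\<bar>h1 z (y s) - p\<bar> \<le> 2 * \<bar>s - s0\<bar>" if "z \<in> {a1..b1}" "\<bar>z - s0\<bar> \<le> \<bar>s - s0\<bar>" for z
        using order_trans[OF lip1[OF that(1) in1(3) in1(2) in1(4)] add_mono[OF that(2) yl]] by (simp add: p_def)
    qed
    have 2: "\<bar>h s0 (y s) - h s0 (y s0) - (y s - y s0) * q\<bar> \<le> \<bar>s - s0\<bar> * \<bar>y s - y s0\<bar>"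
    proof (rule DERIV_approx_bound[where f = "\<lambda>t'. h s0 t'", OF _ in1(3,4)])
      show "((\<lambda>t'. h s0 t') has_real_derivative h2 s0 z) (at z within {a2..b2})" if "z \<in> {a2..b2}" for z
        by (rule h2[OF in1(2) that])
      show "\<bar>h2 s0 z - q\<bar> \<le> \<bar>s - s0\<bar>" if "z \<in> {a2..b2}" "\<bar>z - y s0\<bar> \<le> \<bar>y s - y s0\<bar>" for z
        using order_trans[OF lip2[OF in1(2) that(1) in1(2) in1(4)]] order_trans[OF that(2) yl] by (simp add: q_def)
    qed
    have 3: "\<bar>s - s0\<bar> * \<bar>y s - y s0\<bar> \<le> \<bar>s - s0\<bar> * \<bar>s - s0\<bar>" using yl by (intro mult_left_mono) auto
    have sq: "\<bar>s - s0\<bar> * \<bar>s - s0\<bar> = (s - s0)\<^sup>2" by (simp add: power2_eq_square)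
    have "(h s (y s) - s * p - y s * q) - (h s0 (y s0) - s0 * p - y s0 * q)
        = (h s (y s) - h s0 (y s) - (s - s0) * p) + (h s0 (y s) - h s0 (y s0) - (y s - y s0) * q)"
      by (simp add: algebra_simps)
    then show ?thesis using 1 2 3 sq by linarith
  qed
  then have "((\<lambda>s. h s (y s) - s * p - y s * q) has_real_derivative 0) (at s0 within S)"
    by (rule has_real_derivative_zero_if_quadratic)
  then have "((\<lambda>s. (h s (y s) - s * p - y s * q) + s * p + y s * q) has_real_derivative 0 + 1 * p + y' * q) (at s0 within S)"
    by (intro DERIV_add DERIV_cmult_right DERIV_ident yd)
  then show ?thesis by (simp add: p_def q_def mult.commute)
qed

text \<open>The speed is controlled only inside the box. Up to the first time \<open>\<tau>\<close>
  at which the boundary is reached it is at most 1, so reaching it takes time at least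
  \<open>b\<close>, which is no less than \<open>\<alpha>\<close>.\<close>

lemma solution_stays_in_box:
  fixes y F :: "real \<Rightarrow> real"
  assumes \<alpha>: "\<alpha> \<le> b" and y0: "\<bar>y 0\<bar> \<le> C0" and b: "b > 0"
    and der: "\<And>t. t \<in> {0..\<alpha>} \<Longrightarrow> (y has_real_derivative F t) (at t within {0..\<alpha>})"
    and F: "\<And>t. t \<in> {0..\<alpha>} \<Longrightarrow> \<bar>y t\<bar> \<le> C0 + b \<Longrightarrow> \<bar>F t\<bar> \<le> 1"
    and t: "t \<in> {0..\<alpha>}"
  shows "\<bar>y t\<bar> \<le> C0 + b"
proof (rule ccontr)
  assume contra: "\<not> \<bar>y t\<bar> \<le> C0 + b"
  define T where "T = {0..t} \<inter> (\<lambda>s. \<bar>y s\<bar>) -` {C0 + b..}"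
  have cont: "continuous_on {0..t} y"
  proof (rule continuous_on_subset)
    show "continuous_on {0..\<alpha>} y"
      using der by (meson DERIV_continuous continuous_on_eq_continuous_within)
  qed (use t in auto)
  have "closed T" unfolding T_def
    by (intro continuous_closed_preimage continuous_on_rabs cont) auto
  moreover have "bounded T" unfolding T_def by (rule bounded_subset[of "{0..t}"]) auto
  ultimately have "compact T" by (simp add: compact_eq_bounded_closed)
  moreover have "t \<in> T" using contra t by (auto simp: T_def)
  ultimately obtain \<tau> where \<tau>: "\<tau> \<in> T" "\<And>s. s \<in> T \<Longrightarrow> \<tau> \<le> s" using compact_attains_inf[of T] by auto
  have \<tau>t: "0 \<le> \<tau>" "\<tau> \<le> t" "\<bar>y \<tau>\<bar> \<ge> C0 + b" using \<tau>(1) by (auto simp: T_def)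
  have less: "\<bar>y s\<bar> \<le> C0 + b" if "0 \<le> s" "s < \<tau>" for s
  proof (rule ccontr)
    assume "\<not> \<bar>y s\<bar> \<le> C0 + b"
    then have "s \<in> T" using that \<tau>t by (auto simp: T_def)
    then show False using \<tau>(2)[of s] that by simp
  qed
  have bd: "\<bar>y \<tau>\<bar> \<le> C0 + \<tau>"
  proof (cases "\<tau> = 0")
    case False
    then have "0 < \<tau>" using \<tau>t by simp
    have "\<exists>l z. 0 < z \<and> z < \<tau> \<and> (y has_real_derivative l) (at z) \<and> y \<tau> - y 0 = (\<tau> - 0) * l"
    proof (rule MVT[OF \<open>0 < \<tau>\<close>])
      show "continuous_on {0..\<tau>} y" using cont by (rule continuous_on_subset) (use \<tau>t in auto)
      show "y differentiable (at z)" if "0 < z" "z < \<tau>" for z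
      proof -
        have "(y has_real_derivative F z) (at z)" using der[of z] that \<tau>t t at_within_Icc_at[of 0 z \<alpha>] by simp
        then show ?thesis by (auto simp: real_differentiable_def)
      qed
    qed
    then obtain l z where z: "0 < z" "z < \<tau>" "(y has_real_derivative l) (at z)" "y \<tau> - y 0 = \<tau> * l" by auto
    have "(y has_real_derivative F z) (at z)" using der[of z] z(1,2) \<tau>t t at_within_Icc_at[of 0 z \<alpha>] by simp
    then have "l = F z" using z(3) DERIV_unique by blast
    moreover have "\<bar>F z\<bar> \<le> 1" using F[of z] less[of z] z(1,2) \<tau>t t by auto
    ultimately have "\<bar>\<tau> * l\<bar> \<le> \<tau> * 1" unfolding abs_mult using \<tau>t by (intro mult_mono) auto
    then show ?thesis using z(4) y0 by linarith
  qed (use y0 in auto)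
  then have "\<tau> \<ge> b" using \<tau>t by linarith
  \<comment> \<open>The borderline case: the boundary is met only at time \<open>b\<close>, where it
    is reached but not exceeded.\<close>
  then have "\<tau> = t" "\<tau> = b" using \<tau>t t \<alpha> by auto
  then show False using bd contra by simp
qed

text \<open>\<open>S2\<close> grants derivatives in the second variable only for
  \<open>p = 0\<close>. The others come from interchanging the order of differentiation, and
  Lipschitz bounds below the top order come from bounded partial derivatives.\<close>

lemma S2_mixed_partials:
  fixes D :: "nat \<Rightarrow> nat \<Rightarrow> real \<Rightarrow> real \<Rightarrow> real"
  assumes ab: "a1 < b1"
    and dt: "\<And>q s t. q < \<gamma> \<Longrightarrow> s \<in> {a1..b1} \<Longrightarrow> t \<in> {a2..b2} \<Longrightarrow> ((\<lambda>t. D 0 q s t) has_real_derivative D 0 (Suc q) s t) (at t within {a2..b2})"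
    and ds: "\<And>p q s t. p + q < \<gamma> \<Longrightarrow> s \<in> {a1..b1} \<Longrightarrow> t \<in> {a2..b2} \<Longrightarrow> ((\<lambda>s. D p q s t) has_real_derivative D (Suc p) q s t) (at s within {a1..b1})"
    and bd: "\<And>p q s t. p + q \<le> \<gamma> \<Longrightarrow> s \<in> {a1..b1} \<Longrightarrow> t \<in> {a2..b2} \<Longrightarrow> \<bar>D p q s t\<bar> \<le> 1"
    and top: "\<And>p q s t s' t'. p + q = \<gamma> \<Longrightarrow> s \<in> {a1..b1} \<Longrightarrow> t \<in> {a2..b2} \<Longrightarrow> s' \<in> {a1..b1} \<Longrightarrow> t' \<in> {a2..b2} \<Longrightarrow>
        \<bar>D p q s t - D p q s' t'\<bar> \<le> max \<bar>s - s'\<bar> \<bar>t - t'\<bar>"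
  shows "p + q < \<gamma> \<Longrightarrow> s \<in> {a1..b1} \<Longrightarrow> t \<in> {a2..b2} \<Longrightarrow> ((\<lambda>t. D p q s t) has_real_derivative D p (Suc q) s t) (at t within {a2..b2})"
    and "p + q \<le> \<gamma> \<Longrightarrow> s \<in> {a1..b1} \<Longrightarrow> t \<in> {a2..b2} \<Longrightarrow> s' \<in> {a1..b1} \<Longrightarrow> t' \<in> {a2..b2} \<Longrightarrow>
        \<bar>D p q s t - D p q s' t'\<bar> \<le> \<bar>s - s'\<bar> + \<bar>t - t'\<bar>"
proof -
  \<comment> \<open>Differentiability in the second variable is a premise here because the bound is
    already needed inside the induction that proves it.\<close>
  have lipA: "\<bar>D p q s t - D p q s' t'\<bar> \<le> \<bar>s - s'\<bar> + \<bar>t - t'\<bar>"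
    if pq: "p + q \<le> \<gamma>"
      and A: "p + q < \<gamma> \<Longrightarrow> (\<And>s t. s \<in> {a1..b1} \<Longrightarrow> t \<in> {a2..b2} \<Longrightarrow> ((\<lambda>t. D p q s t) has_real_derivative D p (Suc q) s t) (at t within {a2..b2}))"
      and box: "s \<in> {a1..b1}" "t \<in> {a2..b2}" "s' \<in> {a1..b1}" "t' \<in> {a2..b2}" for p q s t s' t'
  proof (cases "p + q = \<gamma>")
    case True
    show ?thesis using top[OF True box] by linarith
  next
    case False
    then have lt: "p + q < \<gamma>" using pq by simp
    have "\<bar>D p q s t - D p q s' t\<bar> \<le> 1 * \<bar>s - s'\<bar>"
      by (rule DERIV_bound_imp_Lipschitz[where f = "\<lambda>s. D p q s t" and f' = "\<lambda>s. D (Suc p) q s t", OF ds[OF lt _ box(2)] bd])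
         (use lt box in auto)
    moreover have "\<bar>D p q s' t - D p q s' t'\<bar> \<le> 1 * \<bar>t - t'\<bar>"
      by (rule DERIV_bound_imp_Lipschitz[where f = "\<lambda>t. D p q s' t" and f' = "\<lambda>t. D p (Suc q) s' t", OF A[OF lt box(3)] bd])
         (use lt box in auto)
    ultimately show ?thesis
      using abs_triangle_ineq[of "D p q s t - D p q s' t" "D p q s' t - D p q s' t'"] by simp
  qed
  have main: "((\<lambda>t. D p q s t) has_real_derivative D p (Suc q) s t) (at t within {a2..b2})"
    if "p + q < \<gamma>" "s \<in> {a1..b1}" "t \<in> {a2..b2}" for p q s t
    using that
  proof (induction p arbitrary: q s t)
    case 0
    then show ?case using dt by simp
  next
    case (Suc p)
    note IHp = Suc.IH
    have "Suc p + q < \<gamma> \<Longrightarrow> s \<in> {a1..b1} \<Longrightarrow> t \<in> {a2..b2} \<Longrightarrow>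
       ((\<lambda>t. D (Suc p) q s t) has_real_derivative D (Suc p) (Suc q) s t) (at t within {a2..b2})" for q s t
    \<comment> \<open>Downward in \<open>q\<close>: the interchange at (p, q) needs the Lipschitz
      bound for (p+1, q+1), which below the top order rests on the case
      \<open>Suc q\<close>.\<close>
    proof (induction "\<gamma> - q" arbitrary: q s t rule: less_induct)
      case less
      have lip: "\<bar>D (Suc p) (Suc q) s t - D (Suc p) (Suc q) s' t'\<bar> \<le> \<bar>s - s'\<bar> + \<bar>t - t'\<bar>"
        if "s \<in> {a1..b1}" "t \<in> {a2..b2}" "s' \<in> {a1..b1}" "t' \<in> {a2..b2}" for s t s' t'
      proof (rule lipA[OF _ _ that])
        show "Suc p + Suc q \<le> \<gamma>" using less.prems(1) by simp
        show "((\<lambda>t. D (Suc p) (Suc q) s t) has_real_derivative D (Suc p) (Suc (Suc q)) s t) (at t within {a2..b2})"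
          if "Suc p + Suc q < \<gamma>" "s \<in> {a1..b1}" "t \<in> {a2..b2}" for s t
          using less.hyps[of "Suc q" s t] that by auto
      qed
      show ?case
      proof (rule mixed_partial_interchange[where g = "D p q" and B = "D p (Suc q)" and C = "D (Suc p) (Suc q)", OF ab])
        show "((\<lambda>s. D p q s t) has_real_derivative D (Suc p) q s t) (at s within {a1..b1})"
          if "s \<in> {a1..b1}" "t \<in> {a2..b2}" for s t using ds[of p q s t] less.prems that by auto
        show "((\<lambda>t. D p q s t) has_real_derivative D p (Suc q) s t) (at t within {a2..b2})"
          if "s \<in> {a1..b1}" "t \<in> {a2..b2}" for s t using IHp[of q s t] less.prems that by auto
        show "((\<lambda>s. D p (Suc q) s t) has_real_derivative D (Suc p) (Suc q) s t) (at s within {a1..b1})"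
          if "s \<in> {a1..b1}" "t \<in> {a2..b2}" for s t using ds[of p "Suc q" s t] less.prems that by auto
      qed (use lip less.prems in auto)
    qed
    then show ?case using Suc.prems by blast
  qed
  show "p + q < \<gamma> \<Longrightarrow> s \<in> {a1..b1} \<Longrightarrow> t \<in> {a2..b2} \<Longrightarrow> ((\<lambda>t. D p q s t) has_real_derivative D p (Suc q) s t) (at t within {a2..b2})"
    by (rule main)
  show "p + q \<le> \<gamma> \<Longrightarrow> s \<in> {a1..b1} \<Longrightarrow> t \<in> {a2..b2} \<Longrightarrow> s' \<in> {a1..b1} \<Longrightarrow> t' \<in> {a2..b2} \<Longrightarrow>
        \<bar>D p q s t - D p q s' t'\<bar> \<le> \<bar>s - s'\<bar> + \<bar>t - t'\<bar>"
    by (rule lipA[OF _ main])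
qed

text \<open>Common part of both equations; \<open>r\<close> is the coefficient sum produced by
  differentiating one generator. The derivative of order k of \<open>y\<close> is that of order k -
  1 of \<open>u\<close>, hence the shift in the radii.\<close>

lemma comb_solution_in_closure:
  fixes y :: "real \<Rightarrow> real" and r :: real
  assumes \<alpha>: "0 < \<alpha>" "\<alpha> \<le> 1" and r: "r \<ge> 0"
    and G: "\<And>l. G l \<subseteq> G (Suc l)" and u: "u \<in> G 0"
    and y: "\<And>t. t \<in> {0..\<alpha>} \<Longrightarrow> (y has_real_derivative u t) (at t within {0..\<alpha>})"
    and bd: "\<And>l u t. l \<le> \<beta> \<Longrightarrow> u \<in> G l \<Longrightarrow> t \<in> {0..\<alpha>} \<Longrightarrow> \<bar>u t\<bar> \<le> 1"
    and lip: "\<And>u s t. u \<in> G \<beta> \<Longrightarrow> s \<in> {0..\<alpha>} \<Longrightarrow> t \<in> {0..\<alpha>} \<Longrightarrow> \<bar>u s - u t\<bar> \<le> r * \<bar>s - t\<bar>"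
    and D: "\<And>l u. l < \<beta> \<Longrightarrow> u \<in> G l \<Longrightarrow> \<exists>u'. comb G (Suc l) 2 r u' \<and> (\<forall>t\<in>{0..\<alpha>}. (u has_real_derivative u' t) (at t within {0..\<alpha>}))"
    and \<eta>: "\<eta> > 0"
  shows "\<exists>h\<in>sob_class \<alpha> (\<beta> + 2) (\<lambda>k. r ^ (k - 1) * fact (k - 1)). \<forall>t\<in>{0..\<alpha>}. \<bar>h t - y t\<bar> \<le> \<eta>"
proof -
  obtain U where U: "U 0 = u" "\<forall>j\<le>\<beta>. comb G j (Suc j) (r ^ j * fact j) (U j)"
     "\<forall>j<\<beta>. \<forall>t\<in>{0..\<alpha>}. (U j has_real_derivative U (Suc j) t) (at t within {0..\<alpha>})"
    using comb_iterated_derivs[of r G u \<beta> "{0..\<alpha>}" \<beta>] r G u D by auto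
  define Y where "Y k = (case k of 0 \<Rightarrow> y | Suc j \<Rightarrow> U j)" for k
  have Ub: "\<bar>U j t\<bar> \<le> r ^ j * fact j" if "j \<le> \<beta>" "t \<in> {0..\<alpha>}" for j t
    using comb_bound[of G j "Suc j" "r ^ j * fact j" "U j" "{0..\<alpha>}" t] U(2) bd that by auto
  have der: "(Y k has_real_derivative Y (Suc k) t) (at t within {0..\<alpha>})" if "k \<le> \<beta>" "t \<in> {0..\<alpha>}" for k t
    using that y U by (cases k) (auto simp: Y_def)
  have "\<exists>h\<in>sob_class \<alpha> (\<beta> + 2) (\<lambda>k. r ^ (k - 1) * fact (k - 1)). \<forall>t\<in>{0..\<alpha>}. \<bar>h t - Y 0 t\<bar> \<le> \<eta>"
  proof (rule smooth_in_closure_sob_class[where Y = Y and c = "\<lambda>k. r ^ (k - 1) * fact (k - 1)", OF \<alpha> der _ _ _ \<eta>])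
    fix k s t assume k: "k \<le> Suc \<beta>" and st: "s \<in> {0..\<alpha>}" "t \<in> {0..\<alpha>}"
    show "\<bar>Y k s - Y k t\<bar> \<le> r ^ (Suc k - 1) * fact (Suc k - 1) * \<bar>s - t\<bar>"
    proof (cases "k = Suc \<beta>")
      case True
      have "\<bar>U \<beta> s - U \<beta> t\<bar> \<le> r * real (Suc \<beta>) * (r ^ \<beta> * fact \<beta>) * \<bar>s - t\<bar>"
        using U(2) bd lip st r by (intro comb_Lipschitz[of G \<beta> _ _ _ _ "{0..\<alpha>}"]) auto
      also have "r * real (Suc \<beta>) * (r ^ \<beta> * fact \<beta>) = r ^ Suc \<beta> * fact (Suc \<beta>)" by simp
      finally show ?thesis using True by (simp add: Y_def)
    next
      case False
      then have kb: "k \<le> \<beta>" using k by simp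
      show ?thesis
      proof (rule DERIV_bound_imp_Lipschitz[OF der[OF kb] _ st])
        show "\<bar>Y (Suc k) z\<bar> \<le> r ^ (Suc k - 1) * fact (Suc k - 1)" if "z \<in> {0..\<alpha>}" for z
          using Ub[OF kb that] by (simp add: Y_def)
      qed
    qed
  qed (use r in auto)
  then show ?thesis by (simp add: Y_def)
qed

text \<open>The chain rule along the solution yields the single product
  \<open>D (Suc q) (y t) * D 0 (y t)\<close>, so r = 1.\<close>

lemma aut_solution_in_closure:
  assumes "C0 > 0" "b > 0" "\<bar>y0\<bar> \<le> C0" and f: "S1 \<beta> 1 {-(C0 + b)..C0 + b} f" and y: "ode_sol_aut (min 1 b) y0 f y"
    and \<eta>: "\<eta> > 0"
  shows "\<exists>h\<in>sob_class (min 1 b) (\<beta> + 2) (\<lambda>k. 1 ^ (k - 1) * fact (k - 1)). \<forall>t\<in>{0..min 1 b}. \<bar>h t - y t\<bar> \<le> \<eta>"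
proof -
  define \<alpha> where "\<alpha> = min 1 b"
  define B where "B = {-(C0 + b)..C0 + b}"
  obtain D where D: "\<forall>t\<in>B. D 0 t = f t"
      "\<forall>k<\<beta>. \<forall>t\<in>B. (D k has_real_derivative D (Suc k) t) (at t within B)"
      "\<forall>k\<le>\<beta>. \<forall>t\<in>B. \<bar>D k t\<bar> \<le> 1" "\<forall>t\<in>B. \<forall>t'\<in>B. \<bar>D \<beta> t - D \<beta> t'\<bar> \<le> 1 * \<bar>t - t'\<bar>"
    using f unfolding S1_def B_def[symmetric] by (elim conjE exE)
  note D0 = D(1)[rule_format] and dD = D(2)[rule_format] and bD = D(3)[rule_format] and lD = D(4)[rule_format]
  have yd: "(y has_real_derivative f (y t)) (at t within {0..\<alpha>})" if "t \<in> {0..\<alpha>}" for t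
    using y that by (simp add: ode_sol_aut_def \<alpha>_def)
  have yB: "y t \<in> B" if t: "t \<in> {0..\<alpha>}" for t
  proof -
    have "\<bar>y t\<bar> \<le> C0 + b"
    proof (rule solution_stays_in_box[OF _ _ \<open>b > 0\<close> yd _ t])
      show "\<bar>y 0\<bar> \<le> C0" using y assms by (simp add: ode_sol_aut_def)
      show "\<bar>f (y z)\<bar> \<le> 1" if "\<bar>y z\<bar> \<le> C0 + b" for z
      proof -
        have "y z \<in> B" using that by (auto simp: B_def)
        then show ?thesis using bD[of 0 "y z"] D0 by simp
      qed
    qed (simp add: \<alpha>_def)
    then show ?thesis by (auto simp: B_def)
  qed
  have yd': "(y has_real_derivative D 0 (y t)) (at t within {0..\<alpha>})" if "t \<in> {0..\<alpha>}" for t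
    using yd[OF that] D0[OF yB[OF that]] by simp
  have ylip: "\<bar>y s - y t\<bar> \<le> 1 * \<bar>s - t\<bar>" if "s \<in> {0..\<alpha>}" "t \<in> {0..\<alpha>}" for s t
    by (rule DERIV_bound_imp_Lipschitz[OF yd' _ that]) (use bD yB in auto)
  define G where "G l = {\<lambda>t. D q (y t) | q. q \<le> l}" for l :: nat
  have "\<exists>h\<in>sob_class \<alpha> (\<beta> + 2) (\<lambda>k. 1 ^ (k - 1) * fact (k - 1)). \<forall>t\<in>{0..\<alpha>}. \<bar>h t - y t\<bar> \<le> \<eta>"
  proof (rule comb_solution_in_closure[where G = G and u = "\<lambda>t. D 0 (y t)", OF _ _ _ _ _ yd' _ _ _ \<eta>])
    show "0 < \<alpha>" "\<alpha> \<le> 1" using assms by (auto simp: \<alpha>_def)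
    show "G l \<subseteq> G (Suc l)" for l by (force simp: G_def)
    show "(\<lambda>t. D 0 (y t)) \<in> G 0" by (auto simp: G_def)
    show "\<bar>u t\<bar> \<le> 1" if "l \<le> \<beta>" "u \<in> G l" "t \<in> {0..\<alpha>}" for l u t
      using that bD yB by (auto simp: G_def)
    have chain: "((\<lambda>t. D q (y t)) has_real_derivative D (Suc q) (y t) * D 0 (y t)) (at t within {0..\<alpha>})"
      if q: "q < \<beta>" and t: "t \<in> {0..\<alpha>}" for q t
    proof -
      have "(D q \<circ> y has_real_derivative D (Suc q) (y t) * D 0 (y t)) (at t within {0..\<alpha>})"
        by (rule DERIV_image_chain[OF DERIV_subset[OF dD[OF q yB[OF t]]] yd'[OF t]]) (use yB in auto)
      then show ?thesis by (simp add: o_def)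
    qed
    show "\<exists>u'. comb G (Suc l) 2 1 u' \<and> (\<forall>t\<in>{0..\<alpha>}. (u has_real_derivative u' t) (at t within {0..\<alpha>}))"
      if l: "l < \<beta>" and u: "u \<in> G l" for l u
    proof -
      obtain q where q: "u = (\<lambda>t. D q (y t))" "q \<le> l" using u by (auto simp: G_def)
      have "comb G (Suc l) (1 + 1) (1 * 1) (\<lambda>t. D (Suc q) (y t) * D 0 (y t))"
        by (intro comb.mult comb.base) (use q in \<open>auto simp: G_def\<close>)
      then have "comb G (Suc l) 2 1 (\<lambda>t. D (Suc q) (y t) * D 0 (y t))" by (simp add: numeral_2_eq_2)
      then show ?thesis using chain[of q] q l by (intro exI[of _ "\<lambda>t. D (Suc q) (y t) * D 0 (y t)"]) auto
    qed
    show "\<bar>u s - u t\<bar> \<le> 1 * \<bar>s - t\<bar>" if u: "u \<in> G \<beta>" and st: "s \<in> {0..\<alpha>}" "t \<in> {0..\<alpha>}" for u s t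
    proof -
      obtain q where q: "u = (\<lambda>t. D q (y t))" "q \<le> \<beta>" using u by (auto simp: G_def)
      show ?thesis
      \<comment> \<open>At the top order the Lipschitz bound of \<open>S1\<close> is composed with
        the 1-Lipschitz \<open>y\<close>; lower orders are differentiable with derivative at most
        1.\<close>
      proof (cases "q = \<beta>")
        case True
        then show ?thesis using lD[OF yB[OF st(1)] yB[OF st(2)]] ylip[OF st] q by simp
      next
        case False
        then have "q < \<beta>" using q by simp
        have "\<bar>D (Suc q) (y z) * D 0 (y z)\<bar> \<le> 1" if "z \<in> {0..\<alpha>}" for z
          unfolding abs_mult using bD[of "Suc q" "y z"] bD[of 0 "y z"] yB[OF that] \<open>q < \<beta>\<close> by (intro mult_le_one) auto
        then show ?thesis unfolding q(1)
          by (intro DERIV_bound_imp_Lipschitz[OF chain[OF \<open>q < \<beta>\<close>] _ st])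
      qed
    qed
  qed simp
  then show ?thesis by (simp add: \<alpha>_def)
qed

text \<open>Differentiation along the solution yields a time derivative plus a product with the
  right-hand side: two terms, so r = 2.\<close>

lemma nonaut_solution_in_closure:
  assumes "C0 > 0" "b > 0" "\<bar>y0\<bar> \<le> C0" and f: "S2 \<beta> 1 0 1 (-(C0 + b)) (C0 + b) f" and y: "ode_sol_nonaut (min 1 b) y0 f y"
    and \<eta>: "\<eta> > 0"
  shows "\<exists>h\<in>sob_class (min 1 b) (\<beta> + 2) (\<lambda>k. 2 ^ (k - 1) * fact (k - 1)). \<forall>t\<in>{0..min 1 b}. \<bar>h t - y t\<bar> \<le> \<eta>"
proof -
  define \<alpha> where "\<alpha> = min 1 b"
  define c where "c = C0 + b"
  obtain D where D: "\<forall>s\<in>{0..1}. \<forall>t\<in>{-c..c}. D 0 0 s t = f s t"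
      "\<forall>q<\<beta>. \<forall>s\<in>{0..1}. \<forall>t\<in>{-c..c}.
        ((\<lambda>t'. D 0 q s t') has_real_derivative D 0 (Suc q) s t) (at t within {-c..c})"
      "\<forall>p q. p + q < \<beta> \<longrightarrow> (\<forall>s\<in>{0..1}. \<forall>t\<in>{-c..c}.
        ((\<lambda>s'. D p q s' t) has_real_derivative D (Suc p) q s t) (at s within {0..1}))"
      "\<forall>p q. p + q \<le> \<beta> \<longrightarrow> (\<forall>s\<in>{0..1}. \<forall>t\<in>{-c..c}. \<bar>D p q s t\<bar> \<le> 1)"
      "\<forall>p q. p + q = \<beta> \<longrightarrow> (\<forall>s\<in>{0..1}. \<forall>t\<in>{-c..c}. \<forall>s'\<in>{0..1}. \<forall>t'\<in>{-c..c}.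
        \<bar>D p q s t - D p q s' t'\<bar> \<le> 1 * max \<bar>s - s'\<bar> \<bar>t - t'\<bar>)"
    using f unfolding S2_def c_def[symmetric] by (elim conjE exE)
  note D0 = D(1)[rule_format] and dt = D(2)[rule_format] and ds = D(3)[rule_format]
    and bd = D(4)[rule_format] and top = D(5)[rule_format]
  have mix1: "((\<lambda>t. D p q s t) has_real_derivative D p (Suc q) s t) (at t within {-c..c})"
    if "p + q < \<beta>" "s \<in> {0..1}" "t \<in> {-c..c}" for p q s t
    by (rule S2_mixed_partials(1)[where D = D and \<gamma> = \<beta>], rule zero_less_one, rule dt, assumption+,
        rule ds, assumption+, rule bd, assumption+, rule top[unfolded mult_1], assumption+) (rule that)+
  have mix2: "\<bar>D p q s t - D p q s' t'\<bar> \<le> \<bar>s - s'\<bar> + \<bar>t - t'\<bar>"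
    if "p + q \<le> \<beta>" "s \<in> {0..1}" "t \<in> {-c..c}" "s' \<in> {0..1}" "t' \<in> {-c..c}" for p q s t s' t'
    by (rule S2_mixed_partials(2)[where D = D and \<gamma> = \<beta>], rule zero_less_one, rule dt, assumption+,
        rule ds, assumption+, rule bd, assumption+, rule top[unfolded mult_1], assumption+) (rule that)+
  have sub: "{0..\<alpha>} \<subseteq> {0..1}" by (auto simp: \<alpha>_def)
  have yd: "(y has_real_derivative f t (y t)) (at t within {0..\<alpha>})" if "t \<in> {0..\<alpha>}" for t
    using y that by (simp add: ode_sol_nonaut_def \<alpha>_def)
  have yB: "y t \<in> {-c..c}" if t: "t \<in> {0..\<alpha>}" for t
  proof -
    have "\<bar>y t\<bar> \<le> C0 + b"
    proof (rule solution_stays_in_box[OF _ _ \<open>b > 0\<close> yd _ t])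
      show "\<bar>y 0\<bar> \<le> C0" using y assms by (simp add: ode_sol_nonaut_def)
      show "\<bar>f z (y z)\<bar> \<le> 1" if z: "z \<in> {0..\<alpha>}" "\<bar>y z\<bar> \<le> C0 + b" for z
      proof -
        have "y z \<in> {-c..c}" "z \<in> {0..1}" using z sub by (auto simp: c_def)
        then show ?thesis using bd[of 0 0 z "y z"] D0 by simp
      qed
    qed (simp add: \<alpha>_def)
    then show ?thesis by (auto simp: c_def)
  qed
  have in1: "t \<in> {0..1}" if "t \<in> {0..\<alpha>}" for t using that sub by blast
  have yd': "(y has_real_derivative D 0 0 t (y t)) (at t within {0..\<alpha>})" if "t \<in> {0..\<alpha>}" for t
    using yd[OF that] D0[OF in1[OF that] yB[OF that]] by simp
  have ylip: "\<bar>y s - y t\<bar> \<le> \<bar>s - t\<bar>" if "s \<in> {0..\<alpha>}" "t \<in> {0..\<alpha>}" for s t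
  proof -
    have "\<bar>y s - y t\<bar> \<le> 1 * \<bar>s - t\<bar>"
      by (rule DERIV_bound_imp_Lipschitz[OF yd' _ that]) (use bd yB in1 in auto)
    then show ?thesis by simp
  qed
  define G where "G l = {\<lambda>t. D p q t (y t) | p q. p + q \<le> l}" for l :: nat
  have chain: "((\<lambda>t. D p q t (y t)) has_real_derivative D (Suc p) q t (y t) + D p (Suc q) t (y t) * D 0 0 t (y t)) (at t within {0..\<alpha>})"
    if pq: "p + q < \<beta>" and t: "t \<in> {0..\<alpha>}" for p q t
    by (rule DERIV_along_curve[OF ds[OF pq] mix1[OF pq] mix2 mix2 sub yB ylip t yd'[OF t]]) (use pq in auto)
  have "\<exists>h\<in>sob_class \<alpha> (\<beta> + 2) (\<lambda>k. 2 ^ (k - 1) * fact (k - 1)). \<forall>t\<in>{0..\<alpha>}. \<bar>h t - y t\<bar> \<le> \<eta>"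
  proof (rule comb_solution_in_closure[where G = G and u = "\<lambda>t. D 0 0 t (y t)", OF _ _ _ _ _ yd' _ _ _ \<eta>])
    show "0 < \<alpha>" "\<alpha> \<le> 1" using assms by (auto simp: \<alpha>_def)
    show "G l \<subseteq> G (Suc l)" for l by (force simp: G_def)
    show "(\<lambda>t. D 0 0 t (y t)) \<in> G 0" by (auto simp: G_def)
    show "\<bar>u t\<bar> \<le> 1" if "l \<le> \<beta>" "u \<in> G l" "t \<in> {0..\<alpha>}" for l u t
      using that bd yB in1 by (auto simp: G_def)
    show "\<exists>u'. comb G (Suc l) 2 2 u' \<and> (\<forall>t\<in>{0..\<alpha>}. (u has_real_derivative u' t) (at t within {0..\<alpha>}))"
      if l: "l < \<beta>" and u: "u \<in> G l" for l u
    proof -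
      obtain p q where pq: "u = (\<lambda>t. D p q t (y t))" "p + q \<le> l" using u by (auto simp: G_def)
      have in_G: "(\<lambda>t. D (Suc p) q t (y t)) \<in> G (Suc l)" "(\<lambda>t. D p (Suc q) t (y t)) \<in> G (Suc l)" "(\<lambda>t. D 0 0 t (y t)) \<in> G (Suc l)"
        using pq(2) unfolding G_def by (fastforce+)
      \<comment> \<open>\<open>comb.add\<close> wants equal length bounds, so the single factor is
        regarded as a product of at most two.\<close>
      have "comb G (Suc l) 2 1 (\<lambda>t. D (Suc p) q t (y t))"
        by (rule comb.weaken[OF comb.base[where G = G and l = "Suc l", OF in_G(1)]]) auto
      moreover have "comb G (Suc l) 2 1 (\<lambda>t. D p (Suc q) t (y t) * D 0 0 t (y t))"
        using comb.mult[OF comb.base[where G = G and l = "Suc l", OF in_G(2)] comb.base[where G = G and l = "Suc l", OF in_G(3)]] by (simp add: numeral_2_eq_2)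
      ultimately have "comb G (Suc l) 2 (1 + 1) (\<lambda>t. D (Suc p) q t (y t) + D p (Suc q) t (y t) * D 0 0 t (y t))"
        by (rule comb.add)
      then have "comb G (Suc l) 2 2 (\<lambda>t. D (Suc p) q t (y t) + D p (Suc q) t (y t) * D 0 0 t (y t))" by simp
      then show ?thesis using chain[of p q] pq l
        by (intro exI[of _ "\<lambda>t. D (Suc p) q t (y t) + D p (Suc q) t (y t) * D 0 0 t (y t)"]) auto
    qed
    show "\<bar>u s - u t\<bar> \<le> 2 * \<bar>s - t\<bar>" if u: "u \<in> G \<beta>" and st: "s \<in> {0..\<alpha>}" "t \<in> {0..\<alpha>}" for u s t
    proof -
      obtain p q where pq: "u = (\<lambda>t. D p q t (y t))" "p + q \<le> \<beta>" using u by (auto simp: G_def)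
      show ?thesis using mix2[OF pq(2) in1[OF st(1)] yB[OF st(1)] in1[OF st(2)] yB[OF st(2)]] ylip[OF st] pq(1)
        by simp
    qed
  qed simp
  then show ?thesis by (simp add: \<alpha>_def)
qed

section \<open>The rate\<close>

text \<open>From m to m + 1 the left side grows by (m+1)(1 + 1/m)^m, at most 2m * 3, and the right
  side by 8m.\<close>

lemma power_self_le_fact: "m \<ge> 1 \<Longrightarrow> real m ^ m \<le> 8 ^ m * fact (m - 1)"
proof (induction m rule: nat_induct_at_least)
  case base
  then show ?case by simp
next
  case (Suc m)
  then have m: "real m \<ge> 1" by simp
  have "(1 + 1 / real m) ^ m \<le> exp 1" using exp_ge_one_plus_x_over_n_power_n[where x = 1 and n = m] Suc.hyps by simp
  also have "\<dots> \<le> 3" by (rule exp_le)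
  finally have e: "(1 + 1 / real m) ^ m \<le> 3" .
  have "real (Suc m) = real m * (1 + 1 / real m)" using m by (simp add: field_simps)
  then have "real (Suc m) ^ m = real m ^ m * (1 + 1 / real m) ^ m" by (metis power_mult_distrib)
  also have "\<dots> \<le> (8 ^ m * fact (m - 1)) * 3" using Suc.IH e by (intro mult_mono) auto
  finally have "real (Suc m) * real (Suc m) ^ m \<le> (2 * real m) * ((8 ^ m * fact (m - 1)) * 3)"
    using m by (intro mult_mono) auto
  also have "\<dots> = 6 * 8 ^ m * (real m * fact (m - 1))" by simp
  also have "real m * fact (m - 1) = fact m" using Suc.hyps by (simp add: fact_reduce)
  also have "6 * 8 ^ m * fact m \<le> 8 * 8 ^ m * (fact m :: real)" by simp
  finally show ?case by simp
qed

text \<open>The solution itself need not belong to \<open>E\<close>, so the minimizer is compared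
  with members of \<open>E\<close> within \<open>\<eta>\<close> of it on the design, and
  \<open>\<eta>\<close> tends to 0.\<close>

lemma least_squares_basic_inequality:
  fixes x :: "nat \<Rightarrow> real"
  assumes n: "n \<ge> 1" and ls: "is_ls_estimator n x E yhat"
    and cl: "\<And>\<eta>. \<eta> > 0 \<Longrightarrow> \<exists>h\<in>E. \<forall>i<n. \<bar>h (x i) - y (x i)\<bar> \<le> \<eta>"
  shows "(\<Sum>i<n. (yhat (\<lambda>j. y (x j) + \<epsilon> j) (x i) - y (x i))\<^sup>2)
         \<le> 2 * (\<Sum>i<n. \<epsilon> i * (yhat (\<lambda>j. y (x j) + \<epsilon> j) (x i) - y (x i)))"
proof -
  define \<Delta> where "\<Delta> i = yhat (\<lambda>j. y (x j) + \<epsilon> j) (x i) - y (x i)" for i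
  have le: "(\<Sum>i<n. (\<epsilon> i - \<Delta> i)\<^sup>2) \<le> (\<Sum>i<n. (\<bar>\<epsilon> i\<bar> + \<eta>)\<^sup>2)" if \<eta>: "\<eta> > 0" for \<eta>
  proof -
    obtain h where h: "h \<in> E" "\<And>i. i < n \<Longrightarrow> \<bar>h (x i) - y (x i)\<bar> \<le> \<eta>" using cl[OF \<eta>] by blast
    have "ls_obj n x (\<lambda>j. y (x j) + \<epsilon> j) (yhat (\<lambda>j. y (x j) + \<epsilon> j)) \<le> ls_obj n x (\<lambda>j. y (x j) + \<epsilon> j) h"
      using ls h(1) unfolding is_ls_estimator_def by blast
    then have "(\<Sum>i<n. (y (x i) + \<epsilon> i - yhat (\<lambda>j. y (x j) + \<epsilon> j) (x i))\<^sup>2) \<le> (\<Sum>i<n. (y (x i) + \<epsilon> i - h (x i))\<^sup>2)"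
      unfolding ls_obj_def using n by (simp add: mult_le_cancel_left_pos divide_le_cancel)
    also have "\<dots> \<le> (\<Sum>i<n. (\<bar>\<epsilon> i\<bar> + \<eta>)\<^sup>2)"
    proof (intro sum_mono)
      fix i assume "i \<in> {..<n}"
      then have "\<bar>y (x i) + \<epsilon> i - h (x i)\<bar> \<le> \<bar>\<epsilon> i\<bar> + \<eta>" using h(2)[of i] by auto
      then have "\<bar>y (x i) + \<epsilon> i - h (x i)\<bar>\<^sup>2 \<le> (\<bar>\<epsilon> i\<bar> + \<eta>)\<^sup>2" by (rule power_mono) simp
      then show "(y (x i) + \<epsilon> i - h (x i))\<^sup>2 \<le> (\<bar>\<epsilon> i\<bar> + \<eta>)\<^sup>2" by simp
    qed
    finally show ?thesis by (simp add: \<Delta>_def algebra_simps)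
  qed
  have "((\<lambda>\<eta>. \<Sum>i<n. (\<bar>\<epsilon> i\<bar> + \<eta>)\<^sup>2) \<longlongrightarrow> (\<Sum>i<n. (\<bar>\<epsilon> i\<bar> + 0)\<^sup>2)) (at_right 0)"
    by (intro tendsto_intros)
  moreover have "\<forall>\<^sub>F \<eta> in at_right 0. (\<Sum>i<n. (\<epsilon> i - \<Delta> i)\<^sup>2) \<le> (\<Sum>i<n. (\<bar>\<epsilon> i\<bar> + \<eta>)\<^sup>2)"
    using le by (auto simp: eventually_at_filter)
  ultimately have "(\<Sum>i<n. (\<epsilon> i - \<Delta> i)\<^sup>2) \<le> (\<Sum>i<n. (\<bar>\<epsilon> i\<bar> + 0)\<^sup>2)"
    by (rule tendsto_lowerbound) simp
  then have "(\<Sum>i<n. (\<epsilon> i)\<^sup>2 - 2 * (\<epsilon> i * \<Delta> i) + (\<Delta> i)\<^sup>2) \<le> (\<Sum>i<n. (\<epsilon> i)\<^sup>2)"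
    by (simp add: power2_diff algebra_simps)
  then have "(\<Sum>i<n. (\<Delta> i)\<^sup>2) \<le> 2 * (\<Sum>i<n. \<epsilon> i * \<Delta> i)"
    by (simp add: sum.distrib sum_subtractf sum_distrib_left)
  then show ?thesis by (simp add: \<Delta>_def)
qed

text \<open>For smoothness \<open>\<gamma> \<ge> n\<close>, where the first entry of the maximum in
  \<open>rbar2\<close> equals \<open>\<sigma>\<^sup>2\<close>. The weight 2 leaves half of the
  squared error to absorb.\<close>

lemma ls_risk_trivial_bound:
  assumes \<sigma>: "\<sigma> > 0" and n: "n \<ge> 1"
    and basic: "\<And>\<epsilon>. (\<Sum>i<n. (yhat (\<lambda>j. y (x j) + \<epsilon> j) (x i) - y (x i))\<^sup>2)
         \<le> 2 * (\<Sum>i<n. \<epsilon> i * (yhat (\<lambda>j. y (x j) + \<epsilon> j) (x i) - y (x i)))"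
  shows "ls_risk n \<sigma> x y yhat \<le> ennreal (4 * \<sigma>\<^sup>2)"
proof -
  let ?M = "PiM {..<n} (\<lambda>_. gauss \<sigma>)"
  have pt: "(\<Sum>i<n. (yhat (\<lambda>j. y (x j) + \<epsilon> j) (x i) - y (x i))\<^sup>2) \<le> 4 * (\<Sum>i<n. (\<epsilon> i)\<^sup>2)" for \<epsilon>
  proof -
    define d where "d i = yhat (\<lambda>j. y (x j) + \<epsilon> j) (x i) - y (x i)" for i
    have "2 * (\<Sum>i<n. \<epsilon> i * d i) \<le> 2 * (\<Sum>i<n. (\<epsilon> i)\<^sup>2) + (\<Sum>i<n. (d i)\<^sup>2) / 2"
      by (rule amgm_from_square[OF Cauchy_Schwarz_ineq_sum]) (auto intro: sum_nonneg)
    then show ?thesis using basic[of \<epsilon>] unfolding d_def[symmetric] by simp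
  qed
  have "ls_risk n \<sigma> x y yhat \<le> (\<integral>\<^sup>+ \<epsilon>. ennreal (4 / n * (\<Sum>i<n. (\<epsilon> i)\<^sup>2)) \<partial>?M)"
    unfolding ls_risk_def using n pt
    by (intro nn_integral_mono ennreal_leI) (simp add: divide_right_mono)
  also have "\<dots> \<le> ennreal (4 / n * (\<sigma>\<^sup>2 * n))"
    using mean_le_cmult[OF mean_le_noise_energy[OF \<sigma>, of n], of "4 / n"] by (simp add: mean_le_def)
  finally show ?thesis using n by simp
qed

text \<open>The resolution \<open>J \<approx> 8 \<rho> / (s m)\<close> balances the two terms of the risk bound: the defining identity
  \<open>\<rho>\<^bsup>2m+1\<^esup> = (2\<^bsup>m-1\<^esup> (m-1)!)\<^sup>2 s\<^bsup>2m\<^esup>\<close> and Stirling's lower bound for \<open>(m-1)!\<close> make the constants independent of \<open>m\<close>.\<close>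

lemma resolution_choice:
  fixes s :: real and \<gamma> :: nat
  assumes s: "s > 0"
  defines "m \<equiv> \<gamma> + 2"
  defines "\<rho> \<equiv> (2 ^ (\<gamma> + 1) * fact (\<gamma> + 1)) powr (2 / (2 * (real \<gamma> + 2) + 1)) *
        s powr (2 * (real \<gamma> + 2) / (2 * (real \<gamma> + 2) + 1))"
  obtains J :: nat where "J \<ge> 1" "s * real m * real J \<le> 8 * \<rho> + s * real m" "4 ^ m / real J ^ (2 * m) \<le> 4 * \<rho>"
proof -
  define L :: real where "L = 2 ^ (m - 1) * fact (m - 1)"
  have L0: "L > 0" by (simp add: L_def)
  have m2: "m \<ge> 2" by (simp add: m_def)
  have N: "2 * (real \<gamma> + 2) + 1 = real (2 * m + 1)" by (simp add: m_def)
  have \<rho>: "\<rho> = L powr (2 / real (2 * m + 1)) * s powr (real (2 * m) / real (2 * m + 1))"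
    unfolding \<rho>_def N L_def by (simp add: m_def algebra_simps)
  have \<rho>0: "\<rho> > 0" using L0 s by (simp add: \<rho>)
  have "t / K * K = t" if "K \<noteq> 0" for t K :: real using that by simp
  then have cancel: "t / real (2 * m + 1) * real (2 * m + 1) = t" for t by (metis Suc_eq_plus1 nat.distinct(1) of_nat_eq_0_iff)
  have "\<rho> ^ (2 * m + 1) = \<rho> powr real (2 * m + 1)" using \<rho>0 by (simp only: powr_realpow)
  also have "\<dots> = (L powr (2 / real (2 * m + 1))) powr real (2 * m + 1) * (s powr (real (2 * m) / real (2 * m + 1))) powr real (2 * m + 1)"
    unfolding \<rho> by (rule powr_mult)
  also have "(L powr (2 / real (2 * m + 1))) powr real (2 * m + 1) = L powr 2" by (simp only: powr_powr cancel)
  also have "(s powr (real (2 * m) / real (2 * m + 1))) powr real (2 * m + 1) = s powr real (2 * m)"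
    by (simp only: powr_powr cancel)
  also have "L powr 2 = L\<^sup>2" using L0 by (simp add: powr_numeral)
  also have "s powr real (2 * m) = s ^ (2 * m)" using s by (rule powr_realpow)
  finally have id: "\<rho> ^ (2 * m + 1) = L\<^sup>2 * s ^ (2 * m)" .
  \<comment> \<open>The 8 is the base in \<open>power_self_le_fact\<close>: 4^m / 64^m leaves
    16^(-m), which cancels the 16^m in the bound for \<open>(real m ^ m)\<^sup>2\<close>.\<close>
  define z where "z = 8 * \<rho> / (s * real m)"
  have z0: "z > 0" using \<rho>0 s m2 by (simp add: z_def)
  \<comment> \<open>Rounding up keeps the approximation bound and costs at most the extra term
    \<open>s * real m\<close>.\<close>
  define J where "J = nat \<lceil>z\<rceil>"
  have J: "J \<ge> 1" "real J \<le> z + 1" "z \<le> real J" using z0 unfolding J_def by linarith+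
  show thesis
  proof (rule that[OF J(1)])
    have "s * real m * real J \<le> s * real m * (z + 1)" using J(2) s by (intro mult_left_mono) auto
    also have "\<dots> = 8 * \<rho> + s * real m" using s m2 by (simp add: z_def distrib_left)
    finally show "s * real m * real J \<le> 8 * \<rho> + s * real m" .
    have "(real m ^ m)\<^sup>2 \<le> (8 ^ m * fact (m - 1))\<^sup>2" using m2 by (intro power_mono power_self_le_fact) auto
    also have "\<dots> = 4 * 16 ^ m * L\<^sup>2"
    proof -
      have "(2::real) * 2 ^ (m - 1) = 2 ^ m" using m2 by (simp flip: power_Suc)
      then have "2 * 4 ^ m * L = (2 ^ m * 4 ^ m) * fact (m - 1)"
        unfolding L_def by (metis mult.assoc mult.commute)
      also have "(2::real) ^ m * 4 ^ m = 8 ^ m" by (simp add: power_mult_distrib[symmetric])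
      finally have "2 * 4 ^ m * L = 8 ^ m * (fact (m - 1) :: real)" .
      then have "(8 ^ m * (fact (m - 1) :: real))\<^sup>2 = (2 * 4 ^ m * L)\<^sup>2" by simp
      also have "\<dots> = 4 * (4 ^ m * 4 ^ m) * L\<^sup>2" by (simp add: power2_eq_square)
      also have "(4::real) ^ m * 4 ^ m = 16 ^ m" by (simp add: power_mult_distrib[symmetric])
      finally show ?thesis .
    qed
    finally have mm: "(real m ^ m)\<^sup>2 \<le> 4 * 16 ^ m * L\<^sup>2" .
    have "4 ^ m / real J ^ (2 * m) \<le> 4 ^ m / z ^ (2 * m)"
      using J(3) z0 by (intro divide_left_mono power_mono mult_pos_pos zero_less_power) auto
    also have "\<dots> = (real m ^ m)\<^sup>2 * s ^ (2 * m) / (16 ^ m * \<rho> ^ (2 * m))"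
    proof -
      have "z ^ (2 * m) = 8 ^ (2 * m) * \<rho> ^ (2 * m) / (s ^ (2 * m) * real m ^ (2 * m))"
        by (simp only: z_def power_divide power_mult_distrib)
      also have "(8::real) ^ (2 * m) = 64 ^ m" by (simp add: power_mult)
      also have "real m ^ (2 * m) = (real m ^ m)\<^sup>2" by (simp only: mult.commute[of 2 m] power_mult)
      finally have "z ^ (2 * m) = 64 ^ m * \<rho> ^ (2 * m) / (s ^ (2 * m) * (real m ^ m)\<^sup>2)" .
      moreover have "(64::real) ^ m = 4 ^ m * 16 ^ m" by (simp add: power_mult_distrib[symmetric])
      ultimately show ?thesis by simp
    qed
    also have "\<dots> \<le> (4 * 16 ^ m * L\<^sup>2) * s ^ (2 * m) / (16 ^ m * \<rho> ^ (2 * m))"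
      using mm s \<rho>0 by (intro divide_right_mono mult_right_mono) auto
    also have "\<dots> = 4 * (L\<^sup>2 * s ^ (2 * m)) / \<rho> ^ (2 * m)" by simp
    also have "\<dots> = 4 * \<rho>" unfolding id[symmetric] using \<rho>0 by simp
    finally show "4 ^ m / real J ^ (2 * m) \<le> 4 * \<rho>" .
  qed
qed

theorem theorem3p4:
  fixes cstar :: real
  assumes "cstar > 0"
  shows "\<exists>c1>0. \<exists>c2>0. \<exists>c3>0.
    \<forall>(\<beta>::nat) (C0::real) (b::real) (\<sigma>::real) (n::nat) (x::nat \<Rightarrow> real) (y::real \<Rightarrow> real) (y0::real)
      (yhat::(nat \<Rightarrow> real) \<Rightarrow> real \<Rightarrow> real) (E::(real \<Rightarrow> real) set).
      C0 > 0 \<and> b > 0 \<and> \<sigma> > 0 \<and> n \<ge> 1 \<and> C0 + b \<le> cstar \<and>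
      (\<forall>i<n. x i \<in> {0..min 1 b}) \<and> \<bar>y0\<bar> \<le> C0 \<and>
      ((\<exists>f. S1 \<beta> 1 {-(C0 + b)..C0 + b} f \<and> ode_sol_aut (min 1 b) y0 f y \<and>
            E = AH_dagger (min 1 b) (\<beta> + 2)) \<or>
       (\<exists>f. S2 \<beta> 1 0 1 (-(C0 + b)) (C0 + b) f \<and> ode_sol_nonaut (min 1 b) y0 f y \<and>
            E = H_dagger (min 1 b) (\<beta> + 2))) \<and>
      is_ls_estimator n x E yhat \<and>
      max (min 1 b) C0 \<ge> c1 * sqrt (rbar2 \<beta> \<sigma> n)
      \<longrightarrow> ls_risk n \<sigma> x y yhat \<le>
          ennreal (c2 * (rbar2 \<beta> \<sigma> n + exp (- c3 * real n * rbar2 \<beta> \<sigma> n / \<sigma>\<^sup>2)))"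
proof -
  have main: "ls_risk n \<sigma> x y yhat \<le>
          ennreal (1570 * (rbar2 \<beta> \<sigma> n + exp (- 1 * real n * rbar2 \<beta> \<sigma> n / \<sigma>\<^sup>2)))"
    if C0: "C0 > 0" and b: "b > 0" and \<sigma>: "\<sigma> > 0" and n: "n \<ge> 1" and x: "\<forall>i<n. x i \<in> {0..min 1 b}" and y0: "\<bar>y0\<bar> \<le> C0"
      and cases: "(\<exists>f. S1 \<beta> 1 {-(C0 + b)..C0 + b} f \<and> ode_sol_aut (min 1 b) y0 f y \<and>
            E = AH_dagger (min 1 b) (\<beta> + 2)) \<or>
       (\<exists>f. S2 \<beta> 1 0 1 (-(C0 + b)) (C0 + b) f \<and> ode_sol_nonaut (min 1 b) y0 f y \<and>
            E = H_dagger (min 1 b) (\<beta> + 2))"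
      and ls: "is_ls_estimator n x E yhat"
    for \<beta> n :: nat and C0 b \<sigma> :: real and x :: "nat \<Rightarrow> real" and y :: "real \<Rightarrow> real" and y0 :: real
      and yhat :: "(nat \<Rightarrow> real) \<Rightarrow> real \<Rightarrow> real" and E :: "(real \<Rightarrow> real) set"
  proof -
    define \<alpha> where "\<alpha> = min 1 b"
    define c :: "nat \<Rightarrow> real" where "c k = 2 ^ (k - 1) * fact (k - 1)" for k
    \<comment> \<open>The radii of the autonomous class are the smaller ones, so a single
      approximation bound with \<open>c\<close> serves both cases; closeness of \<open>y\<close> is
      still proved within \<open>E\<close> itself.\<close>
    have ES: "E \<subseteq> sob_class \<alpha> (\<beta> + 2) c"
      using cases
    proof (elim disjE exE conjE)
      assume "E = AH_dagger (min 1 b) (\<beta> + 2)"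
      then have "E = sob_class \<alpha> (\<beta> + 2) (\<lambda>k. fact (k - 1))" by (simp add: AH_dagger_def \<alpha>_def)
      also have "\<dots> \<subseteq> sob_class \<alpha> (\<beta> + 2) c"
        by (rule sob_class_mono) (auto simp: c_def mult_le_cancel_right1)
      finally show ?thesis .
    next
      assume "E = H_dagger (min 1 b) (\<beta> + 2)"
      moreover have "c = (\<lambda>k. 2 ^ (k - 1) * fact (k - 1))" by (simp add: c_def fun_eq_iff)
      ultimately show ?thesis by (simp add: H_dagger_def \<alpha>_def)
    qed
    have closure: "\<exists>h\<in>E. \<forall>i<n. \<bar>h (x i) - y (x i)\<bar> \<le> \<eta>" if \<eta>: "\<eta> > 0" for \<eta>
    proof -
      have "\<exists>h\<in>E. \<forall>t\<in>{0..min 1 b}. \<bar>h t - y t\<bar> \<le> \<eta>"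
        using cases
      proof (elim disjE exE conjE)
        fix f assume "S1 \<beta> 1 {-(C0 + b)..C0 + b} f" "ode_sol_aut (min 1 b) y0 f y" "E = AH_dagger (min 1 b) (\<beta> + 2)"
        then show ?thesis using aut_solution_in_closure[OF C0 b y0 _ _ \<eta>] by (simp add: AH_dagger_def)
      next
        fix f assume "S2 \<beta> 1 0 1 (-(C0 + b)) (C0 + b) f" "ode_sol_nonaut (min 1 b) y0 f y" "E = H_dagger (min 1 b) (\<beta> + 2)"
        then show ?thesis using nonaut_solution_in_closure[OF C0 b y0 _ _ \<eta>] by (simp add: H_dagger_def)
      qed
      then show ?thesis using x by blast
    qed
    note basic = least_squares_basic_inequality[OF n ls closure]
    define s where "s = \<sigma>\<^sup>2 / real n"
    have s0: "s > 0" using \<sigma> n by (simp add: s_def)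
    define v where "v \<gamma> = \<sigma>\<^sup>2 * real (max (min \<gamma> n) 1) / real n" for \<gamma> :: nat
    define \<rho> where "\<rho> \<gamma> = (2 ^ (\<gamma> + 1) * fact (\<gamma> + 1)) powr (2 / (2 * (real \<gamma> + 2) + 1)) *
        s powr (2 * (real \<gamma> + 2) / (2 * (real \<gamma> + 2) + 1))" for \<gamma> :: nat
    have rb: "rbar2 \<beta> \<sigma> n = Min ((\<lambda>\<gamma>. max (v \<gamma>) (\<rho> \<gamma>)) ` {0..\<beta>})"
      by (simp add: rbar2_def v_def \<rho>_def s_def)
    have "rbar2 \<beta> \<sigma> n \<in> (\<lambda>\<gamma>. max (v \<gamma>) (\<rho> \<gamma>)) ` {0..\<beta>}" unfolding rb by (rule Min_in) auto
    then obtain \<gamma> where \<gamma>: "\<gamma> \<le> \<beta>" "rbar2 \<beta> \<sigma> n = max (v \<gamma>) (\<rho> \<gamma>)" by auto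
    have v0: "v \<gamma> \<ge> 0" by (simp add: v_def)
    have risk: "ls_risk n \<sigma> x y yhat \<le> ennreal (1570 * max (v \<gamma>) (\<rho> \<gamma>))"
    proof (cases "n \<le> \<gamma>")
      case True
      then have "v \<gamma> = \<sigma>\<^sup>2" using n by (simp add: v_def)
      moreover have "ls_risk n \<sigma> x y yhat \<le> ennreal (4 * \<sigma>\<^sup>2)" by (rule ls_risk_trivial_bound[OF \<sigma> n basic])
      moreover have "4 * v \<gamma> \<le> 1570 * max (v \<gamma>) (\<rho> \<gamma>)" using v0 by (simp add: max_def)
      ultimately show ?thesis by (metis ennreal_leI order_trans)
    next
      case False
      define m where "m = \<gamma> + 2"
      have sm: "s * real m \<le> 3 * v \<gamma>"
      proof -
        \<comment> \<open>Since \<open>\<gamma> + 2\<close> is at most 3 when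
          \<open>\<gamma> \<le> 1\<close> and at most \<open>3 * \<gamma>\<close> otherwise.\<close>
        have "real m \<le> 3 * real (max \<gamma> 1)" by (simp add: m_def max_def)
        then have "s * real m \<le> s * (3 * real (max \<gamma> 1))" using s0 by (intro mult_left_mono) auto
        moreover have "v \<gamma> = s * real (max \<gamma> 1)" using False by (simp add: v_def s_def min_def)
        ultimately show ?thesis by simp
      qed
      obtain J :: nat where J: "J \<ge> 1" "s * real m * real J \<le> 8 * \<rho> \<gamma> + s * real m" "4 ^ m / real J ^ (2 * m) \<le> 4 * \<rho> \<gamma>"
        using resolution_choice[OF s0, of \<gamma>] unfolding \<rho>_def m_def by blast
      have sub: "sob_class \<alpha> (\<beta> + 2) c \<subseteq> sob_class \<alpha> m c"
        by (rule sob_class_mono) (use \<gamma>(1) in \<open>auto simp: m_def\<close>)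
      have "ls_risk n \<sigma> x y yhat \<le> ennreal (110 * (\<sigma>\<^sup>2 / n) * real m * real J + 90 * 4 ^ m / real J ^ (2 * m))"
      proof (rule ls_risk_bound_resolution[OF \<sigma> n J(1) _ _ _ _ _ _ basic])
        show "m \<ge> 2" "\<alpha> \<le> 1" by (auto simp: m_def \<alpha>_def)
        show "x i \<in> {0..\<alpha>}" if "i < n" for i using x that by (simp add: \<alpha>_def)
        show "c m = 2 ^ (m - 1) * fact (m - 1)" by (simp add: c_def)
        show "\<exists>h\<in>sob_class \<alpha> m c. \<forall>i<n. \<bar>h (x i) - y (x i)\<bar> \<le> \<eta>" if "\<eta> > 0" for \<eta>
          using closure[OF that] ES sub by blast
        show "yhat Y \<in> sob_class \<alpha> m c" for Y
          using ls ES sub unfolding is_ls_estimator_def by blast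
      qed
      also have "110 * (\<sigma>\<^sup>2 / n) * real m * real J + 90 * 4 ^ m / real J ^ (2 * m)
          = 110 * (s * real m * real J) + 90 * (4 ^ m / real J ^ (2 * m))" by (simp add: s_def)
      also have "ennreal \<dots> \<le> ennreal (1570 * max (v \<gamma>) (\<rho> \<gamma>))"
      proof (rule ennreal_leI)
        have "v \<gamma> \<le> max (v \<gamma>) (\<rho> \<gamma>)" "\<rho> \<gamma> \<le> max (v \<gamma>) (\<rho> \<gamma>)" by auto
        \<comment> \<open>110 * (8 \<open>\<rho>\<close> + 3 \<open>v\<close>) + 90 * 4
          \<open>\<rho>\<close> = 1240 \<open>\<rho>\<close> + 330 \<open>v\<close>, and 1240 + 330
          = 1570.\<close>
        then show "110 * (s * real m * real J) + 90 * (4 ^ m / real J ^ (2 * m)) \<le> 1570 * max (v \<gamma>) (\<rho> \<gamma>)"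
          using J(2,3) sm by linarith
      qed
      finally show ?thesis .
    qed
    also have "ennreal (1570 * max (v \<gamma>) (\<rho> \<gamma>)) \<le>
        ennreal (1570 * (rbar2 \<beta> \<sigma> n + exp (- 1 * real n * rbar2 \<beta> \<sigma> n / \<sigma>\<^sup>2)))"
      unfolding \<gamma>(2) by (intro ennreal_leI mult_left_mono) auto
    finally show ?thesis .
  qed
  show ?thesis
    by (intro exI[of _ 1] exI[of _ 1570] conjI allI impI zero_less_one main; (elim conjE)?; simp?)
qed

end
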